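(* Let $\Lambda$ be a finitely aligned $k$-graph and let $R$ be a commutative ring with $1$. Then $\operatorname{KP}_R(\Lambda)$ is simple if and only if $R$ is a field and $\Lambda$ is aperiodic and cofinal.
   Context: $\mathbb{N}$ contains $0$; for $m,n\in\mathbb{N}^k$ ($k\ge 1$), $m\le n$ and $m\vee n$ (maximum) are taken coordinatewise. A $k$-graph $\Lambda$ is a countable small category with a functor $d:\Lambda\to\mathbb{N}^k$ ($\mathbb{N}^k$ viewed as a category with one object) satisfying the factorisation property: if $d(\lambda)=m+n$ there are unique $\mu,\nu\in\Lambda$ with $\lambda=\mu\nu$, $d(\mu)=m$, $d(\nu)=n$; write $\lambda(0,m)=\mu$, $\lambda(m,m+n)=\nu$. $\Lambda^0$ denotes the objects (vertices), identified with the identity morphisms, i.e. the morphisms of degree $0$. $r(\lambda), s(\lambda)$ are the range (codomain) and source (domain); $\lambda\mu$ is defined when $s(\lambda)=r(\mu)$. $v\Lambda=\{\lambda\in\Lambda: r(\lambda)=v\}$; $\Lambda v=\{\lambda\in\Lambda:s(\lambda)=v\}$; $v\Lambda w=v\Lambda\cap\Lambda w$. For $\lambda,\mu\in\Lambda$, $\operatorname{MCE}(\lambda,\mu)$ is the set of $\tau\in\Lambda$ with $d(\tau)=d(\lambda)\vee d(\mu)$, $\tau(0,d(\lambda))=\lambda$, $\tau(0,d(\mu))=\mu$, and $\Lambda^{\min}(\lambda,\mu)=\{(\rho,\tau)\in\Lambda\times\Lambda:\lambda\rho=\mu\tau\in\operatorname{MCE}(\lambda,\mu)\}$. $\Lambda$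 is finitely aligned if every $\Lambda^{\min}(\lambda,\mu)$ is finite (possibly empty). A set $E\subseteq v\Lambda$ is exhaustive if for every $\lambda\in v\Lambda$ there is $\mu\in E$ with $\Lambda^{\min}(\lambda,\mu)\ne\emptyset$. $\operatorname{FE}(\Lambda)$ is the collection of all finite exhaustive sets $E\subseteq v\Lambda\setminus\{v\}$, $v\in\Lambda^0$; for such $E$, $r(E):=v$. Ghost paths: for each $\lambda\in\Lambda$ there is a formal symbol $\lambda^*$, with $v^*:=v$ for $v\in\Lambda^0$; $G(\Lambda^{\ne0})$ is the set of $\lambda^*$ with $\lambda\notin\Lambda^0$. $R$-algebras are associative and not assumed unital. A Kumjian-Pask $\Lambda$-family $\{S_\lambda,S_{\mu^*}:\lambda,\mu\in\Lambda\}$ in an $R$-algebra $A$ is a map $S:\Lambda\cup G(\Lambda^{\neq0})\to A$ such that: (KP1) $\{S_v:v\in\Lambda^0\}$ are mutually orthogonal idempotents; (KP2) if $s(\lambda)=r(\mu)$ then $S_\lambda S_\mu=S_{\lambda\mu}$ and $S_{\mu^*}S_{\lambda^*}=S_{(\lambda\mu)^*}$; (KP3) $S_{\lambda^*}S_\mu=\sum_{(\rho,\tau)\in\Lambda^{\min}(\lambda,\mu)}S_\rho S_{\tau^*}$ for all $\lambda,\mu\in\Lambda$ (empty sum is $0$); (KP4) $\prod_{\lambda\in E}(S_{r(E)}-S_\lambda S_{\lambda^*})=0$ for all $E\in\operatorname{FE}(\Lambda)$ (the factors commute as a consequence of (KP1)-(KP3)). $\operatorname{KP}_R(\Lambda)$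 is the universal $R$-algebra generated by a Kumjian-Pask $\Lambda$-family $\{s_\lambda,s_{\mu^*}\}$: every Kumjian-Pask $\Lambda$-family $S$ in an $R$-algebra $A$ induces a unique $R$-algebra homomorphism $\operatorname{KP}_R(\Lambda)\to A$ with $s_\lambda\mapsto S_\lambda$, $s_{\mu^*}\mapsto S_{\mu^*}$. Simple has its usual ring-theoretic meaning (no two-sided ideals other than $\{0\}$ and the whole algebra). Boundary paths: for $m\in(\mathbb{N}\cup\{\infty\})^k$, $\Omega_{k,m}=\{(p,q)\in\mathbb{N}^k\times\mathbb{N}^k:p\le q\le m\}$ is the $k$-graph with objects $\{p\in\mathbb{N}^k:p\le m\}$, $r(p,q)=p$, $s(p,q)=q$, $d(p,q)=q-p$. A boundary path of $\Lambda$ is a degree-preserving functor $x:\Omega_{k,m}\to\Lambda$ such that for every $n\in\mathbb{N}^k$ with $n\le m$ and every $E\in\operatorname{FE}(\Lambda)$ with $r(E)=x(n,n)$ there is $\lambda\in E$ with $n+d(\lambda)\le m$ and $x(n,n+d(\lambda))=\lambda$. Put $d(x)=m$, $x(n)=x(n,n)$, $r(x)=x(0)$; $\partial\Lambda$ is the set of boundary paths. For $\lambda\in\Lambda$ with $s(\lambda)=r(x)$, $\lambda x$ is the boundary path of degree $d(\lambda)+d(x)$ with $(\lambda x)(0,d(\lambda))=\lambda$ and $(\lambda x)(d(\lambda)+p,d(\lambda)+q)=x(p,q)$. A boundary path $x$ is aperiodic if for all $\lambda,\mu\in\Lambda r(x)$, $\lambda\ne\mu$ implies $\lambda x\neq\mu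 x$. $\Lambda$ is aperiodic if for each $v\in\Lambda^0$ there is an aperiodic boundary path $x$ with $r(x)=v$. $\Lambda$ is cofinal if for all $v\in\Lambda^0$ and $x\in\partial\Lambda$ there is $n\in\mathbb{N}^k$ with $n\le d(x)$ and $v\Lambda x(n)\neq\emptyset$. *)

theory Defs
  imports
    "HOL-Library.Function_Algebras"
    "HOL-Library.Extended_Nat"
    "HOL-Library.Countable_Set"
    "HOL-Library.FuncSet"
    "HOL-Library.Poly_Mapping"
begin

section \<open>Higher-rank graphs\<close>

text \<open>
  The monoid of degrees is the type \<^typ>\<open>'k \<Rightarrow> nat\<close> for a finite index type \<^typ>\<open>'k\<close>, with the
  pointwise addition, order and \<^const>\<open>sup\<close>.  Categories are given by their morphisms only: objects
  are identified with identity morphisms, so that range and source take values in morphisms.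
\<close>

record ('a, 'k) kgraph =
  mor :: "'a set"
  rng :: "'a \<Rightarrow> 'a"
  src :: "'a \<Rightarrow> 'a"
  cmp :: "'a \<Rightarrow> 'a \<Rightarrow> 'a"
  deg :: "'a \<Rightarrow> 'k \<Rightarrow> nat"

locale k_graph =
  fixes \<Lambda> :: "('a, 'k::finite) kgraph"
  assumes countable_mor: "countable (mor \<Lambda>)"
    and rng_mor: "\<alpha> \<in> mor \<Lambda> \<Longrightarrow> rng \<Lambda> \<alpha> \<in> mor \<Lambda>"
    and src_mor: "\<alpha> \<in> mor \<Lambda> \<Longrightarrow> src \<Lambda> \<alpha> \<in> mor \<Lambda>"
    and rng_rng: "\<alpha> \<in> mor \<Lambda> \<Longrightarrow> rng \<Lambda> (rng \<Lambda> \<alpha>) = rng \<Lambda> \<alpha>"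
    and src_rng: "\<alpha> \<in> mor \<Lambda> \<Longrightarrow> src \<Lambda> (rng \<Lambda> \<alpha>) = rng \<Lambda> \<alpha>"
    and rng_src: "\<alpha> \<in> mor \<Lambda> \<Longrightarrow> rng \<Lambda> (src \<Lambda> \<alpha>) = src \<Lambda> \<alpha>"
    and src_src: "\<alpha> \<in> mor \<Lambda> \<Longrightarrow> src \<Lambda> (src \<Lambda> \<alpha>) = src \<Lambda> \<alpha>"
    and cmp_mor: "\<lbrakk>\<alpha> \<in> mor \<Lambda>; \<mu> \<in> mor \<Lambda>; src \<Lambda> \<alpha> = rng \<Lambda> \<mu>\<rbrakk> \<Longrightarrow> cmp \<Lambda> \<alpha> \<mu> \<in> mor \<Lambda>"
    and rng_cmp: "\<lbrakk>\<alpha> \<in> mor \<Lambda>; \<mu> \<in> mor \<Lambda>; src \<Lambda> \<alpha> = rng \<Lambda> \<mu>\<rbrakk> \<Longrightarrow> rng \<Lambda> (cmp \<Lambda> \<alpha> \<mu>) = rng \<Lambda> \<alpha>"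
    and src_cmp: "\<lbrakk>\<alpha> \<in> mor \<Lambda>; \<mu> \<in> mor \<Lambda>; src \<Lambda> \<alpha> = rng \<Lambda> \<mu>\<rbrakk> \<Longrightarrow> src \<Lambda> (cmp \<Lambda> \<alpha> \<mu>) = src \<Lambda> \<mu>"
    and cmp_assoc: "\<lbrakk>\<alpha> \<in> mor \<Lambda>; \<mu> \<in> mor \<Lambda>; \<nu> \<in> mor \<Lambda>; src \<Lambda> \<alpha> = rng \<Lambda> \<mu>; src \<Lambda> \<mu> = rng \<Lambda> \<nu>\<rbrakk>
      \<Longrightarrow> cmp \<Lambda> (cmp \<Lambda> \<alpha> \<mu>) \<nu> = cmp \<Lambda> \<alpha> (cmp \<Lambda> \<mu> \<nu>)"
    and cmp_rng: "\<alpha> \<in> mor \<Lambda> \<Longrightarrow> cmp \<Lambda> (rng \<Lambda> \<alpha>) \<alpha> = \<alpha>"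
    and cmp_src: "\<alpha> \<in> mor \<Lambda> \<Longrightarrow> cmp \<Lambda> \<alpha> (src \<Lambda> \<alpha>) = \<alpha>"
    and deg_rng: "\<alpha> \<in> mor \<Lambda> \<Longrightarrow> deg \<Lambda> (rng \<Lambda> \<alpha>) = 0"
    and deg_src: "\<alpha> \<in> mor \<Lambda> \<Longrightarrow> deg \<Lambda> (src \<Lambda> \<alpha>) = 0"
    and deg_cmp: "\<lbrakk>\<alpha> \<in> mor \<Lambda>; \<mu> \<in> mor \<Lambda>; src \<Lambda> \<alpha> = rng \<Lambda> \<mu>\<rbrakk>
      \<Longrightarrow> deg \<Lambda> (cmp \<Lambda> \<alpha> \<mu>) = deg \<Lambda> \<alpha> + deg \<Lambda> \<mu>"
    and factorisation: "\<lbrakk>\<alpha> \<in> mor \<Lambda>; deg \<Lambda> \<alpha> = m + n\<rbrakk>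
      \<Longrightarrow> \<exists>!(\<mu>, \<nu>). \<mu> \<in> mor \<Lambda> \<and> \<nu> \<in> mor \<Lambda> \<and> src \<Lambda> \<mu> = rng \<Lambda> \<nu> \<and> \<alpha> = cmp \<Lambda> \<mu> \<nu>
            \<and> deg \<Lambda> \<mu> = m \<and> deg \<Lambda> \<nu> = n"

definition vertices :: "('a, 'k) kgraph \<Rightarrow> 'a set"
  where "vertices \<Lambda> = {v \<in> mor \<Lambda>. deg \<Lambda> v = 0}"

lemma (in k_graph) vertices_eq_identities: "vertices \<Lambda> = {v \<in> mor \<Lambda>. rng \<Lambda> v = v}"
proof -
  have "rng \<Lambda> v = v" if "v \<in> mor \<Lambda>" "deg \<Lambda> v = 0" for v
  proof -
    let ?P = "\<lambda>(\<mu>, \<nu>). \<mu> \<in> mor \<Lambda> \<and> \<nu> \<in> mor \<Lambda> \<and> src \<Lambda> \<mu> = rng \<Lambda> \<nu> \<and> v = cmp \<Lambda> \<mu> \<nu>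
      \<and> deg \<Lambda> \<mu> = 0 \<and> deg \<Lambda> \<nu> = 0"
    have "\<exists>!p. ?P p"
      using factorisation[of v 0 0] that by simp
    moreover have "?P (rng \<Lambda> v, v)" "?P (v, src \<Lambda> v)"
      using that by (simp_all add: rng_mor src_mor src_rng rng_src cmp_rng cmp_src deg_rng deg_src)
    ultimately have "(rng \<Lambda> v, v) = (v, src \<Lambda> v)"
      by blast
    then show ?thesis by simp
  qed
  then show ?thesis
    unfolding vertices_def by (metis (mono_tags, lifting) deg_rng Collect_cong)
qed

text \<open>\<open>initial_segment \<Lambda> \<alpha> m\<close> is the path \<open>\<alpha>(0, m)\<close>, meaningful for \<open>m \<le> d(\<alpha>)\<close>.\<close>

definition initial_segment :: "('a, 'k) kgraph \<Rightarrow> 'a \<Rightarrow> ('k \<Rightarrow> nat) \<Rightarrow> 'a"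
  where "initial_segment \<Lambda> \<alpha> m = (THE \<mu>. \<mu> \<in> mor \<Lambda> \<and> deg \<Lambda> \<mu> = m \<and>
           (\<exists>\<nu> \<in> mor \<Lambda>. src \<Lambda> \<mu> = rng \<Lambda> \<nu> \<and> \<alpha> = cmp \<Lambda> \<mu> \<nu>))"

definition MCE :: "('a, 'k) kgraph \<Rightarrow> 'a \<Rightarrow> 'a \<Rightarrow> 'a set"
  where "MCE \<Lambda> \<alpha> \<mu> = {\<tau> \<in> mor \<Lambda>. deg \<Lambda> \<tau> = sup (deg \<Lambda> \<alpha>) (deg \<Lambda> \<mu>) \<and>
           initial_segment \<Lambda> \<tau> (deg \<Lambda> \<alpha>) = \<alpha> \<and> initial_segment \<Lambda> \<tau> (deg \<Lambda> \<mu>) = \<mu>}"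

definition Lmin :: "('a, 'k) kgraph \<Rightarrow> 'a \<Rightarrow> 'a \<Rightarrow> ('a \<times> 'a) set"
  where "Lmin \<Lambda> \<alpha> \<mu> = {(\<rho>, \<tau>). \<rho> \<in> mor \<Lambda> \<and> \<tau> \<in> mor \<Lambda> \<and>
           src \<Lambda> \<alpha> = rng \<Lambda> \<rho> \<and> src \<Lambda> \<mu> = rng \<Lambda> \<tau> \<and>
           cmp \<Lambda> \<alpha> \<rho> = cmp \<Lambda> \<mu> \<tau> \<and> cmp \<Lambda> \<alpha> \<rho> \<in> MCE \<Lambda> \<alpha> \<mu>}"

definition finitely_aligned :: "('a, 'k) kgraph \<Rightarrow> bool"
  where "finitely_aligned \<Lambda> \<longleftrightarrow> (\<forall>\<alpha> \<in> mor \<Lambda>. \<forall>\<mu> \<in> mor \<Lambda>. finite (Lmin \<Lambda> \<alpha> \<mu>))"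

definition paths_to :: "('a, 'k) kgraph \<Rightarrow> 'a \<Rightarrow> 'a set"
  where "paths_to \<Lambda> v = {\<alpha> \<in> mor \<Lambda>. rng \<Lambda> \<alpha> = v}"

definition exhaustive :: "('a, 'k) kgraph \<Rightarrow> 'a \<Rightarrow> 'a set \<Rightarrow> bool"
  where "exhaustive \<Lambda> v E \<longleftrightarrow>
           E \<subseteq> paths_to \<Lambda> v \<and> (\<forall>\<alpha> \<in> paths_to \<Lambda> v. \<exists>\<mu> \<in> E. Lmin \<Lambda> \<alpha> \<mu> \<noteq> {})"

text \<open>\<open>FE \<Lambda> v\<close> consists of those \<open>E \<in> FE(\<Lambda>)\<close> for which \<open>r(E) = v\<close>.\<close>

definition FE :: "('a, 'k) kgraph \<Rightarrow> 'a \<Rightarrow> 'a set set"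
  where "FE \<Lambda> v = {E. finite E \<and> E \<subseteq> paths_to \<Lambda> v - {v} \<and> exhaustive \<Lambda> v E}"


section \<open>Boundary paths\<close>

abbreviation below :: "('k \<Rightarrow> nat) \<Rightarrow> ('k \<Rightarrow> enat) \<Rightarrow> bool"
  where "below n m \<equiv> (\<lambda>i. enat (n i)) \<le> m"

definition Omega :: "('k \<Rightarrow> enat) \<Rightarrow> (('k \<Rightarrow> nat) \<times> ('k \<Rightarrow> nat), 'k) kgraph"
  where "Omega m = \<lparr>
    mor = {(p, q). p \<le> q \<and> below q m},
    rng = (\<lambda>(p, q). (p, p)),
    src = (\<lambda>(p, q). (q, q)),
    cmp = (\<lambda>(p, q) (p', q'). (p, q')),
    deg = (\<lambda>(p, q). q - p)\<rparr>"

lemma Omega_simps [simp]: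
  "(p, q) \<in> mor (Omega m) \<longleftrightarrow> p \<le> q \<and> below q m"
  "rng (Omega m) (p, q) = (p, p)" "src (Omega m) (p, q) = (q, q)"
  "cmp (Omega m) (p, q) (p', q') = (p, q')" "deg (Omega m) (p, q) = q - p"
  by (simp_all add: Omega_def)

lemma below_trans: "p \<le> q \<Longrightarrow> below q m \<Longrightarrow> below p m"
  unfolding le_fun_def by (meson enat_ord_simps(1) order_trans)

lemma k_graph_Omega: "k_graph (Omega m :: (_, 'k::finite) kgraph)"
proof (unfold_locales, goal_cases)
  case 1
  show ?case by (rule countable_subset[OF subset_UNIV countableI_type])
next
  case (17 x a b)
  obtain p q where x: "x = (p, q)" by (cases x)
  have pq: "p \<le> q" "below q m" and eq: "q - p = a + b"
    using 17 by (simp_all add: x)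
  have q: "q i = p i + a i + b i" for i
    using fun_cong[OF eq, of i] le_funD[OF pq(1), of i] by (simp add: fun_diff_def)
  then have pa: "p + a \<le> q"
    by (simp add: le_fun_def)
  have below: "below (p + a) m"
    using pa pq(2) by (rule below_trans)
  show ?case
  proof (rule ex1I[of _ "((p, p + a), (p + a, q))"])
    fix z assume z: "case z of (\<mu>, \<nu>) \<Rightarrow> \<mu> \<in> mor (Omega m) \<and> \<nu> \<in> mor (Omega m) \<and>
      src (Omega m) \<mu> = rng (Omega m) \<nu> \<and> x = cmp (Omega m) \<mu> \<nu> \<and>
      deg (Omega m) \<mu> = a \<and> deg (Omega m) \<nu> = b"
    obtain p' r r' q' where [simp]: "z = ((p', r), (r', q'))" by (cases z) auto
    have "p' = p" "q' = q" "r' = r" "p \<le> r" "r - p = a"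
      using z by (auto simp: x)
    moreover have "r = p + a"
    proof
      fix i show "r i = (p + a) i"
        using fun_cong[OF \<open>r - p = a\<close>, of i] le_funD[OF \<open>p \<le> r\<close>, of i] by (simp add: fun_diff_def)
    qed
    ultimately show "z = ((p, p + a), (p + a, q))" by simp
  next
    have "(p + a) - p = a" "q - (p + a) = b" "p \<le> p + a"
      using q by (auto simp: fun_eq_iff le_fun_def)
    then show "case ((p, p + a), (p + a, q)) of (\<mu>, \<nu>) \<Rightarrow> \<mu> \<in> mor (Omega m) \<and> \<nu> \<in> mor (Omega m) \<and>
      src (Omega m) \<mu> = rng (Omega m) \<nu> \<and> x = cmp (Omega m) \<mu> \<nu> \<and>
      deg (Omega m) \<mu> = a \<and> deg (Omega m) \<nu> = b"
      using pa pq(2) below by (simp add: x)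
  qed
next
  case (16 x y)
  obtain p q r where "x = (p, q)" "y = (q, r)" "p \<le> q" "q \<le> r"
    using 16 by (cases x; cases y) simp
  then show ?case
    by (simp add: fun_eq_iff le_fun_def)
next
  case (2 x)
  then show ?case by (cases x) (auto dest: below_trans)
next
  case (8 x y)
  then show ?case by (cases x; cases y) (simp, blast intro: order_trans)
qed auto

definition degree_functor :: "('b, 'k) kgraph \<Rightarrow> ('a, 'k) kgraph \<Rightarrow> ('b \<Rightarrow> 'a) \<Rightarrow> bool"
  where "degree_functor \<Gamma> \<Lambda> f \<longleftrightarrow>
    (\<forall>\<gamma> \<in> mor \<Gamma>. f \<gamma> \<in> mor \<Lambda> \<and> deg \<Lambda> (f \<gamma>) = deg \<Gamma> \<gamma> \<and>
        rng \<Lambda> (f \<gamma>) = f (rng \<Gamma> \<gamma>) \<and> src \<Lambda> (f \<gamma>) = f (src \<Gamma> \<gamma>)) \<and>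
    (\<forall>\<gamma> \<in> mor \<Gamma>. \<forall>\<delta> \<in> mor \<Gamma>. src \<Gamma> \<gamma> = rng \<Gamma> \<delta> \<longrightarrow> f (cmp \<Gamma> \<gamma> \<delta>) = cmp \<Lambda> (f \<gamma>) (f \<delta>))"

record ('a, 'k) path =
  pdeg :: "'k \<Rightarrow> enat"
  pmap :: "('k \<Rightarrow> nat) \<times> ('k \<Rightarrow> nat) \<Rightarrow> 'a"

text \<open>
  Degree and extensionality of \<^const>\<open>pmap\<close> make HOL equality of \<^typ>\<open>('a, 'k) path\<close> coincide with
  equality of functors.
\<close>

definition graph_paths :: "('a, 'k) kgraph \<Rightarrow> ('a, 'k) path set"
  where "graph_paths \<Lambda> = {x. degree_functor (Omega (pdeg x)) \<Lambda> (pmap x) \<and>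
           pmap x \<in> extensional (mor (Omega (pdeg x)))}"

definition boundary_paths :: "('a, 'k) kgraph \<Rightarrow> ('a, 'k) path set"
  where "boundary_paths \<Lambda> = {x \<in> graph_paths \<Lambda>.
    \<forall>n. below n (pdeg x) \<longrightarrow> (\<forall>E \<in> FE \<Lambda> (pmap x (n, n)).
      \<exists>\<alpha> \<in> E. below (n + deg \<Lambda> \<alpha>) (pdeg x) \<and> pmap x (n, n + deg \<Lambda> \<alpha>) = \<alpha>)}"

abbreviation path_range :: "('a, 'k) path \<Rightarrow> 'a"
  where "path_range x \<equiv> pmap x (0, 0)"

text \<open>
  \<open>prepend \<Lambda> \<alpha> x\<close> is \<open>\<alpha>x\<close>, for \<open>s(\<alpha>) = r(x)\<close>.  The two equations determine a unique functor, by
  the factorisation property; it is a boundary path if \<open>x\<close> is one and \<open>\<Lambda>\<close> is finitely aligned.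
\<close>

definition prepend :: "('a, 'k) kgraph \<Rightarrow> 'a \<Rightarrow> ('a, 'k) path \<Rightarrow> ('a, 'k) path"
  where "prepend \<Lambda> \<alpha> x = (THE y. y \<in> graph_paths \<Lambda> \<and>
    pdeg y = (\<lambda>i. enat (deg \<Lambda> \<alpha> i) + pdeg x i) \<and>
    pmap y (0, deg \<Lambda> \<alpha>) = \<alpha> \<and>
    (\<forall>p q. p \<le> q \<and> below q (pdeg x) \<longrightarrow>
      pmap y (deg \<Lambda> \<alpha> + p, deg \<Lambda> \<alpha> + q) = pmap x (p, q)))"

definition aperiodic_path :: "('a, 'k) kgraph \<Rightarrow> ('a, 'k) path \<Rightarrow> bool"
  where "aperiodic_path \<Lambda> x \<longleftrightarrow>
    (\<forall>\<alpha> \<in> mor \<Lambda>. \<forall>\<mu> \<in> mor \<Lambda>. src \<Lambda> \<alpha> = path_range x \<longrightarrow> src \<Lambda> \<mu> = path_range x \<longrightarrow>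
      \<alpha> \<noteq> \<mu> \<longrightarrow> prepend \<Lambda> \<alpha> x \<noteq> prepend \<Lambda> \<mu> x)"

definition aperiodic_graph :: "('a, 'k) kgraph \<Rightarrow> bool"
  where "aperiodic_graph \<Lambda> \<longleftrightarrow>
    (\<forall>v \<in> vertices \<Lambda>. \<exists>x \<in> boundary_paths \<Lambda>. path_range x = v \<and> aperiodic_path \<Lambda> x)"

definition cofinal_graph :: "('a, 'k) kgraph \<Rightarrow> bool"
  where "cofinal_graph \<Lambda> \<longleftrightarrow>
    (\<forall>v \<in> vertices \<Lambda>. \<forall>x \<in> boundary_paths \<Lambda>. \<exists>n. below n (pdeg x) \<and>
      {\<alpha> \<in> mor \<Lambda>. rng \<Lambda> \<alpha> = v \<and> src \<Lambda> \<alpha> = pmap x (n, n)} \<noteq> {})"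


section \<open>Associative algebras without unit\<close>

record ('r, 'b) nualgebra =
  carrier :: "'b set"
  azero :: 'b
  aadd :: "'b \<Rightarrow> 'b \<Rightarrow> 'b"
  amult :: "'b \<Rightarrow> 'b \<Rightarrow> 'b"
  ascale :: "'r \<Rightarrow> 'b \<Rightarrow> 'b"

locale nonunital_algebra =
  fixes A :: "('r::comm_ring_1, 'b) nualgebra"
  assumes zero_closed: "azero A \<in> carrier A"
    and add_closed: "\<lbrakk>x \<in> carrier A; y \<in> carrier A\<rbrakk> \<Longrightarrow> aadd A x y \<in> carrier A"
    and mult_closed: "\<lbrakk>x \<in> carrier A; y \<in> carrier A\<rbrakk> \<Longrightarrow> amult A x y \<in> carrier A"
    and scale_closed: "x \<in> carrier A \<Longrightarrow> ascale A c x \<in> carrier A"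
    and add_assoc: "\<lbrakk>x \<in> carrier A; y \<in> carrier A; z \<in> carrier A\<rbrakk>
      \<Longrightarrow> aadd A (aadd A x y) z = aadd A x (aadd A y z)"
    and add_comm: "\<lbrakk>x \<in> carrier A; y \<in> carrier A\<rbrakk> \<Longrightarrow> aadd A x y = aadd A y x"
    and add_zero: "x \<in> carrier A \<Longrightarrow> aadd A (azero A) x = x"
    and add_inverse: "x \<in> carrier A \<Longrightarrow> \<exists>y \<in> carrier A. aadd A x y = azero A"
    and mult_assoc: "\<lbrakk>x \<in> carrier A; y \<in> carrier A; z \<in> carrier A\<rbrakk>
      \<Longrightarrow> amult A (amult A x y) z = amult A x (amult A y z)"
    and distrib_left: "\<lbrakk>x \<in> carrier A; y \<in> carrier A; z \<in> carrier A\<rbrakk>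
      \<Longrightarrow> amult A x (aadd A y z) = aadd A (amult A x y) (amult A x z)"
    and distrib_right: "\<lbrakk>x \<in> carrier A; y \<in> carrier A; z \<in> carrier A\<rbrakk>
      \<Longrightarrow> amult A (aadd A x y) z = aadd A (amult A x z) (amult A y z)"
    and scale_add: "\<lbrakk>x \<in> carrier A; y \<in> carrier A\<rbrakk>
      \<Longrightarrow> ascale A c (aadd A x y) = aadd A (ascale A c x) (ascale A c y)"
    and add_scale: "x \<in> carrier A \<Longrightarrow> ascale A (c + d) x = aadd A (ascale A c x) (ascale A d x)"
    and scale_scale: "x \<in> carrier A \<Longrightarrow> ascale A c (ascale A d x) = ascale A (c * d) x"
    and scale_one: "x \<in> carrier A \<Longrightarrow> ascale A 1 x = x"
    and scale_mult_left: "\<lbrakk>x \<in> carrier A; y \<in> carrier A\<rbrakk>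
      \<Longrightarrow> amult A (ascale A c x) y = ascale A c (amult A x y)"
    and scale_mult_right: "\<lbrakk>x \<in> carrier A; y \<in> carrier A\<rbrakk>
      \<Longrightarrow> amult A x (ascale A c y) = ascale A c (amult A x y)"

definition two_sided_ideal :: "('r, 'b) nualgebra \<Rightarrow> 'b set \<Rightarrow> bool"
  where "two_sided_ideal A I \<longleftrightarrow> I \<subseteq> carrier A \<and> azero A \<in> I \<and>
    (\<forall>x \<in> I. \<forall>y \<in> I. aadd A x y \<in> I) \<and>
    (\<forall>x \<in> I. \<exists>y \<in> I. aadd A x y = azero A) \<and>
    (\<forall>x \<in> I. \<forall>a \<in> carrier A. amult A a x \<in> I \<and> amult A x a \<in> I)"

definition simple_algebra :: "('r, 'b) nualgebra \<Rightarrow> bool"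
  where "simple_algebra A \<longleftrightarrow> (\<forall>I. two_sided_ideal A I \<longrightarrow> I = {azero A} \<or> I = carrier A)"

text \<open>
  Quotients of algebras are taken by two-sided ideals that are moreover closed under scalars, which
  is not automatic in the absence of a unit.
\<close>

definition algebra_ideal :: "('r, 'b) nualgebra \<Rightarrow> 'b set \<Rightarrow> bool"
  where "algebra_ideal A I \<longleftrightarrow> two_sided_ideal A I \<and> (\<forall>c. \<forall>x \<in> I. ascale A c x \<in> I)"

definition ideal_generated :: "('r, 'b) nualgebra \<Rightarrow> 'b set \<Rightarrow> 'b set"
  where "ideal_generated A X = \<Inter>{I. algebra_ideal A I \<and> X \<subseteq> I}"

definition acoset :: "('r, 'b) nualgebra \<Rightarrow> 'b set \<Rightarrow> 'b \<Rightarrow> 'b set"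
  where "acoset A I x = {aadd A x i | i. i \<in> I}"

definition quotient_algebra :: "('r, 'b) nualgebra \<Rightarrow> 'b set \<Rightarrow> ('r, 'b set) nualgebra"
  where "quotient_algebra A I = \<lparr>
    carrier = acoset A I ` carrier A,
    azero = acoset A I (azero A),
    aadd = (\<lambda>X Y. \<Union>x \<in> X. \<Union>y \<in> Y. acoset A I (aadd A x y)),
    amult = (\<lambda>X Y. \<Union>x \<in> X. \<Union>y \<in> Y. acoset A I (amult A x y)),
    ascale = (\<lambda>c X. \<Union>x \<in> X. acoset A I (ascale A c x))\<rparr>"

text \<open>
  The free algebra on a set \<open>X\<close> of letters has the nonempty words in \<open>X\<close> as a basis.  The ambient
  type of finitely supported functions on all words is the free algebra with unit.
\<close>

datatype 'g word = Word (letters: "'g list")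

instantiation word :: (type) monoid_add
begin

definition zero_word :: "'a word" where "0 = Word []"

definition plus_word :: "'a word \<Rightarrow> 'a word \<Rightarrow> 'a word"
  where "u + v = Word (letters u @ letters v)"

instance
  by standard (simp_all add: zero_word_def plus_word_def)

end

definition free_algebra :: "'g set \<Rightarrow> ('r::comm_ring_1, 'g word \<Rightarrow>\<^sub>0 'r) nualgebra"
  where "free_algebra X = \<lparr>
    carrier = {p. \<forall>w \<in> Poly_Mapping.keys p. w \<noteq> 0 \<and> set (letters w) \<subseteq> X},
    azero = 0,
    aadd = (+),
    amult = (*),
    ascale = (\<lambda>c. Poly_Mapping.map ((*) c))\<rparr>"


section \<open>Kumjian--Pask algebras\<close>

datatype 'a gen = Path 'a | Ghost 'a

definition kp_generators :: "('a, 'k) kgraph \<Rightarrow> 'a gen set"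
  where "kp_generators \<Lambda> = Path ` mor \<Lambda> \<union> Ghost ` (mor \<Lambda> - vertices \<Lambda>)"

text \<open>The symbol \<open>\<alpha>\<^sup>*\<close>, which is \<open>\<alpha>\<close> itself if \<open>\<lambda>\<close> is a vertex.\<close>

definition ghost :: "('a, 'k) kgraph \<Rightarrow> 'a \<Rightarrow> 'a gen"
  where "ghost \<Lambda> \<alpha> = (if \<alpha> \<in> vertices \<Lambda> then Path \<alpha> else Ghost \<alpha>)"

text \<open>Products of nonempty lists, as there need not be a unit.\<close>

fun nprod :: "'b::semigroup_mult list \<Rightarrow> 'b" where
  "nprod [x] = x"
| "nprod (x # y # zs) = x * nprod (y # zs)"

text \<open>
  The elements whose vanishing says that \<open>S\<close> is a Kumjian--Pask family.  Since the factors in (KP4)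
  commute only as a consequence of (KP1)--(KP3), the product is taken in every order; it is never
  empty because exhaustive sets are nonempty.
\<close>

inductive_set kp_relators :: "('a, 'k) kgraph \<Rightarrow> ('a gen \<Rightarrow> 'b::ring) \<Rightarrow> 'b set"
  for \<Lambda> :: "('a, 'k) kgraph" and S :: "'a gen \<Rightarrow> 'b" where
  KP1_idem: "v \<in> vertices \<Lambda> \<Longrightarrow> S (Path v) * S (Path v) - S (Path v) \<in> kp_relators \<Lambda> S"
| KP1_orth: "\<lbrakk>v \<in> vertices \<Lambda>; w \<in> vertices \<Lambda>; v \<noteq> w\<rbrakk>
    \<Longrightarrow> S (Path v) * S (Path w) \<in> kp_relators \<Lambda> S"
| KP2_path: "\<lbrakk>\<alpha> \<in> mor \<Lambda>; \<mu> \<in> mor \<Lambda>; src \<Lambda> \<alpha> = rng \<Lambda> \<mu>\<rbrakk>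
    \<Longrightarrow> S (Path \<alpha>) * S (Path \<mu>) - S (Path (cmp \<Lambda> \<alpha> \<mu>)) \<in> kp_relators \<Lambda> S"
| KP2_ghost: "\<lbrakk>\<alpha> \<in> mor \<Lambda>; \<mu> \<in> mor \<Lambda>; src \<Lambda> \<alpha> = rng \<Lambda> \<mu>\<rbrakk>
    \<Longrightarrow> S (ghost \<Lambda> \<mu>) * S (ghost \<Lambda> \<alpha>) - S (ghost \<Lambda> (cmp \<Lambda> \<alpha> \<mu>)) \<in> kp_relators \<Lambda> S"
| KP3: "\<lbrakk>\<alpha> \<in> mor \<Lambda>; \<mu> \<in> mor \<Lambda>\<rbrakk>
    \<Longrightarrow> S (ghost \<Lambda> \<alpha>) * S (Path \<mu>) - (\<Sum>(\<rho>, \<tau>) \<in> Lmin \<Lambda> \<alpha> \<mu>. S (Path \<rho>) * S (ghost \<Lambda> \<tau>))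
      \<in> kp_relators \<Lambda> S"
| KP4: "\<lbrakk>v \<in> vertices \<Lambda>; set ls \<in> FE \<Lambda> v; distinct ls\<rbrakk>
    \<Longrightarrow> nprod (map (\<lambda>\<alpha>. S (Path v) - S (Path \<alpha>) * S (ghost \<Lambda> \<alpha>)) ls) \<in> kp_relators \<Lambda> S"

definition kp_family :: "('a, 'k) kgraph \<Rightarrow> ('a gen \<Rightarrow> 'b::ring) \<Rightarrow> bool"
  where "kp_family \<Lambda> S \<longleftrightarrow> (\<forall>x \<in> kp_relators \<Lambda> S. x = 0)"

definition free_gen :: "'g \<Rightarrow> ('g word \<Rightarrow>\<^sub>0 'r::comm_ring_1)"
  where "free_gen g = Poly_Mapping.single (Word [g]) 1"

abbreviation kp_free :: "('a, 'k) kgraph \<Rightarrow> ('r::comm_ring_1, 'a gen word \<Rightarrow>\<^sub>0 'r) nualgebra"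
  where "kp_free \<Lambda> \<equiv> free_algebra (kp_generators \<Lambda>)"

definition kp_ideal :: "('a, 'k) kgraph \<Rightarrow> ('a gen word \<Rightarrow>\<^sub>0 'r::comm_ring_1) set"
  where "kp_ideal \<Lambda> = ideal_generated (kp_free \<Lambda>) (kp_relators \<Lambda> free_gen)"

definition kumjian_pask ::
    "('a, 'k) kgraph \<Rightarrow> ('r::comm_ring_1, ('a gen word \<Rightarrow>\<^sub>0 'r) set) nualgebra"
  where "kumjian_pask \<Lambda> = quotient_algebra (kp_free \<Lambda>) (kp_ideal \<Lambda>)"

section \<open>The universal property\<close>

lemma scale_conv_mult: "ascale (free_algebra X) c p = Poly_Mapping.single 0 c * p"
  by (simp add: free_algebra_def Poly_Mapping.mult_map_scale_conv_mult)

lemma poly_mapping_monomials: "(p :: 'a \<Rightarrow>\<^sub>0 'b::comm_monoid_add) =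
    (\<Sum>k \<in> Poly_Mapping.keys p. Poly_Mapping.single k (Poly_Mapping.lookup p k))"
  by (rule poly_mapping_eqI)
    (auto simp: lookup_sum lookup_single when_def sum.delta' in_keys_iff
        if_distrib cong: if_cong)

lemma single_zero_central:
  fixes p :: "'g::monoid_add \<Rightarrow>\<^sub>0 'r::comm_ring_1"
  shows "p * Poly_Mapping.single 0 c = Poly_Mapping.single 0 c * p"
proof -
  have "Poly_Mapping.single k d * Poly_Mapping.single 0 c
      = Poly_Mapping.single 0 c * Poly_Mapping.single k d" for k :: 'g and d
    by (simp add: mult_single mult.commute)
  then show ?thesis
    by (subst (1 2) poly_mapping_monomials[of p]) (simp only: sum_distrib_left sum_distrib_right)
qed

lemma word_add_eq_0_iff: "(u :: 'g word) + v = 0 \<longleftrightarrow> u = 0 \<and> v = 0"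
  by (cases u; cases v) (auto simp: plus_word_def zero_word_def)

lemma letters_add: "letters (u + v) = letters u @ letters v"
  by (simp add: plus_word_def)

lemma free_algebra_closed:
  fixes p q :: "'g word \<Rightarrow>\<^sub>0 'r::comm_ring_1" and X :: "'g set"
  defines "C \<equiv> carrier (free_algebra X :: ('r, 'g word \<Rightarrow>\<^sub>0 'r) nualgebra)"
  shows "0 \<in> C"
    and "p \<in> C \<Longrightarrow> q \<in> C \<Longrightarrow> p + q \<in> C"
    and "p \<in> C \<Longrightarrow> - p \<in> C"
    and "p \<in> C \<Longrightarrow> q \<in> C \<Longrightarrow> p - q \<in> C"
    and "p \<in> C \<Longrightarrow> q \<in> C \<Longrightarrow> p * q \<in> C"
    and "p \<in> C \<Longrightarrow> Poly_Mapping.single 0 c * p \<in> C"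
proof -
  show "0 \<in> C" by (simp add: C_def free_algebra_def)
  show add: "p + q \<in> C" if "p \<in> C" "q \<in> C" for p q
    using that Poly_Mapping.keys_add[of p q] by (auto simp: C_def free_algebra_def)
  show minus: "- p \<in> C" if "p \<in> C" for p
    using that by (auto simp: C_def free_algebra_def in_keys_iff)
  show "p - q \<in> C" if "p \<in> C" "q \<in> C"
    using add[OF that(1) minus[OF that(2)]] by simp
  show "p * q \<in> C" if "p \<in> C" "q \<in> C"
  proof -
    have "w \<noteq> 0 \<and> set (letters w) \<subseteq> X" if "w \<in> Poly_Mapping.keys (p * q)" for w
    proof -
      obtain u v where "w = u + v" "u \<in> Poly_Mapping.keys p" "v \<in> Poly_Mapping.keys q"
        using keys_mult[of p q] \<open>w \<in> _\<close> by blast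
      then show ?thesis
        using \<open>p \<in> C\<close> \<open>q \<in> C\<close>
        by (auto simp: C_def free_algebra_def word_add_eq_0_iff letters_add)
    qed
    then show ?thesis by (simp add: C_def free_algebra_def)
  qed
  show "Poly_Mapping.single 0 c * p \<in> C" if "p \<in> C"
  proof -
    have "Poly_Mapping.keys (Poly_Mapping.single 0 c * p) \<subseteq> Poly_Mapping.keys p"
      using keys_mult[of "Poly_Mapping.single 0 c" p] by (auto split: if_splits)
    then show ?thesis using that by (auto simp: C_def free_algebra_def)
  qed
qed

lemma free_algebra_ops [simp]:
  "azero (free_algebra X) = 0" "aadd (free_algebra X) = (+)" "amult (free_algebra X) = (*)"
  by (simp_all add: free_algebra_def)

lemma nonunital_algebra_free: "nonunital_algebra (free_algebra X :: ('r::comm_ring_1, _) nualgebra)"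
proof (unfold_locales, goal_cases)
  case 8
  then show ?case by (metis free_algebra_closed(3) free_algebra_ops(1,2) add.right_inverse)
next
  case (17 x y c)
  have "x * (Poly_Mapping.single 0 c * y) = Poly_Mapping.single 0 c * (x * y)"
    by (metis mult.assoc single_zero_central)
  then show ?case by (simp add: scale_conv_mult)
next
  case (14 x c d)
  have "Poly_Mapping.single 0 c * (Poly_Mapping.single 0 d * x) = Poly_Mapping.single 0 (c * d) * x"
    by (simp add: mult_single flip: mult.assoc)
  then show ?case by (simp add: scale_conv_mult)
qed (simp_all add: scale_conv_mult free_algebra_closed distrib_left distrib_right single_add
    mult.assoc add.assoc add.commute)


context
  fixes X :: "'g set" and I :: "('g word \<Rightarrow>\<^sub>0 'r::comm_ring_1) set"
  assumes I: "algebra_ideal (free_algebra X) I"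
begin

private abbreviation (input) "F \<equiv> free_algebra X :: ('r, 'g word \<Rightarrow>\<^sub>0 'r) nualgebra"
private abbreviation (input) "cst \<equiv> acoset F I"

lemma ideal_free_closed:
  shows "I \<subseteq> carrier F" "0 \<in> I"
    and "x \<in> I \<Longrightarrow> y \<in> I \<Longrightarrow> x + y \<in> I"
    and "x \<in> I \<Longrightarrow> - x \<in> I"
    and "x \<in> I \<Longrightarrow> a \<in> carrier F \<Longrightarrow> a * x \<in> I"
    and "x \<in> I \<Longrightarrow> a \<in> carrier F \<Longrightarrow> x * a \<in> I"
    and "x \<in> I \<Longrightarrow> ascale F c x \<in> I"
  using I unfolding algebra_ideal_def two_sided_ideal_def
  by (auto simp: minus_unique)

lemma ideal_free_diff: "x \<in> I \<Longrightarrow> y \<in> I \<Longrightarrow> x - y \<in> I"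
  using ideal_free_closed(3)[of x "- y"] ideal_free_closed(4)[of y] by simp

lemma mem_acoset_free: "y \<in> cst x \<longleftrightarrow> y - x \<in> I"
  by (auto simp: acoset_def) (metis diff_add_cancel add.commute)

lemma acoset_free_self: "x \<in> cst x"
  by (simp add: mem_acoset_free ideal_free_closed)

lemma acoset_free_eqI:
  assumes "x - y \<in> I" shows "cst x = cst y"
proof -
  have "z - x \<in> I \<longleftrightarrow> z - y \<in> I" for z
    using ideal_free_closed(3)[of "z - x" "x - y"] ideal_free_diff[of "z - y" "x - y"] assms by auto
  then show ?thesis by (auto simp: mem_acoset_free)
qed

lemma acoset_free_eq_iff: "cst x = cst y \<longleftrightarrow> x - y \<in> I"
  using acoset_free_eqI acoset_free_self[of x] by (auto simp: mem_acoset_free)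

lemma acoset_free_carrier: "y \<in> cst x \<Longrightarrow> x \<in> carrier F \<Longrightarrow> y \<in> carrier F"
  using free_algebra_closed(2)[of x X "y - x"] ideal_free_closed(1) by (auto simp: mem_acoset_free)

lemma quotient_free_ops:
  assumes "x \<in> carrier F" "y \<in> carrier F"
  shows "aadd (quotient_algebra F I) (cst x) (cst y) = cst (x + y)"
    and "amult (quotient_algebra F I) (cst x) (cst y) = cst (x * y)"
    and "ascale (quotient_algebra F I) c (cst x) = cst (ascale F c x)"
proof -
  have add: "cst (a + b) = cst (x + y)" if "a \<in> cst x" "b \<in> cst y" for a b
  proof -
    have "a + b - (x + y) = (a - x) + (b - y)"
      by simp
    also have "\<dots> \<in> I"
      using that unfolding mem_acoset_free by (rule ideal_free_closed(3))
    finally show ?thesis by (rule acoset_free_eqI)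
  qed
  have "(\<Union>a \<in> cst x. \<Union>b \<in> cst y. cst (a + b)) = (\<Union>a \<in> cst x. \<Union>b \<in> cst y. cst (x + y))"
    by (intro SUP_cong refl add)
  also have "\<dots> = cst (x + y)"
    using acoset_free_self by blast
  finally show "aadd (quotient_algebra F I) (cst x) (cst y) = cst (x + y)"
    by (simp add: quotient_algebra_def)
  have mult: "cst (a * b) = cst (x * y)" if "a \<in> cst x" "b \<in> cst y" for a b
  proof -
    have "a * b - x * y = (a - x) * b + x * (b - y)"
      by (simp add: algebra_simps)
    also have "\<dots> \<in> I"
      using that acoset_free_carrier[OF that(2) assms(2)] assms(1) unfolding mem_acoset_free
      by (intro ideal_free_closed(3) ideal_free_closed(5) ideal_free_closed(6))
    finally show ?thesis by (rule acoset_free_eqI)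
  qed
  have "(\<Union>a \<in> cst x. \<Union>b \<in> cst y. cst (a * b)) = (\<Union>a \<in> cst x. \<Union>b \<in> cst y. cst (x * y))"
    by (intro SUP_cong refl mult)
  also have "\<dots> = cst (x * y)"
    using acoset_free_self by blast
  finally show "amult (quotient_algebra F I) (cst x) (cst y) = cst (x * y)"
    by (simp add: quotient_algebra_def)
  have scale: "cst (ascale F c a) = cst (ascale F c x)" if "a \<in> cst x" for a
  proof -
    have "ascale F c a - ascale F c x = ascale F c (a - x)"
      by (simp add: scale_conv_mult right_diff_distrib)
    also have "\<dots> \<in> I"
      using that unfolding mem_acoset_free by (rule ideal_free_closed(7))
    finally show ?thesis by (rule acoset_free_eqI)
  qed
  have "(\<Union>a \<in> cst x. cst (ascale F c a)) = (\<Union>a \<in> cst x. cst (ascale F c x))"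
    by (intro SUP_cong refl scale)
  also have "\<dots> = cst (ascale F c x)"
    using acoset_free_self by blast
  finally show "ascale (quotient_algebra F I) c (cst x) = cst (ascale F c x)"
    by (simp add: quotient_algebra_def)
qed

lemma nonunital_algebra_quotient_free: "nonunital_algebra (quotient_algebra F I)"
proof -
  interpret F: nonunital_algebra F by (rule nonunital_algebra_free)
  have c: "carrier (quotient_algebra F I) = cst ` carrier F"
    and z: "azero (quotient_algebra F I) = cst 0"
    by (simp_all add: quotient_algebra_def)
  have inv: "\<exists>y\<in>carrier F. cst (x + y) = cst 0" if "x \<in> carrier F" for x
    using free_algebra_closed(3)[OF that] by (intro bexI[of _ "- x"]) simp_all
  show ?thesis
    by standard
      (auto simp: c z quotient_free_ops inv F.scale_closed F.scale_add F.add_scale F.scale_scale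
        F.scale_one F.scale_mult_left[simplified] F.scale_mult_right[simplified]
        free_algebra_closed F.scale_add[simplified] F.add_scale[simplified]
        algebra_simps intro: imageI)
qed

end

lemma algebra_ideal_generated:
  assumes "nonunital_algebra A" "X \<subseteq> carrier A"
  shows "algebra_ideal A (ideal_generated A X)" "X \<subseteq> ideal_generated A X"
    "algebra_ideal A J \<Longrightarrow> X \<subseteq> J \<Longrightarrow> ideal_generated A X \<subseteq> J"
proof -
  interpret nonunital_algebra A by fact
  show "X \<subseteq> ideal_generated A X" "algebra_ideal A J \<Longrightarrow> X \<subseteq> J \<Longrightarrow> ideal_generated A X \<subseteq> J"
    by (auto simp: ideal_generated_def)
  have top: "algebra_ideal A (carrier A)"
    using add_inverse by (auto simp: algebra_ideal_def two_sided_ideal_def zero_closed add_closed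
      mult_closed scale_closed)
  have inv: "\<exists>y\<in>ideal_generated A X. aadd A x y = azero A" if x: "x \<in> ideal_generated A X" for x
  proof -
    have xc: "x \<in> carrier A" using x top assms(2) by (auto simp: ideal_generated_def)
    obtain y where y: "y \<in> carrier A" "aadd A x y = azero A" using add_inverse[OF xc] by blast
    have "y \<in> J" if J: "algebra_ideal A J" "X \<subseteq> J" for J
    proof -
      have "x \<in> J" using x J by (auto simp: ideal_generated_def)
      then obtain y' where y': "y' \<in> J" "aadd A x y' = azero A" "y' \<in> carrier A"
        using J unfolding algebra_ideal_def two_sided_ideal_def by blast
      have "y' = y"
        by (metis y y' xc add_assoc add_comm add_zero)
      then show ?thesis using y' by simp
    qed
    then show ?thesis using y by (auto simp: ideal_generated_def)
  qed
  show "algebra_ideal A (ideal_generated A X)"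
    unfolding algebra_ideal_def two_sided_ideal_def
  proof (intro conjI ballI allI)
    show "ideal_generated A X \<subseteq> carrier A" using top assms(2) by (auto simp: ideal_generated_def)
  qed (use inv in \<open>auto simp: ideal_generated_def algebra_ideal_def two_sided_ideal_def\<close>)
qed

lemma nprod_closed:
  assumes "\<And>x y. x \<in> C \<Longrightarrow> y \<in> C \<Longrightarrow> x * y \<in> C"
  shows "xs \<noteq> [] \<Longrightarrow> set xs \<subseteq> C \<Longrightarrow> nprod xs \<in> C"
  by (induction xs rule: nprod.induct) (auto intro: assms)

lemma FE_nonempty: assumes "v \<in> vertices \<Lambda>" "k_graph \<Lambda>" shows "{} \<notin> FE \<Lambda> v"
proof -
  interpret k_graph \<Lambda> by fact
  have "v \<in> paths_to \<Lambda> v"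
    using assms(1) vertices_eq_identities by (auto simp: paths_to_def)
  then show ?thesis by (auto simp: FE_def exhaustive_def)
qed

lemma free_gen_closed: "g \<in> X \<Longrightarrow> free_gen g \<in> carrier (free_algebra X)"
  by (auto simp: free_gen_def free_algebra_def zero_word_def)

lemma kp_generatorsI:
  "\<alpha> \<in> mor \<Lambda> \<Longrightarrow> Path \<alpha> \<in> kp_generators \<Lambda>" "\<alpha> \<in> mor \<Lambda> \<Longrightarrow> ghost \<Lambda> \<alpha> \<in> kp_generators \<Lambda>"
  by (auto simp: kp_generators_def ghost_def)

lemma kp_relators_closed:
  assumes "k_graph \<Lambda>"
  shows "kp_relators \<Lambda> free_gen \<subseteq> carrier (kp_free \<Lambda> :: ('r::comm_ring_1, _) nualgebra)"
proof
  interpret k_graph \<Lambda> by fact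
  let ?C = "carrier (kp_free \<Lambda> :: ('r, _) nualgebra)"
  have *: "free_gen (Path \<alpha>) \<in> ?C" "free_gen (ghost \<Lambda> \<alpha>) \<in> ?C" if "\<alpha> \<in> mor \<Lambda>" for \<alpha>
    using that by (simp_all add: free_gen_closed kp_generatorsI)
  have v: "v \<in> mor \<Lambda>" if "v \<in> vertices \<Lambda>" for v using that by (simp add: vertices_def)
  have sum: "(\<Sum>x \<in> L. f x) \<in> ?C" if "\<And>x. x \<in> L \<Longrightarrow> f x \<in> ?C" for L :: "('a \<times> 'a) set" and f
    using that by (induction L rule: infinite_finite_induct) (auto intro: free_algebra_closed)
  fix x :: "'a gen word \<Rightarrow>\<^sub>0 'r"
  assume "x \<in> kp_relators \<Lambda> free_gen"
  then show "x \<in> ?C"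
  proof cases
    case (KP3 \<alpha> \<mu>)
    then show ?thesis
      by (auto intro!: free_algebra_closed * sum simp: Lmin_def)
  next
    case (KP4 w ls)
    then have "ls \<noteq> []" "set ls \<subseteq> mor \<Lambda>"
      using FE_nonempty[of w \<Lambda>] assms by (auto simp: FE_def paths_to_def)
    then show ?thesis unfolding KP4
      using KP4 v by (intro nprod_closed) (auto intro!: free_algebra_closed *)
  qed (auto intro!: free_algebra_closed * cmp_mor dest: v)
qed

lemma nonunital_algebra_kumjian_pask:
  "k_graph \<Lambda> \<Longrightarrow> nonunital_algebra (kumjian_pask \<Lambda>)"
  unfolding kumjian_pask_def kp_ideal_def
  by (intro nonunital_algebra_quotient_free algebra_ideal_generated nonunital_algebra_free
      kp_relators_closed)


text \<open>
  An algebra over \<open>'r\<close> whose underlying set is a whole type is a \<^class>\<open>ring\<close> (which need not have a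
  unit) with a compatible scalar multiplication.
\<close>

locale type_algebra = module scale for scale :: "'r::comm_ring_1 \<Rightarrow> 'b::ring \<Rightarrow> 'b" +
  assumes scale_times_left: "scale c x * y = scale c (x * y)"
    and scale_times_right: "x * scale c y = scale c (x * y)"
begin

definition algebra_hom :: "('r, 'c) nualgebra \<Rightarrow> ('c \<Rightarrow> 'b) \<Rightarrow> bool"
  where "algebra_hom A \<phi> \<longleftrightarrow>
    (\<forall>x \<in> carrier A. \<forall>y \<in> carrier A. \<phi> (aadd A x y) = \<phi> x + \<phi> y \<and> \<phi> (amult A x y) = \<phi> x * \<phi> y) \<and>
    (\<forall>c. \<forall>x \<in> carrier A. \<phi> (ascale A c x) = scale c (\<phi> x))"

definition evl :: "('g \<Rightarrow> 'b) \<Rightarrow> ('g word \<Rightarrow>\<^sub>0 'r) \<Rightarrow> 'b"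
  where "evl S p = (\<Sum>w \<in> Poly_Mapping.keys p.
    scale (Poly_Mapping.lookup p w) (nprod (map S (letters w))))"

lemma evl_add: "evl S (p + q) = evl S p + evl S q"
  unfolding evl_def
  by (rule setsum_keys_plus_distrib) (simp_all add: scale_left_distrib)

lemma evl_zero: "evl S 0 = 0"
  by (simp add: evl_def)

lemma evl_minus: "evl S (- p) = - evl S p"
  using evl_add[of S p "- p"] by (simp add: evl_zero eq_neg_iff_add_eq_0 add.commute)

lemma evl_diff: "evl S (p - q) = evl S p - evl S q"
  using evl_add[of S p "- q"] by (simp add: evl_minus)

lemma evl_sum: "evl S (sum f L) = (\<Sum>x \<in> L. evl S (f x))"
  by (induction L rule: infinite_finite_induct) (simp_all add: evl_add evl_zero)

lemma evl_single: "evl S (Poly_Mapping.single w c) = scale c (nprod (map S (letters w)))"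
  by (simp add: evl_def)

lemma nprod_append: "xs \<noteq> [] \<Longrightarrow> ys \<noteq> [] \<Longrightarrow> nprod (xs @ ys) = nprod xs * nprod (ys :: 'b list)"
proof (induction xs rule: nprod.induct)
  case (1 x)
  then show ?case by (cases ys) auto
qed (simp_all add: mult.assoc)

lemma evl_mult:
  assumes "p \<in> carrier (free_algebra X)" "q \<in> carrier (free_algebra X)"
  shows "evl S (p * q) = evl S p * evl S q"
proof -
  let ?s = "\<lambda>p w. Poly_Mapping.single w (Poly_Mapping.lookup p w)"
  have *: "evl S (?s p u * ?s q v) = evl S (?s p u) * evl S (?s q v)"
    if "u \<in> Poly_Mapping.keys p" "v \<in> Poly_Mapping.keys q" for u v
  proof -
    have "letters u \<noteq> []" "letters v \<noteq> []"
      using assms that by (cases u; cases v; force simp: free_algebra_def zero_word_def)+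
    then show ?thesis
      by (simp add: mult_single evl_single letters_add nprod_append scale_times_left
          scale_times_right mult.commute)
  qed
  have "evl S (p * q) = evl S ((\<Sum>u \<in> Poly_Mapping.keys p. ?s p u) * (\<Sum>v \<in> Poly_Mapping.keys q. ?s q v))"
    by (simp flip: poly_mapping_monomials)
  also have "\<dots> = (\<Sum>u \<in> Poly_Mapping.keys p. \<Sum>v \<in> Poly_Mapping.keys q. evl S (?s p u) * evl S (?s q v))"
    unfolding sum_product evl_sum by (intro sum.cong refl *)
  also have "\<dots> = evl S (\<Sum>u \<in> Poly_Mapping.keys p. ?s p u) * evl S (\<Sum>v \<in> Poly_Mapping.keys q. ?s q v)"
    unfolding sum_product evl_sum ..
  finally show ?thesis by (simp flip: poly_mapping_monomials)
qed

lemma evl_scale: "evl S (ascale (free_algebra X) c p) = scale c (evl S p)"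
proof -
  have "evl S (Poly_Mapping.single 0 c * Poly_Mapping.single w d) = scale c (evl S (Poly_Mapping.single w d))" for w d
    by (simp add: mult_single evl_single)
  then show ?thesis
    by (subst (1 2) poly_mapping_monomials[of p])
      (simp only: scale_conv_mult sum_distrib_left evl_sum scale_sum_right)
qed

lemma evl_gen [simp]: "evl S (free_gen g) = S g"
  by (simp add: free_gen_def evl_single)

lemma evl_nprod:
  "xs \<noteq> [] \<Longrightarrow> set xs \<subseteq> carrier (free_algebra X) \<Longrightarrow> evl S (nprod xs) = nprod (map (evl S) xs)"
proof (induction xs rule: nprod.induct)
  case (2 x y zs)
  then show ?case
    using nprod_closed[of "carrier (free_algebra X)" "y # zs"]
    by (simp add: evl_mult[of _ X] free_algebra_closed)
qed simp_all

lemma evl_relators: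
  fixes \<Lambda> :: "('a, 'k::finite) kgraph"
  assumes "k_graph \<Lambda>" "x \<in> kp_relators \<Lambda> free_gen"
  shows "evl S x \<in> kp_relators \<Lambda> S"
proof -
  interpret k_graph \<Lambda> by fact
  let ?C = "carrier (kp_free \<Lambda> :: ('r, _) nualgebra)"
  have *: "free_gen (Path \<alpha>) \<in> ?C" "free_gen (ghost \<Lambda> \<alpha>) \<in> ?C" if "\<alpha> \<in> mor \<Lambda>" for \<alpha>
    using that by (simp_all add: free_gen_closed kp_generatorsI)
  have v: "v \<in> mor \<Lambda>" if "v \<in> vertices \<Lambda>" for v using that by (simp add: vertices_def)
  have [simp]: "evl S (free_gen (Path \<alpha>) * free_gen (Path \<mu>)) = S (Path \<alpha>) * S (Path \<mu>)"
     "evl S (free_gen (ghost \<Lambda> \<alpha>) * free_gen (ghost \<Lambda> \<mu>)) = S (ghost \<Lambda> \<alpha>) * S (ghost \<Lambda> \<mu>)"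
     "evl S (free_gen (ghost \<Lambda> \<alpha>) * free_gen (Path \<mu>)) = S (ghost \<Lambda> \<alpha>) * S (Path \<mu>)"
     "evl S (free_gen (Path \<alpha>) * free_gen (ghost \<Lambda> \<mu>)) = S (Path \<alpha>) * S (ghost \<Lambda> \<mu>)"
    if "\<alpha> \<in> mor \<Lambda>" "\<mu> \<in> mor \<Lambda>" for \<alpha> \<mu>
    using that * by (simp_all add: evl_mult[of _ "kp_generators \<Lambda>"])
  show ?thesis
    using assms(2)
  proof cases
    case (KP1_idem v)
    then show ?thesis using kp_relators.KP1_idem[of v \<Lambda> S] v by (simp add: evl_diff)
  next
    case (KP1_orth v w)
    then show ?thesis using kp_relators.KP1_orth[of v \<Lambda> w S] v by simp
  next
    case (KP2_path \<alpha> \<mu>)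
    then show ?thesis using kp_relators.KP2_path[of \<alpha> \<Lambda> \<mu> S] by (simp add: evl_diff)
  next
    case (KP2_ghost \<alpha> \<mu>)
    then show ?thesis using kp_relators.KP2_ghost[of \<alpha> \<Lambda> \<mu> S] by (simp add: evl_diff)
  next
    case (KP3 \<alpha> \<mu>)
    have "evl S (\<Sum>(\<rho>, \<tau>)\<in>Lmin \<Lambda> \<alpha> \<mu>. free_gen (Path \<rho>) * free_gen (ghost \<Lambda> \<tau>))
      = (\<Sum>(\<rho>, \<tau>)\<in>Lmin \<Lambda> \<alpha> \<mu>. S (Path \<rho>) * S (ghost \<Lambda> \<tau>))"
      unfolding evl_sum by (rule sum.cong) (auto simp: Lmin_def)
    then show ?thesis using KP3 kp_relators.KP3[of \<alpha> \<Lambda> \<mu> S] by (simp add: evl_diff)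
  next
    case (KP4 w ls)
    then have ls: "ls \<noteq> []" "set ls \<subseteq> mor \<Lambda>"
      using FE_nonempty[of w \<Lambda>] assms by (auto simp: FE_def paths_to_def)
    have "evl S x = nprod (map (evl S) (map (\<lambda>\<alpha>. free_gen (Path w) - free_gen (Path \<alpha>) * free_gen (ghost \<Lambda> \<alpha>)) ls))"
      unfolding KP4(1) using ls KP4(2) v
      by (intro evl_nprod[of _ "kp_generators \<Lambda>"]) (auto intro!: free_algebra_closed *)
    also have "map (evl S) (map (\<lambda>\<alpha>. free_gen (Path w) - free_gen (Path \<alpha>) * free_gen (ghost \<Lambda> \<alpha>)) ls)
      = map (\<lambda>\<alpha>. S (Path w) - S (Path \<alpha>) * S (ghost \<Lambda> \<alpha>)) ls"
      using ls by (auto simp: evl_diff)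
    finally show ?thesis using KP4 kp_relators.KP4[of w \<Lambda> ls S] by simp
  qed
qed

end

definition kp_gen :: "('a, 'k) kgraph \<Rightarrow> 'a gen \<Rightarrow> ('a gen word \<Rightarrow>\<^sub>0 'r::comm_ring_1) set"
  where "kp_gen \<Lambda> g = acoset (kp_free \<Lambda>) (kp_ideal \<Lambda>) (free_gen g)"

context type_algebra
begin

theorem kumjian_pask_universal:
  fixes \<Lambda> :: "('a, 'k::finite) kgraph" and S :: "'a gen \<Rightarrow> 'b"
  assumes \<Lambda>: "k_graph \<Lambda>" and S: "kp_family \<Lambda> S"
  shows "\<exists>!\<phi>. \<phi> \<in> extensional (carrier (kumjian_pask \<Lambda>)) \<and> algebra_hom (kumjian_pask \<Lambda>) \<phi> \<and>
    (\<forall>g \<in> kp_generators \<Lambda>. \<phi> (kp_gen \<Lambda> g) = S g)"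
proof -
  let ?F = "kp_free \<Lambda> :: ('r, _) nualgebra"
  let ?I = "kp_ideal \<Lambda> :: ('a gen word \<Rightarrow>\<^sub>0 'r) set"
  let ?c = "acoset ?F ?I"
  note gen = algebra_ideal_generated[OF nonunital_algebra_free kp_relators_closed[OF \<Lambda>],
      folded kp_ideal_def]
  note ops = quotient_free_ops[OF gen(1), folded kumjian_pask_def]
  have carrier: "carrier (kumjian_pask \<Lambda>) = ?c ` carrier ?F"
    by (simp add: kumjian_pask_def quotient_algebra_def)
  let ?K = "{x \<in> carrier ?F. evl S x = 0}"
  have mem_scale: "ascale ?F c x \<in> carrier ?F" if "x \<in> carrier ?F" for x c
    using that by (rule nonunital_algebra.scale_closed[OF nonunital_algebra_free])
  have "\<exists>y \<in> ?K. x + y = 0" if "x \<in> ?K" for x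
    using that by (intro bexI[of _ "- x"]) (simp_all add: free_algebra_closed evl_minus)
  then have "algebra_ideal ?F ?K"
    unfolding algebra_ideal_def two_sided_ideal_def
    by (simp add: free_algebra_closed evl_zero evl_add evl_mult[of _ "kp_generators \<Lambda>"] evl_scale mem_scale)
  moreover have "kp_relators \<Lambda> free_gen \<subseteq> ?K"
    using evl_relators[OF \<Lambda>] S kp_relators_closed[OF \<Lambda>] by (auto simp: kp_family_def)
  ultimately have K: "?I \<subseteq> ?K" by (rule gen(3))
  have wd: "evl S x = evl S y" if "?c x = ?c y" for x y
  proof -
    have "x - y \<in> ?K"
      using that K unfolding acoset_free_eq_iff[OF gen(1)] by blast
    then show ?thesis by (simp add: evl_diff)
  qed
  define \<phi> where "\<phi> = (\<lambda>Y \<in> carrier (kumjian_pask \<Lambda>). evl S (SOME x. x \<in> carrier ?F \<and> ?c x = Y))"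
  have \<phi>: "\<phi> (?c x) = evl S x" if "x \<in> carrier ?F" for x
  proof -
    have "?c (SOME x'. x' \<in> carrier ?F \<and> ?c x' = ?c x) = ?c x"
      using someI[of "\<lambda>x'. x' \<in> carrier ?F \<and> ?c x' = ?c x" x] that by blast
    from wd[OF this] show ?thesis using that by (simp add: \<phi>_def carrier)
  qed
  show ?thesis
  proof (rule ex1I[of _ \<phi>])
    show "\<phi> \<in> extensional (carrier (kumjian_pask \<Lambda>)) \<and> algebra_hom (kumjian_pask \<Lambda>) \<phi> \<and>
      (\<forall>g \<in> kp_generators \<Lambda>. \<phi> (kp_gen \<Lambda> g) = S g)"
      unfolding algebra_hom_def kp_gen_def carrier
      by (simp add: ops \<phi> free_algebra_closed evl_add evl_mult[of _ "kp_generators \<Lambda>"]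
          evl_scale free_gen_closed mem_scale)
        (simp add: \<phi>_def carrier)
  next
    fix \<psi>
    assume \<psi>: "\<psi> \<in> extensional (carrier (kumjian_pask \<Lambda>)) \<and> algebra_hom (kumjian_pask \<Lambda>) \<psi> \<and>
      (\<forall>g \<in> kp_generators \<Lambda>. \<psi> (kp_gen \<Lambda> g) = S g)"
    have hom: "\<psi> (aadd (kumjian_pask \<Lambda>) Y Z) = \<psi> Y + \<psi> Z"
      "\<psi> (amult (kumjian_pask \<Lambda>) Y Z) = \<psi> Y * \<psi> Z"
      "\<psi> (ascale (kumjian_pask \<Lambda>) c Y) = scale c (\<psi> Y)"
      if "Y \<in> carrier (kumjian_pask \<Lambda>)" "Z \<in> carrier (kumjian_pask \<Lambda>)" for Y Z c
      using \<psi> that unfolding algebra_hom_def by blast+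
    have add: "\<psi> (?c (x + y)) = \<psi> (?c x) + \<psi> (?c y)"
      and mult: "\<psi> (?c (x * y)) = \<psi> (?c x) * \<psi> (?c y)"
      and scale: "\<psi> (?c (ascale ?F c x)) = scale c (\<psi> (?c x))"
      if "x \<in> carrier ?F" "y \<in> carrier ?F" for x y c
      using hom[of "?c x" "?c y"] that ops[OF that] by (simp_all add: carrier)
    have zero: "\<psi> (?c 0) = 0"
      using add[of 0 0] by (simp add: free_algebra_closed)
    have word: "\<psi> (?c (Poly_Mapping.single (Word gs) 1)) = nprod (map S gs)"
      if "gs \<noteq> []" "set gs \<subseteq> kp_generators \<Lambda>" for gs
      using that
    proof (induction gs rule: induct_list012)
      case (2 g)
      then show ?case using \<psi> by (simp add: kp_gen_def free_gen_def)
    next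
      case (3 g h gs)
      have "Poly_Mapping.single (Word (h # gs)) 1 \<in> carrier ?F"
        using 3 by (simp add: free_algebra_def zero_word_def)
      moreover have "Poly_Mapping.single (Word (g # h # gs)) (1::'r)
          = free_gen g * Poly_Mapping.single (Word (h # gs)) 1"
        by (simp add: free_gen_def mult_single plus_word_def)
      ultimately show ?case
        using 3 \<psi> mult[of "free_gen g" "Poly_Mapping.single (Word (h # gs)) 1"]
        by (simp add: free_gen_closed kp_gen_def)
    qed simp
    have mono: "\<psi> (?c (Poly_Mapping.single w d)) = evl S (Poly_Mapping.single w d)"
      if "w \<noteq> 0" "set (letters w) \<subseteq> kp_generators \<Lambda>" for w d
    proof -
      have "Poly_Mapping.single w 1 \<in> carrier ?F" using that by (simp add: free_algebra_def)
      then show ?thesis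
        using scale[of "Poly_Mapping.single w 1" "Poly_Mapping.single w 1" d] word[of "letters w"] that
        by (cases w) (simp add: scale_conv_mult mult_single evl_single zero_word_def plus_word_def)
    qed
    have sum: "\<psi> (?c (\<Sum>w \<in> W. Poly_Mapping.single w (d w))) = evl S (\<Sum>w \<in> W. Poly_Mapping.single w (d w))
        \<and> (\<Sum>w \<in> W. Poly_Mapping.single w (d w)) \<in> carrier ?F"
      if "finite W" "\<forall>w \<in> W. w \<noteq> 0 \<and> set (letters w) \<subseteq> kp_generators \<Lambda>" for W d
      using that
    proof (induction W)
      case (insert w W)
      have "Poly_Mapping.single w (d w) \<in> carrier ?F"
        using insert by (simp add: free_algebra_def)
      then show ?case using insert mono by (simp add: add evl_add free_algebra_closed)
    qed (simp add: zero evl_zero free_algebra_closed)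
    have "\<psi> (?c x) = evl S x" if "x \<in> carrier ?F" for x
      using sum[of "Poly_Mapping.keys x" "Poly_Mapping.lookup x"] that
      by (simp add: free_algebra_def flip: poly_mapping_monomials)
    then show "\<psi> = \<phi>"
      using \<psi> \<phi> by (intro extensionalityI[of _ "carrier (kumjian_pask \<Lambda>)"])
        (auto simp: carrier \<phi>_def)
  qed
qed

end

text \<open>The generators of \<^const>\<open>kumjian_pask\<close> satisfy the defining relations.\<close>

lemma kp_relators_in_quotient:
  assumes "k_graph \<Lambda>" "x \<in> kp_relators \<Lambda> free_gen"
  shows "acoset (kp_free \<Lambda>) (kp_ideal \<Lambda>) x = azero (kumjian_pask \<Lambda>)"
proof -
  note gen = algebra_ideal_generated[OF nonunital_algebra_free kp_relators_closed[OF assms(1)],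
      folded kp_ideal_def]
  show ?thesis
    using acoset_free_eqI[OF gen(1), of x 0] subsetD[OF gen(2) assms(2)]
    by (simp add: kumjian_pask_def quotient_algebra_def)
qed

end

theory Submission
  imports Defs
begin

text \<open>
  Boundary paths are replaced by their sets of initial segments, which are filters of paths.

  If the algebra is simple, every representation is zero or faithful.  The representation on functions
  on the boundary paths shows that a scalar \<open>c \<noteq> 0\<close> is invertible, because \<open>c KP(\<Lambda>)\<close> is a nonzero ideal.
  Restricted to the shift-tail class of a boundary path that \<open>v\<close> does not reach, it kills \<open>s\<^sub>v\<close>; so there
  is no such path.  If \<open>\<alpha>x = \<beta>x\<close> for all \<open>x\<close>, it identifies \<open>s\<^sub>\<alpha>\<close> and \<open>s\<^sub>\<beta>\<close>, which its version graded by
  degree distinguishes if \<open>\<alpha> \<noteq> \<beta>\<close>.  So different \<open>\<alpha>, \<beta>\<close> with the same source have extensions \<open>\<alpha>\<xi>, \<beta>\<xi>\<close>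
  without common extension, and a Baire category argument gives aperiodic boundary paths.

  Conversely, let \<open>J\<close> be an ideal and \<open>0 \<noteq> a \<in> J\<close>.  By (KP4) there is a path \<open>\<beta>\<close> such that \<open>a s\<^sub>\<beta>\<close> is
  a combination of different paths \<open>s\<^sub>\<mu>\<close> with nonzero coefficients.  By aperiodicity \<open>\<beta>\<close> can be extended
  so that one of these \<open>\<mu>\<close> has no common extension with any other, and multiplying by \<open>s\<^sub>\<mu>\<^sub>*\<close> leaves a
  nonzero multiple of a vertex.  The vertices in \<open>J\<close> are hereditary and saturated.  Were this not the set of all
  vertices, a generic path avoiding it would be a boundary path contradicting cofinality.
\<close>

section \<open>Paths and their common extensions\<close>

text \<open>Under finite alignment alone a boundary path may be finite in some directions, so it
  cannot be shifted by an arbitrary degree. Filters avoid this: a path is added or removed at the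
  front by the mutually inverse operations \<open>push\<close> and \<open>pull\<close>, and
  exhaustive sets are moved along a path by the sets \<open>Ext\<close>, which finite alignment
  keeps finite. If \<open>\<alpha>x = \<beta>x\<close> with
  \<open>\<alpha> \<noteq> \<beta>\<close>, both are initial segments of one path, so their degrees
  must differ. This is why a second coordinate recording degrees is enough to tell
  \<open>\<alpha>\<close> and \<open>\<beta>\<close> apart, without any graded uniqueness theorem.
  Three obstacles shape the algebra. There is no unit, so products of \<open>1 - e \<nu>\<close>
  become operations on elements and finite sums of vertices act as local units. Ideals in the sense
  of simplicity are not given as closed under scalars; multiples of vertices, which belong to the
  algebra, replace scalars. Finally the algebra consists of cosets over a carrier set; to calculate
  with ring laws it is embedded into a ring that is a whole type.\<close>

context k_graph
begin

abbreviation comp :: "'a \<Rightarrow> 'a \<Rightarrow> 'a" (infixl "\<cdot>" 75)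
  where "\<alpha> \<cdot> \<mu> \<equiv> cmp \<Lambda> \<alpha> \<mu>"

abbreviation "r \<equiv> rng \<Lambda>"
abbreviation "s \<equiv> src \<Lambda>"
abbreviation "d \<equiv> deg \<Lambda>"
abbreviation "\<M> \<equiv> mor \<Lambda>"

lemmas mor_simps [simp] = rng_mor src_mor rng_rng src_rng rng_src src_src cmp_mor rng_cmp src_cmp
  cmp_rng cmp_src deg_rng deg_src deg_cmp

lemma vertex_simps:
  assumes "v \<in> vertices \<Lambda>"
  shows "v \<in> \<M>" "r v = v" "s v = v" "d v = 0"
proof -
  show v: "v \<in> \<M>" "r v = v" "d v = 0"
    using assms vertices_eq_identities by (auto simp: vertices_def)
  then show "s v = v" using src_rng[of v] by simp
qed

lemma vertices_range [simp]: "\<alpha> \<in> \<M> \<Longrightarrow> r \<alpha> \<in> vertices \<Lambda>" "\<alpha> \<in> \<M> \<Longrightarrow> s \<alpha> \<in> vertices \<Lambda>"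
  by (simp_all add: vertices_def)

section \<open>Unique factorisation and cancellation\<close>

lemma factor_unique:
  assumes "\<alpha> \<in> \<M>" "\<beta> \<in> \<M>" "\<alpha>' \<in> \<M>" "\<beta>' \<in> \<M>" "s \<alpha> = r \<beta>" "s \<alpha>' = r \<beta>'"
    "\<alpha> \<cdot> \<beta> = \<alpha>' \<cdot> \<beta>'" "d \<alpha> = d \<alpha>'"
  shows "\<alpha> = \<alpha>'" "\<beta> = \<beta>'"
proof -
  have "d \<alpha> + d \<beta> = d \<alpha> + d \<beta>'"
    using assms by (metis deg_cmp)
  then have "d \<beta> = d \<beta>'" by simp
  let ?P = "\<lambda>(\<mu>, \<nu>). \<mu> \<in> \<M> \<and> \<nu> \<in> \<M> \<and> s \<mu> = r \<nu> \<and> \<alpha> \<cdot> \<beta> = \<mu> \<cdot> \<nu>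
            \<and> d \<mu> = d \<alpha> \<and> d \<nu> = d \<beta>"
  have "\<exists>!p. ?P p"
    using assms(1,2,5) by (intro factorisation) simp_all
  moreover have "?P (\<alpha>, \<beta>)" using assms(1,2,5) by simp
  moreover have "?P (\<alpha>', \<beta>')" using assms(3,4,6-8) \<open>d \<beta> = d \<beta>'\<close> by simp
  ultimately have "(\<alpha>, \<beta>) = (\<alpha>', \<beta>')" by blast
  then show "\<alpha> = \<alpha>'" "\<beta> = \<beta>'" by simp_all
qed

lemma factor:
  assumes "\<alpha> \<in> \<M>" "m \<le> d \<alpha>"
  obtains \<mu> \<nu> where "\<mu> \<in> \<M>" "\<nu> \<in> \<M>" "s \<mu> = r \<nu>" "\<alpha> = \<mu> \<cdot> \<nu>" "d \<mu> = m"
proof -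
  have "d \<alpha> = m + (d \<alpha> - m)"
    using assms(2) by (auto simp: fun_eq_iff le_fun_def)
  from factorisation[OF assms(1) this] that show thesis by auto
qed

lemma left_cancel:
  assumes "\<alpha> \<in> \<M>" "\<beta> \<in> \<M>" "\<beta>' \<in> \<M>" "s \<alpha> = r \<beta>" "s \<alpha> = r \<beta>'" "\<alpha> \<cdot> \<beta> = \<alpha> \<cdot> \<beta>'"
  shows "\<beta> = \<beta>'"
  using factor_unique[of \<alpha> \<beta> \<alpha> \<beta>'] assms by simp

lemma right_cancel:
  assumes "\<alpha> \<in> \<M>" "\<beta> \<in> \<M>" "\<xi> \<in> \<M>" "s \<alpha> = r \<xi>" "s \<beta> = r \<xi>" "\<alpha> \<cdot> \<xi> = \<beta> \<cdot> \<xi>"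
  shows "\<alpha> = \<beta>"
proof -
  have "d \<alpha> + d \<xi> = d \<beta> + d \<xi>"
    using assms deg_cmp by metis
  then have "d \<alpha> = d \<beta>" by simp
  then show ?thesis using factor_unique(1)[OF assms(1,3,2,3-6)] by blast
qed

lemma deg_zero_identity:
  assumes "\<alpha> \<in> \<M>" "d \<alpha> = 0"
  shows "r \<alpha> = \<alpha>" "s \<alpha> = \<alpha>"
  using vertex_simps[of \<alpha>] assms by (simp_all add: vertices_def)

section \<open>The prefix order on paths\<close>

definition initial :: "'a \<Rightarrow> 'a \<Rightarrow> bool" (infix "\<preceq>" 50)
  where "\<mu> \<preceq> \<tau> \<longleftrightarrow> \<mu> \<in> \<M> \<and> (\<exists>\<nu> \<in> \<M>. s \<mu> = r \<nu> \<and> \<tau> = \<mu> \<cdot> \<nu>)"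

lemma initialE:
  assumes "\<mu> \<preceq> \<tau>"
  obtains \<nu> where "\<mu> \<in> \<M>" "\<nu> \<in> \<M>" "s \<mu> = r \<nu>" "\<tau> = \<mu> \<cdot> \<nu>"
  using assms unfolding initial_def by blast

lemma initial_cmp [intro]: "\<lbrakk>\<mu> \<in> \<M>; \<nu> \<in> \<M>; s \<mu> = r \<nu>\<rbrakk> \<Longrightarrow> \<mu> \<preceq> \<mu> \<cdot> \<nu>"
  unfolding initial_def by blast

lemma initial_mor: "\<mu> \<preceq> \<tau> \<Longrightarrow> \<mu> \<in> \<M>" "\<mu> \<preceq> \<tau> \<Longrightarrow> \<tau> \<in> \<M>"
  by (auto elim!: initialE)

lemma initial_refl [simp]: "\<mu> \<in> \<M> \<Longrightarrow> \<mu> \<preceq> \<mu>"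
  using initial_cmp[of \<mu> "s \<mu>"] by simp

lemma initial_trans [trans]:
  assumes "\<mu> \<preceq> \<nu>" "\<nu> \<preceq> \<tau>" shows "\<mu> \<preceq> \<tau>"
proof -
  obtain \<alpha> where \<alpha>: "\<mu> \<in> \<M>" "\<alpha> \<in> \<M>" "s \<mu> = r \<alpha>" "\<nu> = \<mu> \<cdot> \<alpha>"
    using assms(1) by (rule initialE)
  obtain \<beta> where \<beta>: "\<nu> \<in> \<M>" "\<beta> \<in> \<M>" "s \<nu> = r \<beta>" "\<tau> = \<nu> \<cdot> \<beta>"
    using assms(2) by (rule initialE)
  have "\<tau> = \<mu> \<cdot> (\<alpha> \<cdot> \<beta>)"
    using \<alpha> \<beta> by (simp add: cmp_assoc)
  then show ?thesis using \<alpha> \<beta> by auto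
qed

lemma initial_range: "\<mu> \<preceq> \<tau> \<Longrightarrow> r \<mu> = r \<tau>"
  by (auto elim!: initialE)

lemma range_initial: "\<tau> \<in> \<M> \<Longrightarrow> r \<tau> \<preceq> \<tau>"
  using initial_cmp[of "r \<tau>" \<tau>] by simp

lemma initial_deg: "\<mu> \<preceq> \<tau> \<Longrightarrow> d \<mu> \<le> d \<tau>"
  by (auto elim!: initialE simp: le_fun_def)

text \<open>Factor \<open>\<nu>\<close> at degree \<open>d \<mu>\<close>. Its first factor and
  \<open>\<mu>\<close> both begin a factorisation of \<open>\<tau>\<close> and have the same degree,
  so they agree.\<close>

lemma initial_comparable:
  assumes "\<mu> \<preceq> \<tau>" "\<nu> \<preceq> \<tau>" "d \<mu> \<le> d \<nu>"
  shows "\<mu> \<preceq> \<nu>"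
proof -
  obtain \<beta> where \<beta>: "\<nu> \<in> \<M>" "\<beta> \<in> \<M>" "s \<nu> = r \<beta>" "\<tau> = \<nu> \<cdot> \<beta>"
    using assms(2) by (rule initialE)
  obtain \<mu>' \<alpha> where \<alpha>: "\<mu>' \<in> \<M>" "\<alpha> \<in> \<M>" "s \<mu>' = r \<alpha>" "\<nu> = \<mu>' \<cdot> \<alpha>" "d \<mu>' = d \<mu>"
    using factor[OF \<beta>(1) assms(3)] .
  obtain \<gamma> where \<gamma>: "\<mu> \<in> \<M>" "\<gamma> \<in> \<M>" "s \<mu> = r \<gamma>" "\<tau> = \<mu> \<cdot> \<gamma>"
    using assms(1) by (rule initialE)
  have "\<mu>' \<cdot> (\<alpha> \<cdot> \<beta>) = \<mu> \<cdot> \<gamma>"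
    using \<alpha> \<beta> \<gamma> by (simp add: cmp_assoc)
  then have "\<mu>' = \<mu>"
    using \<alpha> \<beta> \<gamma> by (intro factor_unique(1)[of \<mu>' "\<alpha> \<cdot> \<beta>" \<mu> \<gamma>]) simp_all
  then show ?thesis using \<alpha> by auto
qed

lemma initial_antisym:
  assumes "\<mu> \<preceq> \<tau>" "\<nu> \<preceq> \<tau>" "d \<mu> = d \<nu>" shows "\<mu> = \<nu>"
proof -
  have "\<mu> \<preceq> \<nu>" using assms by (intro initial_comparable[of \<mu> \<tau> \<nu>]) simp_all
  then obtain \<beta> where \<beta>: "\<mu> \<in> \<M>" "\<beta> \<in> \<M>" "s \<mu> = r \<beta>" "\<nu> = \<mu> \<cdot> \<beta>"
    by (rule initialE)
  then have "d \<beta> = 0" using assms(3) by simp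
  then show ?thesis using \<beta> deg_zero_identity[of \<beta>] by (metis cmp_src)
qed

lemma initial_cmp_cancel:
  assumes "\<pi> \<in> \<M>" "\<mu> \<in> \<M>" "\<nu> \<in> \<M>" "s \<pi> = r \<mu>" "s \<pi> = r \<nu>"
  shows "\<pi> \<cdot> \<mu> \<preceq> \<pi> \<cdot> \<nu> \<longleftrightarrow> \<mu> \<preceq> \<nu>"
proof
  assume "\<mu> \<preceq> \<nu>"
  then obtain \<beta> where "\<beta> \<in> \<M>" "s \<mu> = r \<beta>" "\<nu> = \<mu> \<cdot> \<beta>"
    by (rule initialE)
  then show "\<pi> \<cdot> \<mu> \<preceq> \<pi> \<cdot> \<nu>"
    using assms initial_cmp[of "\<pi> \<cdot> \<mu>" \<beta>] by (simp add: cmp_assoc)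
next
  assume "\<pi> \<cdot> \<mu> \<preceq> \<pi> \<cdot> \<nu>"
  then obtain \<beta> where \<beta>: "\<beta> \<in> \<M>" "s (\<pi> \<cdot> \<mu>) = r \<beta>" "\<pi> \<cdot> \<nu> = (\<pi> \<cdot> \<mu>) \<cdot> \<beta>"
    by (rule initialE)
  have "\<pi> \<cdot> \<nu> = \<pi> \<cdot> (\<mu> \<cdot> \<beta>)"
    unfolding \<beta>(3) using assms \<beta>(1,2) by (simp add: cmp_assoc)
  moreover have "s \<mu> = r \<beta>" using \<beta>(2) assms by simp
  ultimately have "\<nu> = \<mu> \<cdot> \<beta>"
    using assms \<beta>(1) left_cancel[of \<pi> \<nu> "\<mu> \<cdot> \<beta>"] cmp_mor rng_cmp by metis
  then show "\<mu> \<preceq> \<nu>"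
    using initial_cmp[OF assms(2) \<beta>(1) \<open>s \<mu> = r \<beta>\<close>] by simp
qed

section \<open>Minimal common extensions and exhaustive sets\<close>

lemma initial_segment_eq:
  assumes "\<mu> \<in> \<M>" "\<nu> \<in> \<M>" "s \<mu> = r \<nu>"
  shows "initial_segment \<Lambda> (\<mu> \<cdot> \<nu>) (d \<mu>) = \<mu>"
  unfolding initial_segment_def
proof (rule the_equality)
  show "\<And>\<mu>'. \<mu>' \<in> \<M> \<and> d \<mu>' = d \<mu> \<and> (\<exists>\<nu>'\<in>\<M>. s \<mu>' = r \<nu>' \<and> \<mu> \<cdot> \<nu> = \<mu>' \<cdot> \<nu>') \<Longrightarrow> \<mu>' = \<mu>"
    using assms factor_unique by metis
qed (use assms in auto)

text \<open>The factorisation property evaluates the definite descriptions inside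
  \<open>MCE\<close>; what remains is one equation and one degree. All later arguments about
  \<open>Lmin\<close> rest on this form.\<close>

lemma Lmin_iff:
  assumes "\<alpha> \<in> \<M>" "\<mu> \<in> \<M>"
  shows "(\<rho>, \<tau>) \<in> Lmin \<Lambda> \<alpha> \<mu> \<longleftrightarrow> \<rho> \<in> \<M> \<and> \<tau> \<in> \<M> \<and> s \<alpha> = r \<rho> \<and> s \<mu> = r \<tau> \<and>
    \<alpha> \<cdot> \<rho> = \<mu> \<cdot> \<tau> \<and> d (\<alpha> \<cdot> \<rho>) = sup (d \<alpha>) (d \<mu>)"
  using assms initial_segment_eq[of \<alpha> \<rho>] initial_segment_eq[of \<mu> \<tau>]
  by (auto simp: Lmin_def MCE_def)

text \<open>Cut \<open>\<kappa>\<close> at the join of the two degrees. The result lies below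
  \<open>\<kappa>\<close>, which later places the pair inside a given filter.\<close>

lemma Lmin_of_common_extension:
  assumes "\<alpha> \<preceq> \<kappa>" "\<mu> \<preceq> \<kappa>"
  obtains \<rho> \<tau> where "(\<rho>, \<tau>) \<in> Lmin \<Lambda> \<alpha> \<mu>" "\<alpha> \<cdot> \<rho> \<preceq> \<kappa>"
proof -
  have "sup (d \<alpha>) (d \<mu>) \<le> d \<kappa>"
    using assms initial_deg by simp
  then obtain \<eta> \<zeta> where \<eta>: "\<eta> \<in> \<M>" "\<zeta> \<in> \<M>" "s \<eta> = r \<zeta>" "\<kappa> = \<eta> \<cdot> \<zeta>" "d \<eta> = sup (d \<alpha>) (d \<mu>)"
    using factor assms initial_mor by metis
  then have "\<eta> \<preceq> \<kappa>" by auto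
  then have "\<alpha> \<preceq> \<eta>" "\<mu> \<preceq> \<eta>"
    using initial_comparable[OF assms(1) \<open>\<eta> \<preceq> \<kappa>\<close>] initial_comparable[OF assms(2) \<open>\<eta> \<preceq> \<kappa>\<close>] \<eta>(5)
    by simp_all
  then obtain \<rho> \<tau> where "\<alpha> \<in> \<M>" "\<rho> \<in> \<M>" "s \<alpha> = r \<rho>" "\<eta> = \<alpha> \<cdot> \<rho>"
      "\<mu> \<in> \<M>" "\<tau> \<in> \<M>" "s \<mu> = r \<tau>" "\<eta> = \<mu> \<cdot> \<tau>"
    by (auto elim!: initialE)
  then show thesis
    using that[of \<rho> \<tau>] \<eta> \<open>\<eta> \<preceq> \<kappa>\<close> Lmin_iff[of \<alpha> \<mu> \<rho> \<tau>] by simp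
qed

definition compatible :: "'a \<Rightarrow> 'a \<Rightarrow> bool"
  where "compatible \<alpha> \<mu> \<longleftrightarrow> (\<exists>\<kappa>. \<alpha> \<preceq> \<kappa> \<and> \<mu> \<preceq> \<kappa>)"

lemma compatible_sym: "compatible \<alpha> \<mu> \<longleftrightarrow> compatible \<mu> \<alpha>"
  by (auto simp: compatible_def)

lemma compatible_initial: "compatible \<alpha> \<mu> \<Longrightarrow> \<beta> \<preceq> \<alpha> \<Longrightarrow> \<nu> \<preceq> \<mu> \<Longrightarrow> compatible \<beta> \<nu>"
  unfolding compatible_def using initial_trans by blast

lemma compatible_iff_Lmin:
  assumes "\<alpha> \<in> \<M>" "\<mu> \<in> \<M>" shows "compatible \<alpha> \<mu> \<longleftrightarrow> Lmin \<Lambda> \<alpha> \<mu> \<noteq> {}"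
proof
  assume "compatible \<alpha> \<mu>"
  then show "Lmin \<Lambda> \<alpha> \<mu> \<noteq> {}"
    unfolding compatible_def using Lmin_of_common_extension by blast
next
  assume "Lmin \<Lambda> \<alpha> \<mu> \<noteq> {}"
  then obtain \<rho> \<tau> where "(\<rho>, \<tau>) \<in> Lmin \<Lambda> \<alpha> \<mu>" by auto
  then show "compatible \<alpha> \<mu>"
    unfolding compatible_def Lmin_iff[OF assms] using assms by (metis initial_cmp)
qed

lemma exhaustive_iff:
  "exhaustive \<Lambda> v E \<longleftrightarrow> E \<subseteq> paths_to \<Lambda> v \<and> (\<forall>\<alpha> \<in> \<M>. r \<alpha> = v \<longrightarrow> (\<exists>\<mu> \<in> E. compatible \<alpha> \<mu>))"
  unfolding exhaustive_def paths_to_def using compatible_iff_Lmin by (auto simp: subset_iff)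

lemma FE_iff: "E \<in> FE \<Lambda> v \<longleftrightarrow> finite E \<and> v \<notin> E \<and> exhaustive \<Lambda> v E"
  by (auto simp: FE_def exhaustive_iff)

text \<open>The usual Ext(\<kappa>; E): what has to be appended to \<open>\<kappa>\<close> to reach
  a minimal common extension with a member of \<open>E\<close>. It carries \<open>E\<close> from the
  range of \<open>\<kappa>\<close> to its source.\<close>

definition Ext :: "'a \<Rightarrow> 'a set \<Rightarrow> 'a set"
  where "Ext \<kappa> E = {\<rho>. \<exists>\<nu> \<in> E. \<exists>\<tau>. (\<rho>, \<tau>) \<in> Lmin \<Lambda> \<kappa> \<nu>}"

lemma finite_Ext:
  assumes "finitely_aligned \<Lambda>" "finite E" "E \<subseteq> \<M>" "\<kappa> \<in> \<M>"
  shows "finite (Ext \<kappa> E)"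
proof -
  have "Ext \<kappa> E = (\<Union>\<nu> \<in> E. fst ` Lmin \<Lambda> \<kappa> \<nu>)"
    by (force simp: Ext_def)
  then show ?thesis
    using assms by (auto simp: finitely_aligned_def)
qed

lemma ExtE:
  assumes "\<rho> \<in> Ext \<kappa> E" "E \<subseteq> \<M>" "\<kappa> \<in> \<M>"
  obtains \<nu> \<tau> where "\<nu> \<in> E" "\<rho> \<in> \<M>" "\<tau> \<in> \<M>" "s \<kappa> = r \<rho>" "s \<nu> = r \<tau>" "\<kappa> \<cdot> \<rho> = \<nu> \<cdot> \<tau>"
  using assms Lmin_iff unfolding Ext_def by blast

text \<open>Only extensions of \<open>\<kappa>\<close> have to meet \<open>E\<close>, which need not
  be exhaustive itself nor have a single range; \<open>cut_nonzero\<close> relies on this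
  generality. Given a common extension of \<open>\<kappa> \<cdot> \<xi>\<close> and
  \<open>\<nu>\<close>, cut it to a minimal one of \<open>\<kappa>\<close> and \<open>\<nu>\<close>
  and cancel \<open>\<kappa>\<close>.\<close>

lemma exhaustive_Ext:
  assumes E: "E \<subseteq> \<M>" and \<kappa>: "\<kappa> \<in> \<M>"
    and compat: "\<And>\<xi>. \<lbrakk>\<xi> \<in> \<M>; s \<kappa> = r \<xi>\<rbrakk> \<Longrightarrow> \<exists>\<nu> \<in> E. compatible (\<kappa> \<cdot> \<xi>) \<nu>"
  shows "exhaustive \<Lambda> (s \<kappa>) (Ext \<kappa> E)"
  unfolding exhaustive_iff
proof (intro conjI ballI impI)
  show "Ext \<kappa> E \<subseteq> paths_to \<Lambda> (s \<kappa>)"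
    by (rule subsetI, erule ExtE[OF _ E \<kappa>]) (simp add: paths_to_def)
  fix \<xi> assume \<xi>: "\<xi> \<in> \<M>" "r \<xi> = s \<kappa>"
  then obtain \<nu> \<eta> where \<eta>: "\<nu> \<in> E" "\<kappa> \<cdot> \<xi> \<preceq> \<eta>" "\<nu> \<preceq> \<eta>"
    using compat[of \<xi>] by (auto simp: compatible_def)
  then have "\<kappa> \<preceq> \<eta>"
    using \<xi> \<kappa> initial_trans by (metis initial_cmp)
  then obtain \<rho> \<tau> where \<rho>: "(\<rho>, \<tau>) \<in> Lmin \<Lambda> \<kappa> \<nu>" "\<kappa> \<cdot> \<rho> \<preceq> \<eta>"
    using \<eta> Lmin_of_common_extension by blast
  then have \<rho>': "\<rho> \<in> \<M>" "s \<kappa> = r \<rho>"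
    using Lmin_iff \<kappa> E \<eta> by blast+
  obtain \<gamma> where \<gamma>: "\<gamma> \<in> \<M>" "s \<kappa> = r \<gamma>" "\<eta> = \<kappa> \<cdot> \<gamma>"
    using \<open>\<kappa> \<preceq> \<eta>\<close> by (rule initialE)
  then have "\<xi> \<preceq> \<gamma>" "\<rho> \<preceq> \<gamma>"
    using \<eta> \<rho> \<rho>' \<xi> \<kappa> initial_cmp_cancel by metis+
  then show "\<exists>\<rho> \<in> Ext \<kappa> E. compatible \<xi> \<rho>"
    using \<rho> \<eta> unfolding Ext_def compatible_def by blast
qed

lemma exhaustive_Ext_of_exhaustive:
  assumes E: "exhaustive \<Lambda> v E" and \<kappa>: "\<kappa> \<in> \<M>" "r \<kappa> = v"
  shows "exhaustive \<Lambda> (s \<kappa>) (Ext \<kappa> E)"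
proof (rule exhaustive_Ext)
  show "E \<subseteq> \<M>" using E by (auto simp: exhaustive_iff paths_to_def)
qed (use E \<kappa> in \<open>auto simp: exhaustive_iff\<close>)


section \<open>Boundary paths as filters\<close>

text \<open>
  A path is determined by the set of its initial segments \<open>x(0, n)\<close>; the sets that arise are the
  filters for the order \<open>\<preceq>\<close>.
\<close>

definition filters :: "'a set set"
  where "filters = {F. F \<subseteq> \<M> \<and> F \<noteq> {} \<and> (\<forall>\<kappa> \<in> F. \<forall>\<mu>. \<mu> \<preceq> \<kappa> \<longrightarrow> \<mu> \<in> F) \<and>
    (\<forall>\<mu> \<in> F. \<forall>\<nu> \<in> F. \<exists>\<kappa> \<in> F. \<mu> \<preceq> \<kappa> \<and> \<nu> \<preceq> \<kappa>)}"

definition boundary_filters :: "'a set set"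
  where "boundary_filters = {F \<in> filters. \<forall>\<kappa> \<in> F. \<forall>E \<in> FE \<Lambda> (s \<kappa>). \<exists>\<nu> \<in> E. \<kappa> \<cdot> \<nu> \<in> F}"

lemma boundary_filterD: "F \<in> boundary_filters \<Longrightarrow> F \<in> filters"
  by (simp add: boundary_filters_def)

lemma filter_mor: "F \<in> filters \<Longrightarrow> \<kappa> \<in> F \<Longrightarrow> \<kappa> \<in> \<M>"
  by (auto simp: filters_def)

lemma filter_down: "F \<in> filters \<Longrightarrow> \<kappa> \<in> F \<Longrightarrow> \<mu> \<preceq> \<kappa> \<Longrightarrow> \<mu> \<in> F"
  by (auto simp: filters_def)

lemma filter_directed:
  assumes "F \<in> filters" "\<mu> \<in> F" "\<nu> \<in> F"
  obtains \<kappa> where "\<kappa> \<in> F" "\<mu> \<preceq> \<kappa>" "\<nu> \<preceq> \<kappa>"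
  using assms unfolding filters_def by blast

lemma filter_range: "F \<in> filters \<Longrightarrow> \<mu> \<in> F \<Longrightarrow> \<nu> \<in> F \<Longrightarrow> r \<mu> = r \<nu>"
  by (metis filter_directed initial_range)

lemma filter_range_mem: "F \<in> filters \<Longrightarrow> \<mu> \<in> F \<Longrightarrow> r \<mu> \<in> F"
  using filter_down filter_mor range_initial by blast

lemma filter_vertex_iff:
  assumes "F \<in> filters" "v \<in> vertices \<Lambda>" "\<mu> \<in> F" shows "v \<in> F \<longleftrightarrow> r \<mu> = v"
  using assms filter_range filter_range_mem vertex_simps by metis

lemma filter_deg_unique: "F \<in> filters \<Longrightarrow> \<mu> \<in> F \<Longrightarrow> \<nu> \<in> F \<Longrightarrow> d \<mu> = d \<nu> \<Longrightarrow> \<mu> = \<nu>"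
  by (metis filter_directed initial_antisym)

lemma filter_deg_le: "F \<in> filters \<Longrightarrow> \<mu> \<in> F \<Longrightarrow> \<nu> \<in> F \<Longrightarrow> d \<mu> \<le> d \<nu> \<Longrightarrow> \<mu> \<preceq> \<nu>"
  by (metis filter_directed initial_comparable)

lemma filter_segment:
  assumes "F \<in> filters" "\<kappa> \<in> F" "n \<le> d \<kappa>"
  obtains \<mu> where "\<mu> \<in> F" "d \<mu> = n"
proof -
  obtain \<mu> \<nu> where "\<mu> \<in> \<M>" "\<nu> \<in> \<M>" "s \<mu> = r \<nu>" "\<kappa> = \<mu> \<cdot> \<nu>" "d \<mu> = n"
    using factor assms filter_mor by metis
  then show thesis using that[of \<mu>] assms filter_down by blast
qed

lemma filters_eqI:
  assumes "F \<in> filters" "G \<in> filters" "\<And>\<kappa>. \<kappa> \<in> F \<Longrightarrow> \<exists>\<mu> \<in> G. \<kappa> \<preceq> \<mu>" "\<And>\<kappa>. \<kappa> \<in> G \<Longrightarrow> \<exists>\<mu> \<in> F. \<kappa> \<preceq> \<mu>"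
  shows "F = G"
  using assms filter_down by blast

text \<open>Members of \<open>FE\<close> must not contain their vertex, but the sets
  \<open>Ext\<close> may. If \<open>s \<kappa> \<in> E\<close>, that vertex is itself the
  witness.\<close>

lemma boundary_filter_exhaustive:
  assumes F: "F \<in> boundary_filters" and \<kappa>: "\<kappa> \<in> F" and E: "finite E" "exhaustive \<Lambda> (s \<kappa>) E"
  obtains \<nu> where "\<nu> \<in> E" "\<kappa> \<cdot> \<nu> \<in> F"
proof (cases "s \<kappa> \<in> E")
  case True
  then show thesis
    using that[of "s \<kappa>"] F \<kappa> filter_mor by (auto simp: boundary_filters_def)
next
  case False
  then have "E \<in> FE \<Lambda> (s \<kappa>)" using E by (simp add: FE_iff)
  then show thesis using that F \<kappa> unfolding boundary_filters_def by blast
qed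

text \<open>The filters of \<open>\<pi>x\<close> and of the path \<open>y\<close> with \<open>\<pi>y = x\<close>.\<close>

definition push :: "'a \<Rightarrow> 'a set \<Rightarrow> 'a set"
  where "push \<pi> F = {\<kappa>. \<exists>\<mu> \<in> F. r \<mu> = s \<pi> \<and> \<kappa> \<preceq> \<pi> \<cdot> \<mu>}"

definition pull :: "'a \<Rightarrow> 'a set \<Rightarrow> 'a set"
  where "pull \<pi> F = {\<mu> \<in> \<M>. r \<mu> = s \<pi> \<and> \<pi> \<cdot> \<mu> \<in> F}"

lemma mem_push_cmp:
  assumes "F \<in> filters" "\<pi> \<in> \<M>" "s \<pi> \<in> F" "\<mu> \<in> \<M>" "r \<mu> = s \<pi>"
  shows "\<pi> \<cdot> \<mu> \<in> push \<pi> F \<longleftrightarrow> \<mu> \<in> F"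
proof
  assume "\<pi> \<cdot> \<mu> \<in> push \<pi> F"
  then obtain \<nu> where \<nu>: "\<nu> \<in> F" "r \<nu> = s \<pi>" "\<pi> \<cdot> \<mu> \<preceq> \<pi> \<cdot> \<nu>"
    by (auto simp: push_def)
  then have "\<mu> \<preceq> \<nu>"
    using initial_cmp_cancel[OF assms(2,4) filter_mor[OF assms(1) \<nu>(1)]] assms(5) by metis
  then show "\<mu> \<in> F" using \<nu> assms filter_down by blast
qed (use assms in \<open>auto simp: push_def intro!: bexI[of _ \<mu>]\<close>)

lemma source_push:
  assumes "F \<in> filters" "\<pi> \<in> \<M>" "s \<pi> \<in> F"
  shows "\<pi> \<in> push \<pi> F"
  using mem_push_cmp[of F \<pi> "s \<pi>"] assms by simp

lemma push_filter:
  assumes F: "F \<in> filters" and \<pi>: "\<pi> \<in> \<M>" "s \<pi> \<in> F"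
  shows "push \<pi> F \<in> filters"
proof -
  have range: "r \<mu> = s \<pi>" if "\<mu> \<in> F" for \<mu>
    using that F \<pi> filter_range[of F \<mu> "s \<pi>"] by simp
  have "\<exists>\<kappa> \<in> push \<pi> F. \<mu> \<preceq> \<kappa> \<and> \<nu> \<preceq> \<kappa>" if asm: "\<mu> \<in> push \<pi> F" "\<nu> \<in> push \<pi> F" for \<mu> \<nu>
  proof -
    obtain \<mu>' \<nu>' where 1: "\<mu>' \<in> F" "\<nu>' \<in> F" "\<mu> \<preceq> \<pi> \<cdot> \<mu>'" "\<nu> \<preceq> \<pi> \<cdot> \<nu>'"
      using asm by (auto simp: push_def)
    then obtain \<kappa> where \<kappa>: "\<kappa> \<in> F" "\<mu>' \<preceq> \<kappa>" "\<nu>' \<preceq> \<kappa>"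
      using filter_directed F by blast
    have "\<pi> \<cdot> \<mu>' \<preceq> \<pi> \<cdot> \<kappa>" if "\<mu>' \<in> F" "\<mu>' \<preceq> \<kappa>" for \<mu>'
      using initial_cmp_cancel[OF \<pi>(1) filter_mor[OF F that(1)] filter_mor[OF F \<kappa>(1)]]
        range[OF that(1)] range[OF \<kappa>(1)] that(2) by metis
    then have "\<mu> \<preceq> \<pi> \<cdot> \<kappa>" "\<nu> \<preceq> \<pi> \<cdot> \<kappa>"
      using 1 \<kappa> initial_trans by blast+
    then show ?thesis
      using mem_push_cmp[OF F \<pi>, of \<kappa>] \<kappa> range filter_mor[OF F] by blast
  qed
  moreover have "push \<pi> F \<subseteq> \<M>"
    by (auto simp: push_def initial_mor)
  moreover have "\<mu> \<in> push \<pi> F" if "\<kappa> \<in> push \<pi> F" "\<mu> \<preceq> \<kappa>" for \<mu> \<kappa>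
    using that initial_trans unfolding push_def by blast
  ultimately show ?thesis
    using source_push[OF F \<pi>] unfolding filters_def by blast
qed

lemma pull_filter:
  assumes F: "F \<in> filters" and \<pi>: "\<pi> \<in> F"
  shows "pull \<pi> F \<in> filters" "s \<pi> \<in> pull \<pi> F"
proof -
  have \<pi>': "\<pi> \<in> \<M>" using assms filter_mor by blast
  show mem: "s \<pi> \<in> pull \<pi> F" using \<pi> \<pi>' by (simp add: pull_def)
  have "\<exists>\<kappa> \<in> pull \<pi> F. \<mu> \<preceq> \<kappa> \<and> \<nu> \<preceq> \<kappa>" if \<mu>\<nu>: "\<mu> \<in> pull \<pi> F" "\<nu> \<in> pull \<pi> F" for \<mu> \<nu>
  proof -
    obtain \<kappa> where \<kappa>: "\<kappa> \<in> F" "\<pi> \<cdot> \<mu> \<preceq> \<kappa>" "\<pi> \<cdot> \<nu> \<preceq> \<kappa>"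
      using \<mu>\<nu> filter_directed[OF F] by (auto simp: pull_def)
    then have "\<pi> \<preceq> \<kappa>"
      using \<mu>\<nu> \<pi>' initial_trans[OF initial_cmp] by (auto simp: pull_def)
    then obtain \<gamma> where "\<gamma> \<in> \<M>" "s \<pi> = r \<gamma>" "\<kappa> = \<pi> \<cdot> \<gamma>"
      by (rule initialE)
    then show ?thesis
      using \<kappa> \<mu>\<nu> \<pi>' initial_cmp_cancel by (intro bexI[of _ \<gamma>]) (auto simp: pull_def)
  qed
  moreover have "\<mu> \<in> pull \<pi> F" if "\<kappa> \<in> pull \<pi> F" "\<mu> \<preceq> \<kappa>" for \<mu> \<kappa>
  proof -
    have "\<mu> \<in> \<M>" "r \<mu> = s \<pi>" using that initial_mor initial_range by (auto simp: pull_def)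
    moreover from this have "\<pi> \<cdot> \<mu> \<preceq> \<pi> \<cdot> \<kappa>"
      using that \<pi>' initial_cmp_cancel by (simp add: pull_def)
    ultimately show ?thesis
      using that F filter_down by (auto simp: pull_def)
  qed
  moreover have "pull \<pi> F \<subseteq> \<M>" by (auto simp: pull_def)
  ultimately show "pull \<pi> F \<in> filters"
    using mem unfolding filters_def by blast
qed

lemma pull_push:
  assumes F: "F \<in> filters" and \<pi>: "\<pi> \<in> \<M>" "s \<pi> \<in> F"
  shows "pull \<pi> (push \<pi> F) = F"
proof -
  have "r \<mu> = s \<pi>" if "\<mu> \<in> F" for \<mu>
    using filter_range[OF F that \<pi>(2)] \<pi> by simp
  then show ?thesis
    using mem_push_cmp[OF F \<pi>] filter_mor[OF F] by (auto simp: pull_def)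
qed

lemma push_pull:
  assumes F: "F \<in> filters" and \<pi>: "\<pi> \<in> F"
  shows "push \<pi> (pull \<pi> F) = F"
proof (rule filters_eqI)
  show "push \<pi> (pull \<pi> F) \<in> filters"
    using push_filter pull_filter assms filter_mor by blast
  show "\<exists>\<mu> \<in> F. \<kappa> \<preceq> \<mu>" if "\<kappa> \<in> push \<pi> (pull \<pi> F)" for \<kappa>
    using that by (auto simp: push_def pull_def)
  show "\<exists>\<mu> \<in> push \<pi> (pull \<pi> F). \<kappa> \<preceq> \<mu>" if \<kappa>: "\<kappa> \<in> F" for \<kappa>
  proof -
    obtain \<mu> where \<mu>: "\<mu> \<in> F" "\<kappa> \<preceq> \<mu>" "\<pi> \<preceq> \<mu>"
      using filter_directed[OF F \<kappa> \<pi>] .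
    from \<mu>(3) obtain \<gamma> where "\<gamma> \<in> \<M>" "s \<pi> = r \<gamma>" "\<mu> = \<pi> \<cdot> \<gamma>"
      by (rule initialE)
    then have "\<mu> \<in> push \<pi> (pull \<pi> F)"
      using \<mu> filter_mor[OF F] by (auto simp: push_def pull_def intro!: bexI[of _ \<gamma>])
    then show ?thesis using \<mu> by blast
  qed
qed (rule F)

lemma pull_pull:
  assumes "\<pi> \<in> \<M>" "\<mu> \<in> \<M>" "s \<pi> = r \<mu>"
  shows "pull \<mu> (pull \<pi> F) = pull (\<pi> \<cdot> \<mu>) F"
  using assms by (auto simp: pull_def cmp_assoc)

text \<open>Pulling the left side back along \<open>\<pi> \<cdot> \<mu>\<close> gives
  \<open>F\<close> by \<open>pull_pull\<close> and \<open>pull_push\<close>. Pushing forward again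
  recovers it, so the nested downward closures are never unfolded.\<close>

lemma push_push:
  assumes F: "F \<in> filters" and \<pi>: "\<pi> \<in> \<M>" "\<mu> \<in> \<M>" "s \<pi> = r \<mu>" "s \<mu> \<in> F"
  shows "push \<pi> (push \<mu> F) = push (\<pi> \<cdot> \<mu>) F"
proof -
  have push: "push \<mu> F \<in> filters" "\<mu> \<in> push \<mu> F"
    using assms by (simp_all add: push_filter source_push)
  then have "r \<mu> \<in> push \<mu> F" by (rule filter_range_mem)
  then have *: "s \<pi> \<in> push \<mu> F" using \<pi> by simp
  then have G: "push \<pi> (push \<mu> F) \<in> filters"
    using push \<pi> by (simp add: push_filter)
  have mem: "\<pi> \<cdot> \<mu> \<in> push \<pi> (push \<mu> F)"
    using push * \<pi> by (simp add: mem_push_cmp)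
  have "pull (\<pi> \<cdot> \<mu>) (push \<pi> (push \<mu> F)) = F"
    using pull_pull[OF \<pi>(1-3)] pull_push[OF push(1) \<pi>(1) *] pull_push[OF F \<pi>(2,4)] by metis
  then show ?thesis using push_pull[OF G mem] by simp
qed

lemma pull_vertex: "F \<in> filters \<Longrightarrow> v \<in> vertices \<Lambda> \<Longrightarrow> v \<in> F \<Longrightarrow> pull v F = F"
  unfolding pull_def using filter_vertex_iff filter_mor vertex_simps cmp_rng
  by (intro set_eqI) (smt (verit) mem_Collect_eq)

lemma push_vertex: "F \<in> filters \<Longrightarrow> v \<in> vertices \<Lambda> \<Longrightarrow> v \<in> F \<Longrightarrow> push v F = F"
  using pull_vertex push_pull by metis

lemma pull_boundary:
  assumes F: "F \<in> boundary_filters" and \<pi>: "\<pi> \<in> F"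
  shows "pull \<pi> F \<in> boundary_filters"
proof -
  note F' = boundary_filterD[OF F]
  have \<pi>': "\<pi> \<in> \<M>" using F' \<pi> filter_mor by blast
  have "\<exists>\<nu> \<in> E. \<mu> \<cdot> \<nu> \<in> pull \<pi> F" if asm: "\<mu> \<in> pull \<pi> F" "E \<in> FE \<Lambda> (s \<mu>)" for \<mu> E
  proof -
    have \<mu>: "\<mu> \<in> \<M>" "s \<pi> = r \<mu>" "\<pi> \<cdot> \<mu> \<in> F"
      using asm by (auto simp: pull_def)
    then have "E \<in> FE \<Lambda> (s (\<pi> \<cdot> \<mu>))" using asm(2) \<pi>' by simp
    then obtain \<nu> where \<nu>: "\<nu> \<in> E" "\<pi> \<cdot> \<mu> \<cdot> \<nu> \<in> F"
      using F \<mu>(3) unfolding boundary_filters_def by blast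
    then have "\<nu> \<in> \<M>" "r \<nu> = s \<mu>"
      using asm(2) by (auto simp: FE_def paths_to_def)
    then show ?thesis
      using \<nu> \<mu> \<pi>' by (intro bexI[of _ \<nu>]) (auto simp: pull_def cmp_assoc)
  qed
  then show ?thesis
    using pull_filter[OF F' \<pi>] by (simp add: boundary_filters_def)
qed

text \<open>An element \<open>\<kappa>\<close> of the new filter may end in the middle of
  \<open>\<pi>\<close>, where \<open>F\<close> says nothing. Writing
  \<open>\<pi> \<cdot> \<mu> = \<kappa> \<cdot> \<gamma>\<close> with \<open>\<mu> \<in> F\<close>,
  the set \<open>Ext \<gamma> E\<close> moves \<open>E\<close> to the source of
  \<open>\<mu>\<close>, where the boundary condition of \<open>F\<close> applies.\<close>

lemma push_boundary:
  assumes fa: "finitely_aligned \<Lambda>" and F: "F \<in> boundary_filters" and \<pi>: "\<pi> \<in> \<M>" "s \<pi> \<in> F"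
  shows "push \<pi> F \<in> boundary_filters"
proof -
  note F' = boundary_filterD[OF F]
  have "\<exists>\<nu> \<in> E. \<kappa> \<cdot> \<nu> \<in> push \<pi> F" if "\<kappa> \<in> push \<pi> F" "E \<in> FE \<Lambda> (s \<kappa>)" for \<kappa> E
  proof -
    have E: "finite E" "exhaustive \<Lambda> (s \<kappa>) E" "E \<subseteq> \<M>"
      using that(2) by (auto simp: FE_iff exhaustive_iff paths_to_def)
    obtain \<mu> where \<mu>: "\<mu> \<in> F" "r \<mu> = s \<pi>" "\<kappa> \<preceq> \<pi> \<cdot> \<mu>"
      using \<open>\<kappa> \<in> push \<pi> F\<close> by (auto simp: push_def)
    have \<mu>': "\<mu> \<in> \<M>" using \<mu> F' filter_mor by blast
    obtain \<gamma> where \<gamma>: "\<kappa> \<in> \<M>" "\<gamma> \<in> \<M>" "s \<kappa> = r \<gamma>" "\<pi> \<cdot> \<mu> = \<kappa> \<cdot> \<gamma>"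
      using \<mu>(3) by (rule initialE)
    have s: "s \<gamma> = s \<mu>"
      using src_cmp[of \<kappa> \<gamma>] src_cmp[of \<pi> \<mu>] \<gamma> \<mu> \<mu>' \<pi> by simp
    have "finite (Ext \<gamma> E)" "exhaustive \<Lambda> (s \<mu>) (Ext \<gamma> E)"
      using finite_Ext[OF fa E(1,3) \<gamma>(2)] exhaustive_Ext_of_exhaustive[OF E(2) \<gamma>(2)] \<gamma> s by simp_all
    then obtain \<rho> where \<rho>: "\<rho> \<in> Ext \<gamma> E" "\<mu> \<cdot> \<rho> \<in> F"
      using boundary_filter_exhaustive[OF F \<mu>(1)] by blast
    obtain \<nu> \<tau> where \<nu>: "\<nu> \<in> E" "\<rho> \<in> \<M>" "\<tau> \<in> \<M>" "s \<gamma> = r \<rho>" "s \<nu> = r \<tau>" "\<gamma> \<cdot> \<rho> = \<nu> \<cdot> \<tau>"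
      using ExtE[OF \<rho>(1) E(3) \<gamma>(2)] .
    have "r \<nu> = r \<gamma>" using \<nu> \<gamma> E(3) rng_cmp by (metis subsetD)
    then have "\<pi> \<cdot> (\<mu> \<cdot> \<rho>) = (\<kappa> \<cdot> \<nu>) \<cdot> \<tau>"
      using \<pi> \<mu> \<mu>' \<gamma> \<nu> s E(3) by (simp add: subset_iff cmp_assoc flip: cmp_assoc[of \<pi>])
    then have "\<kappa> \<cdot> \<nu> \<preceq> \<pi> \<cdot> (\<mu> \<cdot> \<rho>)"
      using \<gamma> \<nu> E(3) \<open>r \<nu> = r \<gamma>\<close> by (simp add: subset_iff initial_cmp)
    then have "\<kappa> \<cdot> \<nu> \<in> push \<pi> F"
      using \<rho> \<mu> \<mu>' \<nu> s by (auto simp: push_def intro!: bexI[of _ "\<mu> \<cdot> \<rho>"])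
    then show ?thesis using \<nu> by blast
  qed
  then show ?thesis
    using push_filter[OF F' \<pi>] by (simp add: boundary_filters_def)
qed


section \<open>Generic boundary paths\<close>

text \<open>A Baire category argument along an increasing sequence in \<open>P\<close>.\<close>

lemma generic_filter:
  assumes P: "P \<subseteq> \<M>" and \<alpha>: "\<alpha> \<in> P" and count: "countable \<D>"
    and dense: "\<And>D \<kappa>. \<lbrakk>D \<in> \<D>; \<kappa> \<in> P\<rbrakk> \<Longrightarrow> \<exists>\<mu> \<in> P \<inter> D. \<kappa> \<preceq> \<mu>"
  obtains F where "F \<in> filters" "\<alpha> \<in> F" "\<And>D. D \<in> \<D> \<Longrightarrow> \<exists>\<kappa> \<in> P \<inter> D. \<kappa> \<in> F"
    "\<And>\<kappa>. \<kappa> \<in> F \<Longrightarrow> \<exists>\<mu> \<in> P \<inter> F. \<kappa> \<preceq> \<mu>"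
proof -
  \<comment> \<open>Inserting \<open>P\<close>, which is trivially dense in itself, makes the family
    nonempty, so that \<open>from_nat_into\<close> really enumerates it.\<close>
  define D where "D = (\<lambda>n. from_nat_into (insert P \<D>) n)"
  have D_mem: "D n \<in> insert P \<D>" for n
    unfolding D_def by (rule from_nat_into) simp
  have step: "\<exists>\<mu>. \<mu> \<in> P \<and> \<mu> \<in> D n \<and> \<kappa> \<preceq> \<mu>" if "\<kappa> \<in> P" for \<kappa> n
  proof -
    have "\<kappa> \<preceq> \<kappa>" using that P by auto
    then show ?thesis using D_mem[of n] dense[of "D n" \<kappa>] that by blast
  qed
  have "\<exists>f. \<forall>n. f n \<in> P \<and> (f n \<preceq> f (Suc n) \<and> f (Suc n) \<in> D n) \<and> (n = 0 \<longrightarrow> f n = \<alpha>)"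
    using dependent_nat_choice[of "\<lambda>n \<mu>. \<mu> \<in> P \<and> (n = 0 \<longrightarrow> \<mu> = \<alpha>)" "\<lambda>n \<kappa> \<mu>. \<kappa> \<preceq> \<mu> \<and> \<mu> \<in> D n"]
      step \<alpha> by (metis old.nat.distinct(1))
  then obtain f where f: "\<And>n. f n \<in> P" "\<And>n. f n \<preceq> f (Suc n)" "\<And>n. f (Suc n) \<in> D n" "f 0 = \<alpha>"
    by blast
  have mono: "f m \<preceq> f n" if "m \<le> n" for m n
    using that
  proof (induction rule: dec_induct)
    case base
    show ?case using f(1)[of m] P by (blast intro: initial_refl)
  next
    case (step n)
    then show ?case using f(2) initial_trans by blast
  qed
  define F where "F = {\<kappa>. \<exists>n. \<kappa> \<preceq> f n}"
  have fF: "f n \<in> F" for n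
    using f(1)[of n] P initial_refl[of "f n"] unfolding F_def by blast
  have "F \<in> filters"
    unfolding filters_def
  proof (intro CollectI conjI ballI allI impI)
    show "F \<subseteq> \<M>" by (auto simp: F_def initial_mor)
    show "F \<noteq> {}" using fF by blast
    show "\<mu> \<in> F" if "\<kappa> \<in> F" "\<mu> \<preceq> \<kappa>" for \<kappa> \<mu>
      using that initial_trans by (auto simp: F_def)
    fix \<mu> \<nu> assume "\<mu> \<in> F" "\<nu> \<in> F"
    then obtain m n where "\<mu> \<preceq> f m" "\<nu> \<preceq> f n" by (auto simp: F_def)
    then have "\<mu> \<preceq> f (max m n)" "\<nu> \<preceq> f (max m n)"
      using initial_trans mono by (meson max.cobounded1 max.cobounded2)+
    then show "\<exists>\<kappa> \<in> F. \<mu> \<preceq> \<kappa> \<and> \<nu> \<preceq> \<kappa>" using fF by blast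
  qed
  moreover have "\<exists>\<kappa> \<in> P \<inter> A. \<kappa> \<in> F" if A: "A \<in> \<D>" for A
  proof -
    obtain n where "D n = A"
      using A count from_nat_into_surj[of "insert P \<D>" A] unfolding D_def by auto
    then show ?thesis using f fF by blast
  qed
  moreover have "\<exists>\<mu> \<in> P \<inter> F. \<kappa> \<preceq> \<mu>" if "\<kappa> \<in> F" for \<kappa>
    using that f(1) fF by (auto simp: F_def)
  ultimately show thesis using that[of F] fF[of 0] f(4) by simp
qed

text \<open>
  Being a boundary path is a generic property: for \<open>\<mu>\<close> and \<open>E \<in> FE(\<Lambda>)\<close> with \<open>r(E) = s(\<mu>)\<close>, those
  \<open>\<kappa> \<in> P\<close> are dense which extend to \<open>\<mu>\<nu>\<close> for some \<open>\<nu> \<in> E\<close> or cannot be extended to \<open>\<mu>\<close> in \<open>P\<close>.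
\<close>

lemma generic_boundary_filter:
  assumes fa: "finitely_aligned \<Lambda>" and P: "P \<subseteq> \<M>" and \<alpha>: "\<alpha> \<in> P" and count: "countable \<D>"
    and dense: "\<And>D \<kappa>. \<lbrakk>D \<in> \<D>; \<kappa> \<in> P\<rbrakk> \<Longrightarrow> \<exists>\<mu> \<in> P \<inter> D. \<kappa> \<preceq> \<mu>"
    and ext: "\<And>\<kappa> E. \<lbrakk>\<kappa> \<in> P; finite E; exhaustive \<Lambda> (s \<kappa>) E\<rbrakk> \<Longrightarrow> \<exists>\<nu> \<in> E. \<kappa> \<cdot> \<nu> \<in> P"
  obtains F where "F \<in> boundary_filters" "\<alpha> \<in> F" "\<And>D. D \<in> \<D> \<Longrightarrow> \<exists>\<kappa> \<in> P \<inter> D. \<kappa> \<in> F"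
    "\<And>\<kappa>. \<kappa> \<in> F \<Longrightarrow> \<exists>\<mu> \<in> P \<inter> F. \<kappa> \<preceq> \<mu>"
proof -
  define B where "B = (\<lambda>(\<mu>, E). {\<kappa>. (\<exists>\<nu> \<in> E. \<mu> \<cdot> \<nu> \<preceq> \<kappa>) \<or> (\<forall>\<eta> \<in> P. \<kappa> \<preceq> \<eta> \<longrightarrow> \<not> \<mu> \<preceq> \<eta>)})"
  define X where "X = {(\<mu>, E). \<mu> \<in> \<M> \<and> E \<in> FE \<Lambda> (s \<mu>)}"
  have "countable {E. finite E \<and> E \<subseteq> \<M>}"
    using countable_mor by (rule countable_Collect_finite_subset)
  then have "countable (\<M> \<times> {E. finite E \<and> E \<subseteq> \<M>})"
    using countable_mor by blast
  then have "countable X"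
    by (rule countable_subset[rotated]) (auto simp: X_def FE_def paths_to_def)
  then have count': "countable (\<D> \<union> B ` X)" using count by blast
  have dense': "\<exists>\<mu> \<in> P \<inter> D. \<kappa> \<preceq> \<mu>" if D: "D \<in> \<D> \<union> B ` X" and \<kappa>: "\<kappa> \<in> P" for D \<kappa>
  proof (cases "D \<in> \<D>")
    case False
    then obtain \<mu> E where DB: "D = B (\<mu>, E)" and \<mu>: "\<mu> \<in> \<M>" and "E \<in> FE \<Lambda> (s \<mu>)"
      using D by (auto simp: X_def)
    then have E: "finite E" "exhaustive \<Lambda> (s \<mu>) E" "E \<subseteq> \<M>" "\<And>\<nu>. \<nu> \<in> E \<Longrightarrow> r \<nu> = s \<mu>"
      by (auto simp: FE_iff exhaustive_iff paths_to_def)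
    show ?thesis
    proof (cases "\<forall>\<eta> \<in> P. \<kappa> \<preceq> \<eta> \<longrightarrow> \<not> \<mu> \<preceq> \<eta>")
      case True
      then have "\<kappa> \<in> P \<inter> D" using \<kappa> by (simp add: DB B_def)
      then show ?thesis using P by (intro bexI[of _ \<kappa>]) auto
    next
      case False
      then obtain \<eta> where \<eta>: "\<eta> \<in> P" "\<kappa> \<preceq> \<eta>" "\<mu> \<preceq> \<eta>" by blast
      from \<eta>(3) obtain \<gamma> where \<gamma>: "\<gamma> \<in> \<M>" "s \<mu> = r \<gamma>" "\<eta> = \<mu> \<cdot> \<gamma>"
        by (rule initialE)
      then have s: "s \<eta> = s \<gamma>" using \<mu> by simp
      \<comment> \<open>\<open>E\<close> sits at \<open>s \<mu>\<close>, but only the end of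
        \<open>\<eta>\<close> can be extended within \<open>P\<close>. Moving \<open>E\<close> along
        \<open>\<gamma>\<close> gives an extension of \<open>\<eta>\<close> that passes through some
        \<open>\<mu> \<cdot> \<nu>\<close>.\<close>
      have "finite (Ext \<gamma> E)" "exhaustive \<Lambda> (s \<eta>) (Ext \<gamma> E)"
        using finite_Ext[OF fa E(1,3) \<gamma>(1)] exhaustive_Ext_of_exhaustive[OF E(2) \<gamma>(1)] \<gamma> s by simp_all
      then obtain \<rho> where \<rho>: "\<rho> \<in> Ext \<gamma> E" "\<eta> \<cdot> \<rho> \<in> P"
        using ext \<eta> by blast
      obtain \<nu> \<tau> where \<nu>: "\<nu> \<in> E" "\<rho> \<in> \<M>" "\<tau> \<in> \<M>" "s \<gamma> = r \<rho>" "s \<nu> = r \<tau>" "\<gamma> \<cdot> \<rho> = \<nu> \<cdot> \<tau>"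
        using ExtE[OF \<rho>(1) E(3) \<gamma>(1)] .
      have \<nu>': "\<nu> \<in> \<M>" "s \<mu> = r \<nu>" using \<nu>(1) E(3,4) by auto
      have "\<eta> \<cdot> \<rho> = \<mu> \<cdot> (\<gamma> \<cdot> \<rho>)"
        unfolding \<gamma>(3) using \<mu> \<gamma>(1,2) \<nu>(2,4) by (simp add: cmp_assoc)
      also have "\<dots> = (\<mu> \<cdot> \<nu>) \<cdot> \<tau>"
        unfolding \<nu>(6) using \<mu> \<nu>' \<nu>(3,5) by (simp add: cmp_assoc)
      finally have "\<mu> \<cdot> \<nu> \<preceq> \<eta> \<cdot> \<rho>"
        using \<mu> \<nu>' \<nu>(3,5) by (simp add: initial_cmp)
      moreover have "\<kappa> \<preceq> \<eta> \<cdot> \<rho>"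
        using initial_trans[OF \<eta>(2) initial_cmp[of \<eta> \<rho>]] initial_mor(2)[OF \<eta>(2)] \<nu>(2,4) s by simp
      ultimately show ?thesis
        using \<rho>(2) \<nu>(1) by (intro bexI[of _ "\<eta> \<cdot> \<rho>"]) (auto simp: DB B_def)
    qed
  qed (use dense \<kappa> in blast)
  obtain F where F: "F \<in> filters" "\<alpha> \<in> F" "\<And>D. D \<in> \<D> \<union> B ` X \<Longrightarrow> \<exists>\<kappa> \<in> P \<inter> D. \<kappa> \<in> F"
      "\<And>\<kappa>. \<kappa> \<in> F \<Longrightarrow> \<exists>\<mu> \<in> P \<inter> F. \<kappa> \<preceq> \<mu>"
    using generic_filter[OF P \<alpha> count' dense'] by blast
  have "\<exists>\<nu> \<in> E. \<mu> \<cdot> \<nu> \<in> F" if \<mu>: "\<mu> \<in> F" and E: "E \<in> FE \<Lambda> (s \<mu>)" for \<mu> E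
  proof -
    have "(\<mu>, E) \<in> X" using \<mu> E F(1) filter_mor by (auto simp: X_def)
    then obtain \<kappa> where \<kappa>: "\<kappa> \<in> F" "\<kappa> \<in> B (\<mu>, E)"
      using F(3) by blast
    obtain \<eta> where \<eta>: "\<eta> \<in> F" "\<kappa> \<preceq> \<eta>" "\<mu> \<preceq> \<eta>"
      using filter_directed[OF F(1) \<kappa>(1) \<mu>] .
    \<comment> \<open>Since \<open>P\<close> is cofinal in \<open>F\<close>, some member of
      \<open>P\<close> extends both \<open>\<kappa>\<close> and \<open>\<mu>\<close>; this excludes
      the second alternative in \<open>B\<close>.\<close>
    then obtain \<zeta> where "\<zeta> \<in> P" "\<eta> \<preceq> \<zeta>"
      using F(4) by blast
    moreover from this have "\<kappa> \<preceq> \<zeta>" "\<mu> \<preceq> \<zeta>"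
      using initial_trans \<eta> by blast+
    ultimately have "\<exists>\<nu> \<in> E. \<mu> \<cdot> \<nu> \<preceq> \<kappa>"
      using \<kappa>(2) unfolding B_def by blast
    then show ?thesis using filter_down[OF F(1) \<kappa>(1)] by blast
  qed
  then have "F \<in> boundary_filters" using F(1) by (simp add: boundary_filters_def)
  then show thesis using that F by blast
qed

lemma exhaustive_cmp_mor:
  assumes "\<kappa> \<in> \<M>" "exhaustive \<Lambda> (s \<kappa>) E"
  shows "\<exists>\<nu> \<in> E. \<kappa> \<cdot> \<nu> \<in> \<M>"
proof -
  have "s \<kappa> \<in> \<M>" "r (s \<kappa>) = s \<kappa>" using assms(1) by simp_all
  then obtain \<nu> where "\<nu> \<in> E" using assms(2) unfolding exhaustive_iff by blast
  then show ?thesis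
    using assms by (intro bexI[of _ \<nu>]) (auto simp: exhaustive_iff paths_to_def)
qed

text \<open>With no further dense sets, the category argument still yields a boundary path through
  every finite path. This makes every vertex act nontrivially in the boundary path
  representation.\<close>

lemma boundary_filter_through:
  assumes "finitely_aligned \<Lambda>" "\<alpha> \<in> \<M>"
  obtains F where "F \<in> boundary_filters" "\<alpha> \<in> F"
proof (rule generic_boundary_filter[OF assms(1) order.refl assms(2) countable_empty])
  show "\<exists>\<nu> \<in> E. \<kappa> \<cdot> \<nu> \<in> \<M>" if "\<kappa> \<in> \<M>" "exhaustive \<Lambda> (s \<kappa>) E" for \<kappa> E
    using that by (rule exhaustive_cmp_mor)
qed (use that in auto)


section \<open>Aperiodicity by incompatible extensions\<close>

text \<open>Aperiodicity expressed by finite paths only (see \<open>aperiodic_graph_iff\<close>).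
  Both implications of the theorem use it in this form.\<close>

definition separating :: bool
  where "separating \<longleftrightarrow> (\<forall>\<alpha> \<in> \<M>. \<forall>\<beta> \<in> \<M>. s \<alpha> = s \<beta> \<longrightarrow> \<alpha> \<noteq> \<beta> \<longrightarrow>
    (\<exists>\<xi> \<in> \<M>. r \<xi> = s \<alpha> \<and> \<not> compatible (\<alpha> \<cdot> \<xi>) (\<beta> \<cdot> \<xi>)))"

text \<open>
  Let \<open>\<alpha>\<tau>\<close> be an initial segment of \<open>\<alpha>x\<close> but not of \<open>\<beta>x\<close>.  The \<open>\<sigma>\<close> for which \<open>\<beta>\<tau>\<sigma>\<close> is a minimal
  common extension of \<open>\<alpha>\<tau>\<close> and \<open>\<beta>\<tau>\<close> form a finite set which is not exhaustive, because \<open>x\<close> is a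
  boundary path.
\<close>

lemma incompatible_extension_aux:
  assumes fa: "finitely_aligned \<Lambda>" and F: "F \<in> boundary_filters"
    and \<alpha>: "\<alpha> \<in> \<M>" "s \<alpha> \<in> F" and \<beta>: "\<beta> \<in> \<M>" "s \<beta> = s \<alpha>"
    and notsub: "\<not> push \<alpha> F \<subseteq> push \<beta> F"
  shows "\<exists>\<xi> \<in> \<M>. r \<xi> = s \<alpha> \<and> \<not> compatible (\<alpha> \<cdot> \<xi>) (\<beta> \<cdot> \<xi>)"
proof -
  note F' = boundary_filterD[OF F]
  have push: "push \<beta> F \<in> filters" using push_filter F' \<alpha> \<beta> by simp
  obtain \<kappa> where \<kappa>: "\<kappa> \<in> push \<alpha> F" "\<kappa> \<notin> push \<beta> F" using notsub by blast
  then obtain \<tau> where \<tau>: "\<tau> \<in> F" "r \<tau> = s \<alpha>" "\<kappa> \<preceq> \<alpha> \<cdot> \<tau>" by (auto simp: push_def)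
  have \<tau>': "\<tau> \<in> \<M>" using \<tau> F' filter_mor by blast
  have not: "\<alpha> \<cdot> \<tau> \<notin> push \<beta> F" using \<kappa> \<tau> push filter_down by blast
  have \<alpha>\<tau>: "\<alpha> \<cdot> \<tau> \<in> \<M>" "\<beta> \<cdot> \<tau> \<in> \<M>" "s (\<alpha> \<cdot> \<tau>) = s \<tau>" "s (\<beta> \<cdot> \<tau>) = s \<tau>"
    using \<alpha> \<beta> \<tau> \<tau>' by simp_all
  define G where "G = Ext (\<beta> \<cdot> \<tau>) {\<alpha> \<cdot> \<tau>}"
  have fin: "finite G" unfolding G_def using finite_Ext[OF fa] \<alpha>\<tau> by simp
  have "\<not> exhaustive \<Lambda> (s \<tau>) G"
  proof
    assume "exhaustive \<Lambda> (s \<tau>) G"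
    then obtain \<sigma> where \<sigma>: "\<sigma> \<in> G" "\<tau> \<cdot> \<sigma> \<in> F"
      using boundary_filter_exhaustive[OF F \<tau>(1) fin] by blast
    obtain \<rho> where "(\<sigma>, \<rho>) \<in> Lmin \<Lambda> (\<beta> \<cdot> \<tau>) (\<alpha> \<cdot> \<tau>)"
      using \<sigma>(1) by (auto simp: G_def Ext_def)
    from iffD1[OF Lmin_iff[OF \<alpha>\<tau>(2,1)] this]
    have \<rho>: "\<sigma> \<in> \<M>" "\<rho> \<in> \<M>" "s \<tau> = r \<sigma>" "s \<tau> = r \<rho>" "(\<beta> \<cdot> \<tau>) \<cdot> \<sigma> = (\<alpha> \<cdot> \<tau>) \<cdot> \<rho>"
      unfolding \<alpha>\<tau>(3,4) by blast+
    have "\<alpha> \<cdot> \<tau> \<preceq> \<beta> \<cdot> (\<tau> \<cdot> \<sigma>)"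
    proof -
      have "\<beta> \<cdot> (\<tau> \<cdot> \<sigma>) = (\<alpha> \<cdot> \<tau>) \<cdot> \<rho>"
        using cmp_assoc[of \<beta> \<tau> \<sigma>] \<beta> \<tau>' \<tau>(2) \<rho>(1,3,5) by simp
      then show ?thesis using initial_cmp[OF \<alpha>\<tau>(1) \<rho>(2)] \<rho>(4) \<alpha>\<tau>(3) by simp
    qed
    moreover have "\<beta> \<cdot> (\<tau> \<cdot> \<sigma>) \<in> push \<beta> F"
      using mem_push_cmp[OF F' \<beta>(1)] \<sigma> \<rho> \<tau> \<tau>' \<alpha> \<beta> by simp
    ultimately show False using not push filter_down by blast
  qed
  moreover have "G \<subseteq> paths_to \<Lambda> (s \<tau>)"
    using ExtE[of _ "\<beta> \<cdot> \<tau>" "{\<alpha> \<cdot> \<tau>}"] \<alpha>\<tau> unfolding G_def paths_to_def by force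
  ultimately obtain \<xi> where \<xi>: "\<xi> \<in> \<M>" "r \<xi> = s \<tau>" "\<And>\<sigma>. \<sigma> \<in> G \<Longrightarrow> \<not> compatible \<xi> \<sigma>"
    unfolding exhaustive_iff by blast
  \<comment> \<open>A common extension would lie above \<open>\<beta> \<cdot> \<tau>\<close> and
    \<open>\<alpha> \<cdot> \<tau>\<close>, hence above
    \<open>\<beta> \<cdot> \<tau> \<cdot> \<sigma>\<close> for some \<open>\<sigma> \<in> G\<close>;
    cancelling \<open>\<beta> \<cdot> \<tau>\<close> would make \<open>\<xi>\<close> compatible with
    \<open>\<sigma>\<close>.\<close>
  have "\<not> compatible ((\<alpha> \<cdot> \<tau>) \<cdot> \<xi>) ((\<beta> \<cdot> \<tau>) \<cdot> \<xi>)"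
  proof
    assume "compatible ((\<alpha> \<cdot> \<tau>) \<cdot> \<xi>) ((\<beta> \<cdot> \<tau>) \<cdot> \<xi>)"
    moreover have "\<alpha> \<cdot> \<tau> \<preceq> (\<alpha> \<cdot> \<tau>) \<cdot> \<xi>" using \<alpha>\<tau> \<xi> by (intro initial_cmp) simp_all
    ultimately have "compatible ((\<beta> \<cdot> \<tau>) \<cdot> \<xi>) (\<alpha> \<cdot> \<tau>)"
      using compatible_initial compatible_sym initial_refl \<alpha>\<tau> \<xi> cmp_mor by metis
    then obtain \<eta> where \<eta>: "(\<beta> \<cdot> \<tau>) \<cdot> \<xi> \<preceq> \<eta>" "\<alpha> \<cdot> \<tau> \<preceq> \<eta>" by (auto simp: compatible_def)
    have \<beta>\<tau>: "\<beta> \<cdot> \<tau> \<preceq> \<eta>" using initial_trans[OF initial_cmp \<eta>(1)] \<alpha>\<tau> \<xi> by simp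
    then obtain \<sigma> \<rho> where \<sigma>: "(\<sigma>, \<rho>) \<in> Lmin \<Lambda> (\<beta> \<cdot> \<tau>) (\<alpha> \<cdot> \<tau>)" "(\<beta> \<cdot> \<tau>) \<cdot> \<sigma> \<preceq> \<eta>"
      using \<eta>(2) by (rule Lmin_of_common_extension)
    then have \<sigma>': "\<sigma> \<in> \<M>" "s (\<beta> \<cdot> \<tau>) = r \<sigma>" "\<sigma> \<in> G"
      using Lmin_iff[of "\<beta> \<cdot> \<tau>" "\<alpha> \<cdot> \<tau>"] \<alpha>\<tau> by (auto simp: G_def Ext_def)
    obtain \<gamma> where \<gamma>: "\<gamma> \<in> \<M>" "s (\<beta> \<cdot> \<tau>) = r \<gamma>" "\<eta> = (\<beta> \<cdot> \<tau>) \<cdot> \<gamma>"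
      using \<beta>\<tau> by (rule initialE)
    have "\<xi> \<preceq> \<gamma>" "\<sigma> \<preceq> \<gamma>"
      using initial_cmp_cancel[OF \<alpha>\<tau>(2) _ \<gamma>(1) _ \<gamma>(2)] \<eta>(1) \<sigma>(2) \<sigma>'(1,2) \<xi>(1,2) \<alpha>\<tau>(4) \<gamma>(3) by auto
    then show False using \<xi>(3) \<sigma>'(3) by (auto simp: compatible_def)
  qed
  then show ?thesis
    using \<alpha> \<beta> \<tau>(2) \<tau>' \<xi>(1,2) by (intro bexI[of _ "\<tau> \<cdot> \<xi>"]) (simp_all add: cmp_assoc)
qed

lemma incompatible_extension:
  assumes fa: "finitely_aligned \<Lambda>" and F: "F \<in> boundary_filters"
    and \<alpha>: "\<alpha> \<in> \<M>" "s \<alpha> \<in> F" and \<beta>: "\<beta> \<in> \<M>" "s \<beta> = s \<alpha>" and ne: "push \<alpha> F \<noteq> push \<beta> F"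
  shows "\<exists>\<xi> \<in> \<M>. r \<xi> = s \<alpha> \<and> \<not> compatible (\<alpha> \<cdot> \<xi>) (\<beta> \<cdot> \<xi>)"
proof (cases "push \<alpha> F \<subseteq> push \<beta> F")
  case True
  then have "\<not> push \<beta> F \<subseteq> push \<alpha> F" using ne by blast
  then show ?thesis
    using incompatible_extension_aux[OF fa F \<beta>(1) _ \<alpha>(1)] \<alpha> \<beta> compatible_sym by metis
qed (use incompatible_extension_aux[OF assms(1-6)] in simp)

lemma aperiodic_filter:
  assumes fa: "finitely_aligned \<Lambda>" and sep: separating and v: "v \<in> vertices \<Lambda>"
  obtains F where "F \<in> boundary_filters" "v \<in> F"
    "\<And>\<alpha> \<beta>. \<lbrakk>\<alpha> \<in> \<M>; \<beta> \<in> \<M>; s \<alpha> = v; s \<beta> = v; \<alpha> \<noteq> \<beta>\<rbrakk> \<Longrightarrow> push \<alpha> F \<noteq> push \<beta> F"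
proof -
  \<comment> \<open>Paths that cannot be composed with \<open>\<alpha>\<close> are included, so that
    the set is dense among all paths and not only among those with range
    \<open>s \<alpha>\<close>.\<close>
  define A where "A = (\<lambda>(\<alpha>, \<beta>). {\<tau>. r \<tau> = s \<alpha> \<longrightarrow> \<not> compatible (\<alpha> \<cdot> \<tau>) (\<beta> \<cdot> \<tau>)})"
  define X where "X = {(\<alpha>, \<beta>). \<alpha> \<in> \<M> \<and> \<beta> \<in> \<M> \<and> s \<alpha> = s \<beta> \<and> \<alpha> \<noteq> \<beta>}"
  have "countable X"
    by (rule countable_subset[of _ "\<M> \<times> \<M>"]) (auto simp: X_def countable_mor)
  then have count: "countable (A ` X)" by blast
  have dense: "\<exists>\<mu> \<in> \<M> \<inter> D. \<kappa> \<preceq> \<mu>" if D: "D \<in> A ` X" and \<kappa>: "\<kappa> \<in> \<M>" for D \<kappa>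
  proof -
    obtain \<alpha> \<beta> where DA: "D = A (\<alpha>, \<beta>)" and ab: "\<alpha> \<in> \<M>" "\<beta> \<in> \<M>" "s \<alpha> = s \<beta>" "\<alpha> \<noteq> \<beta>"
      using D by (auto simp: X_def)
    show ?thesis
    proof (cases "r \<kappa> = s \<alpha>")
      case True
      \<comment> \<open>Right cancellation keeps the pair distinct after appending
        \<open>\<kappa>\<close>, so separation applies again beyond \<open>\<kappa>\<close>. This is
        the density of \<open>A\<close>.\<close>
      have "\<alpha> \<cdot> \<kappa> \<noteq> \<beta> \<cdot> \<kappa>"
        using right_cancel[OF ab(1,2) \<kappa>] ab(3,4) True by metis
      then obtain \<xi> where \<xi>: "\<xi> \<in> \<M>" "r \<xi> = s \<kappa>" "\<not> compatible (\<alpha> \<cdot> \<kappa> \<cdot> \<xi>) (\<beta> \<cdot> \<kappa> \<cdot> \<xi>)"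
        using sep[unfolded separating_def, rule_format, of "\<alpha> \<cdot> \<kappa>" "\<beta> \<cdot> \<kappa>"]
          src_cmp[OF ab(1) \<kappa>] src_cmp[OF ab(2) \<kappa>] cmp_mor[OF ab(1) \<kappa>] cmp_mor[OF ab(2) \<kappa>]
          True ab(3) by metis
      then have "\<kappa> \<cdot> \<xi> \<in> D"
        using ab True \<kappa> by (simp add: DA A_def cmp_assoc)
      then show ?thesis
        using \<xi>(1,2) \<kappa> by (intro bexI[of _ "\<kappa> \<cdot> \<xi>"]) auto
    next
      case False
      then show ?thesis using \<kappa> by (intro bexI[of _ \<kappa>]) (auto simp: DA A_def)
    qed
  qed
  obtain F where F: "F \<in> boundary_filters" "v \<in> F" "\<And>D. D \<in> A ` X \<Longrightarrow> \<exists>\<kappa> \<in> \<M> \<inter> D. \<kappa> \<in> F"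
  proof (rule generic_boundary_filter[OF fa order.refl _ count dense])
    show "v \<in> \<M>" using v by (rule vertex_simps)
    show "\<exists>\<nu> \<in> E. \<kappa> \<cdot> \<nu> \<in> \<M>" if "\<kappa> \<in> \<M>" "exhaustive \<Lambda> (s \<kappa>) E" for \<kappa> E
      using that by (rule exhaustive_cmp_mor)
  qed auto
  note F' = boundary_filterD[OF F(1)]
  have "push \<alpha> F \<noteq> push \<beta> F"
    if ab: "\<alpha> \<in> \<M>" "\<beta> \<in> \<M>" "s \<alpha> = v" "s \<beta> = v" "\<alpha> \<noteq> \<beta>" for \<alpha> \<beta>
  proof
    assume eq: "push \<alpha> F = push \<beta> F"
    have "(\<alpha>, \<beta>) \<in> X" using ab by (simp add: X_def)
    then obtain \<tau> where \<tau>: "\<tau> \<in> F" "\<tau> \<in> A (\<alpha>, \<beta>)"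
      using F(3)[of "A (\<alpha>, \<beta>)"] by blast
    have \<tau>': "\<tau> \<in> \<M>" "r \<tau> = v"
      using \<tau>(1) F' F(2) filter_mor filter_vertex_iff v by blast+
    \<comment> \<open>Equal pushes put both paths into one filter, where any two elements have a
      common extension.\<close>
    have "\<alpha> \<cdot> \<tau> \<in> push \<alpha> F" "\<beta> \<cdot> \<tau> \<in> push \<alpha> F"
      using mem_push_cmp[OF F' ab(1), of \<tau>] mem_push_cmp[OF F' ab(2), of \<tau>] \<tau> \<tau>' ab F(2)
      by (simp_all add: eq)
    moreover have "push \<alpha> F \<in> filters" using push_filter F' ab F(2) by simp
    ultimately have "compatible (\<alpha> \<cdot> \<tau>) (\<beta> \<cdot> \<tau>)"
      using filter_directed unfolding compatible_def by blast
    then show False using \<tau>(2) \<tau>'(2) ab(3) by (simp add: A_def)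
  qed
  then show thesis using that F by blast
qed

end

section \<open>Filters and boundary paths\<close>

lemma below_le_iff: "below n m \<longleftrightarrow> (\<forall>i. enat (n i) \<le> m i)"
  by (simp add: le_fun_def)

text \<open>Test on degrees supported at one coordinate: an extended natural number is determined by
  the finite numbers below it.\<close>

lemma eq_if_below_iff:
  assumes "\<And>n. below n m \<longleftrightarrow> below n m'" shows "m = m'"
proof
  fix i
  have "enat t \<le> m i \<longleftrightarrow> enat t \<le> m' i" for t
  proof -
    have "below (\<lambda>j. if j = i then t else 0) a \<longleftrightarrow> enat t \<le> a i" for a :: "'a \<Rightarrow> enat"
      by (auto simp: below_le_iff zero_enat_def[symmetric])
    then show ?thesis using assms by metis
  qed
  then show "m i = m' i"
    by (metis enat_ord_simps(1) enat_ord_code(3) linorder_not_le nle_le not_enat_eq order_refl Suc_ile_eq less_le_not_le)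
qed

context k_graph
begin

lemma graph_path_segment:
  assumes "x \<in> graph_paths \<Lambda>" "p \<le> q" "below q (pdeg x)"
  shows "pmap x (p, q) \<in> \<M>" "d (pmap x (p, q)) = q - p"
    "r (pmap x (p, q)) = pmap x (p, p)" "s (pmap x (p, q)) = pmap x (q, q)"
  using assms unfolding graph_paths_def degree_functor_def
  by (force dest: bspec[of _ _ "(p, q)"])+

lemma graph_path_cmp:
  assumes x: "x \<in> graph_paths \<Lambda>" and "p \<le> q" "q \<le> t" "below t (pdeg x)"
  shows "pmap x (p, q) \<cdot> pmap x (q, t) = pmap x (p, t)"
proof -
  have "(p, q) \<in> mor (Omega (pdeg x))" "(q, t) \<in> mor (Omega (pdeg x))"
    using assms below_trans by auto
  moreover have "src (Omega (pdeg x)) (p, q) = rng (Omega (pdeg x)) (q, t)" by simp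
  ultimately have "pmap x (cmp (Omega (pdeg x)) (p, q) (q, t)) = pmap x (p, q) \<cdot> pmap x (q, t)"
    using x unfolding graph_paths_def degree_functor_def by blast
  then show ?thesis by simp
qed

definition segments :: "('a, 'k) path \<Rightarrow> 'a set"
  where "segments x = {pmap x (0, n) |n. below n (pdeg x)}"

lemma segmentsI: "below n (pdeg x) \<Longrightarrow> pmap x (0, n) \<in> segments x"
  by (auto simp: segments_def)

lemma zero_le_degree [simp]: "(0 :: 'k \<Rightarrow> nat) \<le> n"
  by (simp add: le_fun_def)

lemma below_zero [simp]: "below (\<lambda>i. 0) (m :: 'k \<Rightarrow> enat)"
  by (simp add: le_fun_def zero_enat_def[symmetric])

lemma segments_prefix:
  assumes "x \<in> graph_paths \<Lambda>" "p \<le> q" "below q (pdeg x)"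
  shows "pmap x (0, p) \<preceq> pmap x (0, q)"
proof -
  have "below p (pdeg x)" using assms below_trans by blast
  then have "pmap x (0, p) \<preceq> pmap x (0, p) \<cdot> pmap x (p, q)"
    using assms by (intro initial_cmp) (simp_all add: graph_path_segment)
  then show ?thesis using graph_path_cmp[of x 0 p q] assms by simp
qed

lemma segments_filter:
  assumes x: "x \<in> graph_paths \<Lambda>" shows "segments x \<in> filters"
  unfolding filters_def
proof (intro CollectI conjI ballI allI impI)
  show "segments x \<subseteq> \<M>" using x by (auto simp: segments_def graph_path_segment)
  show "segments x \<noteq> {}" using segmentsI[of 0 x] by auto
  show "\<mu> \<in> segments x" if \<kappa>: "\<kappa> \<in> segments x" "\<mu> \<preceq> \<kappa>" for \<kappa> \<mu>
  proof -
    obtain n where n: "below n (pdeg x)" "\<kappa> = pmap x (0, n)"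
      using \<kappa> by (auto simp: segments_def)
    then have "d \<kappa> = n" using x graph_path_segment[of x 0 n] by simp
    then have le: "d \<mu> \<le> n" using \<kappa> initial_deg by blast
    have b: "below (d \<mu>) (pdeg x)" using le n below_trans by blast
    have "\<mu> = pmap x (0, d \<mu>)"
      using \<kappa>(2) segments_prefix[OF x le n(1)] graph_path_segment(2)[OF x _ b, of 0] n(2)
      by (intro initial_antisym[of _ \<kappa>]) simp_all
    then show ?thesis using segmentsI[OF b] by simp
  qed
  show "\<exists>\<kappa> \<in> segments x. \<mu> \<preceq> \<kappa> \<and> \<nu> \<preceq> \<kappa>" if "\<mu> \<in> segments x" "\<nu> \<in> segments x" for \<mu> \<nu>
  proof -
    obtain m n where mn: "below m (pdeg x)" "\<mu> = pmap x (0, m)" "below n (pdeg x)" "\<nu> = pmap x (0, n)"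
      using \<open>\<mu> \<in> _\<close> \<open>\<nu> \<in> _\<close> by (auto simp: segments_def)
    then have "below (sup m n) (pdeg x)" by (auto simp: below_le_iff sup_max max_def)
    then show ?thesis
      using mn segments_prefix[OF x, of _ "sup m n"] segmentsI
      by (intro bexI[of _ "pmap x (0, sup m n)"]) auto
  qed
qed

lemma below_iff_segments:
  assumes "x \<in> graph_paths \<Lambda>"
  shows "below n (pdeg x) \<longleftrightarrow> (\<exists>\<kappa> \<in> segments x. d \<kappa> = n)"
  using assms graph_path_segment(2)[of x 0] by (auto simp: segments_def)

text \<open>Values \<open>x(p, q)\<close> are read off from initial segments: any factorisation of
  \<open>x(0, q)\<close> at degree \<open>p\<close> has \<open>x(p, q)\<close> as its second
  factor.\<close>

lemma pmap_eqI:
  assumes x: "x \<in> graph_paths \<Lambda>" "p \<le> q" "below q (pdeg x)"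
    and \<alpha>: "\<alpha> \<in> \<M>" "\<beta> \<in> \<M>" "s \<alpha> = r \<beta>" "\<alpha> \<cdot> \<beta> \<in> segments x" "d \<alpha> = p" "d (\<alpha> \<cdot> \<beta>) = q"
  shows "pmap x (p, q) = \<beta>"
proof -
  have b: "below p (pdeg x)" using x below_trans by blast
  have "\<alpha> \<cdot> \<beta> = pmap x (0, q)"
    using \<alpha>(4,6) x(1) graph_path_segment(2)[of x 0] by (auto simp: segments_def)
  also have "\<dots> = pmap x (0, p) \<cdot> pmap x (p, q)"
    using graph_path_cmp[of x 0 p q] x by simp
  finally have "\<beta> = pmap x (p, q)"
    using \<alpha>(1-3,5) graph_path_segment[OF x(1) _ b, of 0] graph_path_segment[OF x]
    by (intro factor_unique(2)[of \<alpha> \<beta> "pmap x (0, p)"]) simp_all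
  then show ?thesis by simp
qed

lemma segments_inj:
  assumes x: "x \<in> graph_paths \<Lambda>" and y: "y \<in> graph_paths \<Lambda>" and eq: "segments x = segments y"
  shows "x = y"
proof -
  have deg: "pdeg x = pdeg y"
    by (rule eq_if_below_iff) (simp add: below_iff_segments x y eq)
  have "pmap x (p, q) = pmap y (p, q)" for p q
  proof (cases "p \<le> q \<and> below q (pdeg x)")
    case True
    then have b: "p \<le> q" "below q (pdeg y)" "below p (pdeg y)" using deg below_trans by auto
    show ?thesis
    proof (rule pmap_eqI[OF x, of p q "pmap y (0, p)"])
      show "pmap y (0, p) \<cdot> pmap y (p, q) \<in> segments x"
        using graph_path_cmp[of y 0 p q] y b segmentsI[of q y] eq by simp
      show "d (pmap y (0, p) \<cdot> pmap y (p, q)) = q"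
        using graph_path_cmp[of y 0 p q] y b graph_path_segment[of y 0 q] by simp
    qed (use True b y graph_path_segment[of y] in simp_all)
  next
    case False
    then have "(p, q) \<notin> mor (Omega (pdeg x))" by simp
    then show ?thesis
      using x y deg unfolding graph_paths_def by (auto simp: extensional_def)
  qed
  then have "pmap x = pmap y" by auto
  then show ?thesis using deg by (cases x; cases y) simp
qed

lemma filter_upper_bound:
  assumes F: "F \<in> filters" and fin: "finite A" "A \<subseteq> F"
  shows "\<exists>\<kappa> \<in> F. \<forall>\<mu> \<in> A. \<mu> \<preceq> \<kappa>"
  using fin
proof (induction A)
  case empty
  then show ?case using F by (auto simp: filters_def)
next
  case (insert \<mu> A)
  then obtain \<kappa> where "\<kappa> \<in> F" "\<forall>\<nu> \<in> A. \<nu> \<preceq> \<kappa>" by blast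
  moreover from this obtain \<eta> where "\<eta> \<in> F" "\<mu> \<preceq> \<eta>" "\<kappa> \<preceq> \<eta>"
    using filter_directed[OF F, of \<mu> \<kappa>] insert by blast
  ultimately show ?case using initial_trans by blast
qed

text \<open>The degree of the path is the coordinatewise supremum of the degrees in
  \<open>F\<close>. If \<open>n\<close> is below it, each coordinate of \<open>n\<close> is attained
  by some element of \<open>F\<close>; there are finitely many coordinates, so directedness gives
  one element attaining all of them.\<close>

lemma segments_surj:
  assumes F: "F \<in> filters"
  obtains x where "x \<in> graph_paths \<Lambda>" "segments x = F"
proof -
  define m where "m = (\<lambda>i. SUP \<kappa> \<in> F. enat (d \<kappa> i))"
  have below: "below n m \<longleftrightarrow> (\<exists>\<kappa> \<in> F. d \<kappa> = n)" for n
  proof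
    assume "\<exists>\<kappa> \<in> F. d \<kappa> = n"
    then show "below n m" by (auto simp: below_le_iff m_def intro: SUP_upper)
  next
    assume n: "below n m"
    have "\<exists>\<kappa> \<in> F. n i \<le> d \<kappa> i" for i
    proof (rule ccontr)
      assume *: "\<not> ?thesis"
      obtain \<kappa> where "\<kappa> \<in> F" using F by (auto simp: filters_def)
      then have "0 < n i" using * by force
      \<comment> \<open>If no degree reaches \<open>n i\<close>, all stay at or below its
        predecessor, a genuine one because \<open>n i\<close> is positive.\<close>
      have "m i \<le> enat (n i - 1)"
        unfolding m_def using * by (intro SUP_least) (force simp: not_le)
      moreover have "enat (n i) \<le> m i" using n by (simp add: below_le_iff)
      ultimately have "enat (n i) \<le> enat (n i - 1)" by (rule order.trans[rotated])
      then show False using \<open>0 < n i\<close> by simp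
    qed
    then obtain f where f: "\<And>i. f i \<in> F" "\<And>i. n i \<le> d (f i) i" by metis
    obtain \<kappa> where \<kappa>: "\<kappa> \<in> F" "\<And>i. f i \<preceq> \<kappa>"
      using filter_upper_bound[OF F, of "range f"] f(1) by auto
    have "n \<le> d \<kappa>"
      using f(2) initial_deg[OF \<kappa>(2)] unfolding le_fun_def by (meson order.trans)
    then show "\<exists>\<kappa> \<in> F. d \<kappa> = n" using filter_segment[OF F \<kappa>(1)] by blast
  qed
  \<comment> \<open>\<open>e n\<close> becomes x(0, n), the unique element of \<open>F\<close> of
    degree \<open>n\<close>, and \<open>c p q\<close> becomes x(p, q), the path by which
    \<open>e q\<close> extends \<open>e p\<close>.\<close>
  define e where "e = (\<lambda>n. SOME \<kappa>. \<kappa> \<in> F \<and> d \<kappa> = n)"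
  have e: "e n \<in> F" "d (e n) = n" "e n \<in> \<M>" if "below n m" for n
    using someI_ex[of "\<lambda>\<kappa>. \<kappa> \<in> F \<and> d \<kappa> = n"] that filter_mor[OF F] unfolding e_def below by blast+
  define c where "c = (\<lambda>p q. SOME \<nu>. \<nu> \<in> \<M> \<and> s (e p) = r \<nu> \<and> e q = e p \<cdot> \<nu>)"
  have c: "c p q \<in> \<M>" "s (e p) = r (c p q)" "e q = e p \<cdot> c p q" if "p \<le> q" "below q m" for p q
  proof -
    have "e p \<preceq> e q" using filter_deg_le[OF F] e that below_trans by metis
    then have "\<exists>\<nu>. \<nu> \<in> \<M> \<and> s (e p) = r \<nu> \<and> e q = e p \<cdot> \<nu>" unfolding initial_def by blast
    from someI_ex[OF this]
    show "c p q \<in> \<M>" "s (e p) = r (c p q)" "e q = e p \<cdot> c p q" unfolding c_def by blast+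
  qed
  have cI: "c p q = \<nu>" if "p \<le> q" "below q m" "\<nu> \<in> \<M>" "s (e p) = r \<nu>" "e q = e p \<cdot> \<nu>" for p q \<nu>
    using left_cancel[of "e p" "c p q" \<nu>] c[OF that(1,2)] that e(3) below_trans by metis
  have cc: "c p p = s (e p)" if "below p m" for p
    using that e by (intro cI) simp_all
  have sc: "s (c p q) = s (e q)" if "p \<le> q" "below q m" for p q
    using c[OF that] e(3) below_trans[OF that] src_cmp by metis
  have dc: "d (c p q) = q - p" if "p \<le> q" "below q m" for p q
  proof -
    have "d (e p) + d (c p q) = d (e q)"
      using c[OF that] e(3) below_trans[OF that] deg_cmp by metis
    then have "p + d (c p q) = q" using e(2) that below_trans[OF that] by simp
    then show ?thesis using add_diff_cancel_left'[of p "d (c p q)"] by simp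
  qed
  have cmp: "c p q \<cdot> c q t = c p t" if "p \<le> q" "q \<le> t" "below t m" for p q t
  proof (rule cI[symmetric])
    have b: "below q m" "below p m" using that below_trans by blast+
    show "p \<le> t" using that by order
    note pq = c[OF that(1) b(1)] and qt = c[OF that(2,3)]
    have st: "s (c p q) = r (c q t)" using sc[OF that(1) b(1)] qt(2) by simp
    show "c p q \<cdot> c q t \<in> \<M>" using pq(1) qt(1) st by (rule cmp_mor)
    show "s (e p) = r (c p q \<cdot> c q t)" using rng_cmp[OF pq(1) qt(1) st] pq(2) by simp
    show "e t = e p \<cdot> (c p q \<cdot> c q t)"
      using cmp_assoc[OF e(3)[OF b(2)] pq(1) qt(1) pq(2) st] pq(3) qt(3) by simp
  qed (rule that)
  define x where "x = \<lparr>pdeg = m, pmap = (\<lambda>(p, q) \<in> mor (Omega m). c p q)\<rparr>"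
  have pmap: "pmap x (p, q) = c p q" if "p \<le> q" "below q m" for p q
    using that by (simp add: x_def)
  have "degree_functor (Omega m) \<Lambda> (pmap x)"
    unfolding degree_functor_def
  proof (intro conjI ballI impI)
    fix \<gamma> assume "\<gamma> \<in> mor (Omega m)"
    then obtain p q where \<gamma>: "\<gamma> = (p, q)" "p \<le> q" "below q m" by (cases \<gamma>) auto
    then have "below p m" using below_trans by blast
    with \<gamma> show "pmap x \<gamma> \<in> \<M>" "d (pmap x \<gamma>) = deg (Omega m) \<gamma>"
      "r (pmap x \<gamma>) = pmap x (rng (Omega m) \<gamma>)" "s (pmap x \<gamma>) = pmap x (src (Omega m) \<gamma>)"
      using c(1,2)[OF \<gamma>(2,3)] by (simp_all add: pmap dc cc sc)
  next
    fix \<gamma> \<delta> assume a: "\<gamma> \<in> mor (Omega m)" "\<delta> \<in> mor (Omega m)" "src (Omega m) \<gamma> = rng (Omega m) \<delta>"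
    then obtain p q t where \<gamma>: "\<gamma> = (p, q)" "\<delta> = (q, t)" by (cases \<gamma>; cases \<delta>) auto
    then have le: "p \<le> q" "q \<le> t" "below q m" "below t m" using a by auto
    then have "p \<le> t" by order
    then show "pmap x (cmp (Omega m) \<gamma> \<delta>) = pmap x \<gamma> \<cdot> pmap x \<delta>"
      using le \<gamma> cmp by (simp add: pmap)
  qed
  then have x: "x \<in> graph_paths \<Lambda>" by (simp add: graph_paths_def x_def)
  have "pmap x (0, n) = e n" if "below n m" for n
  proof -
    have "e 0 = r (e n)"
      using filter_deg_unique[OF F e(1)[of 0] filter_range_mem[OF F e(1)[OF that]]] e(2)[of 0] e(3)[OF that]
      by simp
    then have "c 0 n = e n"
      using that e(3)[OF that] by (intro cI) simp_all
    then show ?thesis using pmap[of 0 n] that by simp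
  qed
  then have "segments x = e ` {n. below n m}"
    by (auto simp: segments_def x_def)
  also have "\<dots> = F"
    using e filter_deg_unique[OF F] below by (auto simp: image_iff) metis
  finally show thesis using x that by blast
qed

lemma source_segments:
  assumes "x \<in> graph_paths \<Lambda>" "below n (pdeg x)"
  shows "s (pmap x (0, n)) = pmap x (n, n)"
  using graph_path_segment[of x 0 n] assms by simp

text \<open>The two clauses of the definition, that the degree fits and that the segment is
  \<open>\<alpha>\<close>, together say that \<open>x(0, n)\<alpha>\<close> is an initial segment of
  \<open>x\<close>.\<close>

lemma boundary_path_iff:
  assumes x: "x \<in> graph_paths \<Lambda>"
  shows "x \<in> boundary_paths \<Lambda> \<longleftrightarrow> segments x \<in> boundary_filters"
proof -
  have *: "(below (n + d \<alpha>) (pdeg x) \<and> pmap x (n, n + d \<alpha>) = \<alpha>) \<longleftrightarrow> pmap x (0, n) \<cdot> \<alpha> \<in> segments x"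
    if n: "below n (pdeg x)" and E: "E \<in> FE \<Lambda> (pmap x (n, n))" "\<alpha> \<in> E" for n E \<alpha>
  proof -
    have \<alpha>: "\<alpha> \<in> \<M>" "r \<alpha> = pmap x (n, n)" using E by (auto simp: FE_def paths_to_def)
    have \<kappa>: "pmap x (0, n) \<in> \<M>" "d (pmap x (0, n)) = n" "s (pmap x (0, n)) = r \<alpha>"
      using graph_path_segment[OF x _ n, of 0] \<alpha> by simp_all
    have le: "n \<le> n + d \<alpha>" by (simp add: le_fun_def)
    show ?thesis
    proof
      assume a: "below (n + d \<alpha>) (pdeg x) \<and> pmap x (n, n + d \<alpha>) = \<alpha>"
      then have "pmap x (0, n) \<cdot> \<alpha> = pmap x (0, n + d \<alpha>)"
        using graph_path_cmp[OF x _ le, of 0] by simp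
      then show "pmap x (0, n) \<cdot> \<alpha> \<in> segments x" using a segmentsI by simp
    next
      assume a: "pmap x (0, n) \<cdot> \<alpha> \<in> segments x"
      then have b: "below (n + d \<alpha>) (pdeg x)"
        using below_iff_segments[OF x] \<alpha> \<kappa> deg_cmp by metis
      moreover have "pmap x (n, n + d \<alpha>) = \<alpha>"
        using a b le \<alpha> \<kappa> by (intro pmap_eqI[OF x, of _ _ "pmap x (0, n)"]) simp_all
      ultimately show "below (n + d \<alpha>) (pdeg x) \<and> pmap x (n, n + d \<alpha>) = \<alpha>" ..
    qed
  qed
  have "x \<in> boundary_paths \<Lambda> \<longleftrightarrow> (\<forall>n. below n (pdeg x) \<longrightarrow> (\<forall>E \<in> FE \<Lambda> (pmap x (n, n)).
      \<exists>\<alpha> \<in> E. pmap x (0, n) \<cdot> \<alpha> \<in> segments x))"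
    unfolding boundary_paths_def using x * by blast
  also have "\<dots> \<longleftrightarrow> (\<forall>\<kappa> \<in> segments x. \<forall>E \<in> FE \<Lambda> (s \<kappa>). \<exists>\<nu> \<in> E. \<kappa> \<cdot> \<nu> \<in> segments x)"
    using source_segments[OF x] unfolding segments_def by force
  finally show ?thesis using segments_filter[OF x] by (simp add: boundary_filters_def)
qed

text \<open>\<open>prepend\<close> is a definite description. The path with filter
  \<open>push \<alpha> (segments x)\<close> satisfies its clauses, and any path satisfying them has
  that filter, so it is the same path by \<open>segments_inj\<close>.\<close>

lemma segments_prepend:
  assumes x: "x \<in> graph_paths \<Lambda>" and \<alpha>: "\<alpha> \<in> \<M>" "s \<alpha> = path_range x"
  shows "prepend \<Lambda> \<alpha> x \<in> graph_paths \<Lambda>" "segments (prepend \<Lambda> \<alpha> x) = push \<alpha> (segments x)"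
proof -
  let ?F = "segments x"
  let ?m = "\<lambda>i. enat (d \<alpha> i) + pdeg x i"
  let ?P = "\<lambda>y. y \<in> graph_paths \<Lambda> \<and> pdeg y = ?m \<and> pmap y (0, d \<alpha>) = \<alpha> \<and>
    (\<forall>p q. p \<le> q \<and> below q (pdeg x) \<longrightarrow> pmap y (d \<alpha> + p, d \<alpha> + q) = pmap x (p, q))"
  note F = segments_filter[OF x]
  have sF: "s \<alpha> \<in> ?F" using \<alpha> segmentsI[of 0 x] by simp
  have seg: "pmap x (0, n) \<in> \<M>" "r (pmap x (0, n)) = s \<alpha>" "d (pmap x (0, n)) = n"
    if "below n (pdeg x)" for n
    using graph_path_segment[OF x _ that, of 0] \<alpha> by simp_all
  have below: "below (d \<alpha> + n) ?m \<longleftrightarrow> below n (pdeg x)" for n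
  proof -
    have "enat (d \<alpha> i + n i) \<le> enat (d \<alpha> i) + pdeg x i \<longleftrightarrow> enat (n i) \<le> pdeg x i" for i
      by (cases "pdeg x i") simp_all
    then show ?thesis by (simp add: below_le_iff)
  qed
  have uniq: "segments y = push \<alpha> ?F" if y: "?P y" for y
  proof -
    have y': "y \<in> graph_paths \<Lambda>" using y by blast
    have eq: "pmap y (0, d \<alpha> + n) = \<alpha> \<cdot> pmap x (0, n)" if n: "below n (pdeg x)" for n
    proof -
      have "pmap y (0, d \<alpha> + n) = pmap y (0, d \<alpha>) \<cdot> pmap y (d \<alpha>, d \<alpha> + n)"
        using graph_path_cmp[OF y', of 0 "d \<alpha>" "d \<alpha> + n"] y below n by (simp add: le_fun_def)
      moreover have "pmap y (d \<alpha> + 0, d \<alpha> + n) = pmap x (0, n)" using y n zero_le_degree by blast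
      ultimately show ?thesis using y by simp
    qed
    show ?thesis
    proof (rule filters_eqI)
      show "segments y \<in> filters" using y' by (rule segments_filter)
      show "push \<alpha> ?F \<in> filters" using push_filter[OF F \<alpha>(1) sF] .
    next
      fix \<kappa> assume "\<kappa> \<in> segments y"
      then obtain n where n: "\<kappa> = pmap y (0, n)" "below n ?m"
        using y by (auto simp: segments_def)
      \<comment> \<open>The subtraction is truncated, so \<open>d \<alpha> + ?n\<close> is the join
        of \<open>n\<close> and \<open>d \<alpha>\<close>, an upper bound of \<open>n\<close> even
        if \<open>n\<close> does not reach past \<open>\<alpha>\<close>.\<close>
      let ?n = "\<lambda>i. n i - d \<alpha> i"
      have "enat (n i - d \<alpha> i) \<le> pdeg x i" for i
        using n(2) unfolding below_le_iff by (cases "pdeg x i") (auto dest: spec[of _ i])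
      then have b: "below ?n (pdeg x)" by (simp add: below_le_iff)
      have "n \<le> d \<alpha> + ?n" by (auto simp: le_fun_def)
      then have "\<kappa> \<preceq> pmap y (0, d \<alpha> + ?n)"
        using segments_prefix[OF y', of n "d \<alpha> + ?n"] n(1) y b below by simp
      then show "\<exists>\<mu> \<in> push \<alpha> ?F. \<kappa> \<preceq> \<mu>"
        using eq[OF b] mem_push_cmp[OF F \<alpha>(1) sF seg(1,2)[OF b]] segmentsI[OF b] by auto
    next
      fix \<kappa> assume "\<kappa> \<in> push \<alpha> ?F"
      then obtain n where n: "below n (pdeg x)" "\<kappa> \<preceq> \<alpha> \<cdot> pmap x (0, n)"
        by (auto simp: push_def segments_def)
      then show "\<exists>\<mu> \<in> segments y. \<kappa> \<preceq> \<mu>"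
        using eq[OF n(1)] segmentsI[of "d \<alpha> + n" y] y below[of n] by auto
    qed
  qed
  obtain y where y: "y \<in> graph_paths \<Lambda>" "segments y = push \<alpha> ?F"
    using segments_surj[OF push_filter[OF F \<alpha>(1) sF]] .
  have mem: "\<alpha> \<cdot> pmap x (0, n) \<in> segments y" "d (\<alpha> \<cdot> pmap x (0, n)) = d \<alpha> + n"
    if n: "below n (pdeg x)" for n
    using mem_push_cmp[OF F \<alpha>(1) sF seg(1,2)[OF n]] segmentsI[OF n] seg[OF n] \<alpha> y(2) by simp_all
  have deg: "pdeg y = ?m"
  proof (rule eq_if_below_iff)
    fix n
    let ?n = "\<lambda>i. n i - d \<alpha> i"
    show "below n (pdeg y) \<longleftrightarrow> below n ?m"
    proof
      assume "below n (pdeg y)"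
      then obtain \<kappa> where \<kappa>: "\<kappa> \<in> push \<alpha> ?F" "d \<kappa> = n"
        using below_iff_segments[OF y(1)] y(2) by auto
      then obtain t where t: "below t (pdeg x)" "\<kappa> \<preceq> \<alpha> \<cdot> pmap x (0, t)"
        by (auto simp: push_def segments_def)
      then have "n \<le> d \<alpha> + t" using \<kappa> initial_deg mem(2) by metis
      then show "below n ?m" using below[of t] t(1) below_trans by metis
    next
      assume n: "below n ?m"
      have "enat (n i - d \<alpha> i) \<le> pdeg x i" for i
        using n unfolding below_le_iff by (cases "pdeg x i") (auto dest: spec[of _ i])
      then have b: "below ?n (pdeg x)" by (simp add: below_le_iff)
      then have "below (d \<alpha> + ?n) (pdeg y)" 
        using mem[OF b] below_iff_segments[OF y(1), of "d \<alpha> + ?n"] by blast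
      moreover have "n \<le> d \<alpha> + ?n" by (auto simp: le_fun_def)
      ultimately show "below n (pdeg y)" using below_trans by blast
    qed
  qed
  have Py: "?P y"
  proof (intro conjI allI impI y(1) deg)
    have "\<alpha> \<in> segments y" using source_push[OF F \<alpha>(1) sF] y(2) by simp
    moreover from this have "below (d \<alpha>) (pdeg y)" using below_iff_segments[OF y(1)] by blast
    ultimately show "pmap y (0, d \<alpha>) = \<alpha>"
      using \<alpha>(1) by (intro pmap_eqI[OF y(1), of _ _ "r \<alpha>"]) simp_all
  next
    fix p q assume pq: "p \<le> q \<and> below q (pdeg x)"
    then have b: "below p (pdeg x)" "below q (pdeg x)" using below_trans by auto
    have st: "s (pmap x (0, p)) = r (pmap x (p, q))"
      using graph_path_segment(3)[OF x, of p q] graph_path_segment(4)[OF x _ b(1), of 0] pq by simp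
    have pq': "pmap x (p, q) \<in> \<M>" "pmap x (0, p) \<cdot> pmap x (p, q) = pmap x (0, q)"
      using graph_path_segment(1)[OF x, of p q] graph_path_cmp[OF x, of 0 p q] pq by simp_all
    note \<alpha>p = seg(2)[OF b(1), symmetric]
    have c: "\<alpha> \<cdot> pmap x (0, q) = (\<alpha> \<cdot> pmap x (0, p)) \<cdot> pmap x (p, q)"
      using cmp_assoc[OF \<alpha>(1) seg(1)[OF b(1)] pq'(1) \<alpha>p st] pq'(2) by simp
    show "pmap y (d \<alpha> + p, d \<alpha> + q) = pmap x (p, q)"
    proof (rule pmap_eqI[OF y(1), of _ _ "\<alpha> \<cdot> pmap x (0, p)"])
      show "d \<alpha> + p \<le> d \<alpha> + q" using pq by (simp add: le_fun_def)
      show "below (d \<alpha> + q) (pdeg y)" using below deg b by simp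
      show "\<alpha> \<cdot> pmap x (0, p) \<cdot> pmap x (p, q) \<in> segments y"
        "d (\<alpha> \<cdot> pmap x (0, p) \<cdot> pmap x (p, q)) = d \<alpha> + q"
        using mem[OF b(2)] by (simp_all flip: c)
      show "d (\<alpha> \<cdot> pmap x (0, p)) = d \<alpha> + p" using mem(2)[OF b(1)] .
      show "\<alpha> \<cdot> pmap x (0, p) \<in> \<M>" using \<alpha>(1) seg(1)[OF b(1)] \<alpha>p by (rule cmp_mor)
      show "s (\<alpha> \<cdot> pmap x (0, p)) = r (pmap x (p, q))"
        using src_cmp[OF \<alpha>(1) seg(1)[OF b(1)] \<alpha>p] st by simp
    qed (rule pq')
  qed
  have "prepend \<Lambda> \<alpha> x = y"
    unfolding prepend_def
  proof (rule the_equality)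
    show "z = y" if "?P z" for z
      using segments_inj[of z y] uniq[OF that] y that by simp
  qed (rule Py)
  then show "prepend \<Lambda> \<alpha> x \<in> graph_paths \<Lambda>" "segments (prepend \<Lambda> \<alpha> x) = push \<alpha> ?F"
    using y by simp_all
qed

lemma prepend_eq_iff:
  assumes "x \<in> graph_paths \<Lambda>" "\<alpha> \<in> \<M>" "\<beta> \<in> \<M>" "s \<alpha> = path_range x" "s \<beta> = path_range x"
  shows "prepend \<Lambda> \<alpha> x = prepend \<Lambda> \<beta> x \<longleftrightarrow> push \<alpha> (segments x) = push \<beta> (segments x)"
  using segments_prepend[OF assms(1,2,4)] segments_prepend[OF assms(1,3,5)] segments_inj
  by metis

lemma vertex_mem_segments:
  assumes x: "x \<in> graph_paths \<Lambda>" and v: "v \<in> vertices \<Lambda>"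
  shows "v \<in> segments x \<longleftrightarrow> path_range x = v"
proof -
  have "path_range x \<in> segments x" by (simp add: segmentsI)
  moreover have "r (path_range x) = path_range x"
    using graph_path_segment(3)[OF x, of 0 0] by simp
  ultimately show ?thesis
    using filter_vertex_iff[OF segments_filter[OF x] v] by metis
qed

text \<open>One aperiodic boundary path at the common source separates any two paths ending there,
  and \<open>incompatible_extension\<close> turns this into a finite witness. Conversely, a generic
  path realises all the countably many separations at once.\<close>

theorem aperiodic_graph_iff:
  assumes fa: "finitely_aligned \<Lambda>"
  shows "aperiodic_graph \<Lambda> \<longleftrightarrow> separating"
proof
  assume ap: "aperiodic_graph \<Lambda>"
  show separating
    unfolding separating_def
  proof (intro ballI impI)
    fix \<alpha> \<beta> assume ab: "\<alpha> \<in> \<M>" "\<beta> \<in> \<M>" "s \<alpha> = s \<beta>" "\<alpha> \<noteq> \<beta>"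
    then have v: "s \<alpha> \<in> vertices \<Lambda>" by simp
    then obtain x where x: "x \<in> boundary_paths \<Lambda>" "path_range x = s \<alpha>" "aperiodic_path \<Lambda> x"
      using ap unfolding aperiodic_graph_def by blast
    then have x': "x \<in> graph_paths \<Lambda>" by (simp add: boundary_paths_def)
    have "prepend \<Lambda> \<alpha> x \<noteq> prepend \<Lambda> \<beta> x"
      using x(2,3) ab unfolding aperiodic_path_def by metis
    then have "push \<alpha> (segments x) \<noteq> push \<beta> (segments x)"
      using prepend_eq_iff[OF x' ab(1,2)] x(2) ab(3) by metis
    then show "\<exists>\<xi> \<in> \<M>. r \<xi> = s \<alpha> \<and> \<not> compatible (\<alpha> \<cdot> \<xi>) (\<beta> \<cdot> \<xi>)"
      using incompatible_extension[OF fa _ ab(1) _ ab(2)] boundary_path_iff[OF x'] x(1,2)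
        vertex_mem_segments[OF x' v] ab(3) by metis
  qed
next
  assume sep: separating
  show "aperiodic_graph \<Lambda>"
    unfolding aperiodic_graph_def
  proof
    fix v assume v: "v \<in> vertices \<Lambda>"
    obtain F where F: "F \<in> boundary_filters" "v \<in> F"
      "\<And>\<alpha> \<beta>. \<lbrakk>\<alpha> \<in> \<M>; \<beta> \<in> \<M>; s \<alpha> = v; s \<beta> = v; \<alpha> \<noteq> \<beta>\<rbrakk> \<Longrightarrow> push \<alpha> F \<noteq> push \<beta> F"
      using aperiodic_filter[OF fa sep v] by blast
    obtain x where x: "x \<in> graph_paths \<Lambda>" "segments x = F"
      using segments_surj[OF boundary_filterD[OF F(1)]] .
    have "path_range x = v" using vertex_mem_segments[OF x(1) v] x(2) F(2) by simp
    moreover have "aperiodic_path \<Lambda> x"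
      unfolding aperiodic_path_def using prepend_eq_iff[OF x(1)] x(2) F(3) \<open>path_range x = v\<close> by metis
    ultimately show "\<exists>x \<in> boundary_paths \<Lambda>. path_range x = v \<and> aperiodic_path \<Lambda> x"
      using boundary_path_iff[OF x(1)] x(2) F(1) by blast
  qed
qed

theorem cofinal_graph_iff:
  "cofinal_graph \<Lambda> \<longleftrightarrow> (\<forall>v \<in> vertices \<Lambda>. \<forall>F \<in> boundary_filters. \<exists>\<kappa> \<in> F. \<exists>\<alpha> \<in> \<M>. r \<alpha> = v \<and> s \<alpha> = s \<kappa>)"
proof -
  have *: "(\<exists>n. below n (pdeg x) \<and> {\<alpha> \<in> \<M>. r \<alpha> = v \<and> s \<alpha> = pmap x (n, n)} \<noteq> {})
      \<longleftrightarrow> (\<exists>\<kappa> \<in> segments x. \<exists>\<alpha> \<in> \<M>. r \<alpha> = v \<and> s \<alpha> = s \<kappa>)" if "x \<in> graph_paths \<Lambda>" for x v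
    using source_segments[OF that] unfolding segments_def by force
  have "boundary_filters = segments ` boundary_paths \<Lambda>"
  proof (intro equalityI subsetI)
    fix F assume F: "F \<in> boundary_filters"
    obtain x where "x \<in> graph_paths \<Lambda>" "segments x = F"
      using segments_surj[OF boundary_filterD[OF F]] .
    then show "F \<in> segments ` boundary_paths \<Lambda>" using F boundary_path_iff by blast
  next
    fix F assume "F \<in> segments ` boundary_paths \<Lambda>"
    then obtain x where x: "F = segments x" "x \<in> boundary_paths \<Lambda>" by blast
    then have "x \<in> graph_paths \<Lambda>" by (simp add: boundary_paths_def)
    then show "F \<in> boundary_filters" using x boundary_path_iff by blast
  qed
  moreover have "cofinal_graph \<Lambda> \<longleftrightarrow> (\<forall>v \<in> vertices \<Lambda>. \<forall>x \<in> boundary_paths \<Lambda>.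
      \<exists>\<kappa> \<in> segments x. \<exists>\<alpha> \<in> \<M>. r \<alpha> = v \<and> s \<alpha> = s \<kappa>)"
    unfolding cofinal_graph_def by (intro ball_cong refl *) (simp add: boundary_paths_def)
  ultimately show ?thesis by simp
qed

end

section \<open>The boundary path representation\<close>

typedef (overloaded) ('x, 'r::comm_ring_1) endo =
  "{T :: ('x \<Rightarrow> 'r) \<Rightarrow> 'x \<Rightarrow> 'r.
    (\<forall>f g. T (f + g) = T f + T g) \<and> (\<forall>c f. T (\<lambda>x. c * f x) = (\<lambda>x. c * T f x))}"
  morphisms app Endo
  by (rule exI[of _ "\<lambda>f. f"]) simp

setup_lifting type_definition_endo

instantiation endo :: (type, comm_ring_1) ring
begin

lift_definition zero_endo :: "('a, 'b) endo" is "\<lambda>f. 0"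
  by (simp add: fun_eq_iff)

lift_definition plus_endo :: "('a, 'b) endo \<Rightarrow> ('a, 'b) endo \<Rightarrow> ('a, 'b) endo" is "\<lambda>S T f. S f + T f"
  by (simp add: fun_eq_iff algebra_simps)

lift_definition uminus_endo :: "('a, 'b) endo \<Rightarrow> ('a, 'b) endo" is "\<lambda>S f. - S f"
  by (simp add: fun_eq_iff algebra_simps)

lift_definition minus_endo :: "('a, 'b) endo \<Rightarrow> ('a, 'b) endo \<Rightarrow> ('a, 'b) endo" is "\<lambda>S T f. S f - T f"
  by (simp add: fun_eq_iff algebra_simps)

lift_definition times_endo :: "('a, 'b) endo \<Rightarrow> ('a, 'b) endo \<Rightarrow> ('a, 'b) endo" is "\<lambda>S T f. S (T f)"
  by simp

instance
  by standard (transfer; simp add: fun_eq_iff algebra_simps)+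

end

lift_definition scale_endo :: "'r \<Rightarrow> ('x, 'r::comm_ring_1) endo \<Rightarrow> ('x, 'r) endo"
  is "\<lambda>c T f x. c * T f x"
  by (simp add: fun_eq_iff algebra_simps)

lemma type_algebra_endo: "type_algebra (scale_endo :: 'r::comm_ring_1 \<Rightarrow> ('x, 'r) endo \<Rightarrow> _)"
  by unfold_locales (transfer; simp add: fun_eq_iff algebra_simps)+

lemma app_simps [simp]:
  "app 0 f = 0" "app (S + T) f = app S f + app T f" "app (S - T) f = app S f - app T f"
  "app (S * T) f = app S (app T f)" "app (scale_endo c S) f = (\<lambda>x. c * app S f x)"
  by (transfer; simp)+

lemma app_sum: "app (\<Sum>i \<in> I. S i) f y = (\<Sum>i \<in> I. app (S i) f y)"
  by (induction I rule: infinite_finite_induct) simp_all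

lemma endo_eqI: "(\<And>f y. app S f y = app T f y) \<Longrightarrow> S = T"
  by (transfer; simp add: fun_eq_iff)

lemma endo_eqI_pair: "(\<And>f x y. app S f (x, y) = app T f (x, y)) \<Longrightarrow> S = T"
  by (rule endo_eqI) (auto simp: split_paired_all)

lift_definition pullback :: "('x \<Rightarrow> 'x option) \<Rightarrow> ('x, 'r::comm_ring_1) endo"
  is "\<lambda>h f y. case h y of None \<Rightarrow> 0 | Some z \<Rightarrow> f z"
  by (auto simp: fun_eq_iff split: option.split)

lemma app_pullback: "app (pullback h) f y = (case h y of None \<Rightarrow> 0 | Some z \<Rightarrow> f z)"
  by transfer simp

context k_graph
begin

text \<open>Pulling functions back reverses composition, so \<open>Path \<alpha>\<close> is given by
  removing \<open>\<alpha>\<close>. For \<open>t = 0\<close> it moves a point mass at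
  \<open>F\<close> with \<open>s \<alpha> \<in> F\<close> to one at \<open>push \<alpha> F\<close>,
  as expected of a path.\<close>

definition path_map :: "'a set set \<Rightarrow> int \<Rightarrow> 'a \<Rightarrow> 'a set \<times> ('k \<Rightarrow> int) \<Rightarrow> ('a set \<times> ('k \<Rightarrow> int)) option"
  where "path_map X t \<alpha> = (\<lambda>(F, g). if F \<in> X \<and> \<alpha> \<in> F
    then Some (pull \<alpha> F, \<lambda>i. g i - t * int (d \<alpha> i)) else None)"

definition ghost_map :: "'a set set \<Rightarrow> int \<Rightarrow> 'a \<Rightarrow> 'a set \<times> ('k \<Rightarrow> int) \<Rightarrow> ('a set \<times> ('k \<Rightarrow> int)) option"
  where "ghost_map X t \<alpha> = (\<lambda>(F, g). if F \<in> X \<and> s \<alpha> \<in> F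
    then Some (push \<alpha> F, \<lambda>i. g i + t * int (d \<alpha> i)) else None)"

text \<open>
  The representation on functions on \<open>X \<times> \<int>\<^sup>k\<close>, for an invariant set \<open>X\<close> of boundary paths.  Paths act
  on the second coordinate by translation by \<open>t\<close> times their degree, so that \<open>t = 1\<close> detects degrees
  while \<open>t = 0\<close> ignores them.
\<close>

fun boundary_rep :: "'a set set \<Rightarrow> int \<Rightarrow> 'a gen \<Rightarrow> ('a set \<times> ('k \<Rightarrow> int), 'r::comm_ring_1) endo"
  where "boundary_rep X t (Path \<alpha>) = pullback (path_map X t \<alpha>)"
  | "boundary_rep X t (Ghost \<alpha>) = pullback (ghost_map X t \<alpha>)"

lemma app_path:
  "app (boundary_rep X t (Path \<alpha>)) f (F, g) =
    (if F \<in> X \<and> \<alpha> \<in> F then f (pull \<alpha> F, \<lambda>i. g i - t * int (d \<alpha> i)) else 0)"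
  by (simp add: app_pullback path_map_def)

declare boundary_rep.simps [simp del]

text \<open>Closure under both shifts makes cutting functions off outside \<open>X\<close>
  compatible with all the operators. Besides the set of all boundary filters, a single shift-tail
  class is used, where vertices may act as zero.\<close>

definition invariant :: "'a set set \<Rightarrow> bool"
  where "invariant X \<longleftrightarrow> X \<subseteq> boundary_filters \<and> (\<forall>F \<in> X. \<forall>\<alpha> \<in> F. pull \<alpha> F \<in> X) \<and>
    (\<forall>F \<in> X. \<forall>\<alpha> \<in> \<M>. s \<alpha> \<in> F \<longrightarrow> push \<alpha> F \<in> X)"

lemma invariant_boundary_filters: "finitely_aligned \<Lambda> \<Longrightarrow> invariant boundary_filters"
  unfolding invariant_def using pull_boundary push_boundary by blast

context
  fixes X :: "'a set set" and t :: int
  assumes X: "invariant X"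
begin

lemma invariant_filter: "F \<in> X \<Longrightarrow> F \<in> filters"
  using X boundary_filterD unfolding invariant_def by blast

lemma invariant_pull: "F \<in> X \<Longrightarrow> \<alpha> \<in> F \<Longrightarrow> pull \<alpha> F \<in> X"
  using X unfolding invariant_def by blast

lemma invariant_push: "F \<in> X \<Longrightarrow> \<alpha> \<in> \<M> \<Longrightarrow> s \<alpha> \<in> F \<Longrightarrow> push \<alpha> F \<in> X"
  using X unfolding invariant_def by blast

lemma app_vertex:
  assumes "v \<in> vertices \<Lambda>"
  shows "app (boundary_rep X t (Path v)) f (F, g) = (if F \<in> X \<and> v \<in> F then f (F, g) else 0)"
  using assms pull_vertex[OF invariant_filter] vertex_simps(4)[OF assms] by (auto simp: app_path)

lemma app_ghost:
  assumes \<alpha>: "\<alpha> \<in> \<M>"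
  shows "app (boundary_rep X t (ghost \<Lambda> \<alpha>)) f (F, g) =
    (if F \<in> X \<and> s \<alpha> \<in> F then f (push \<alpha> F, \<lambda>i. g i + t * int (d \<alpha> i)) else 0)"
proof (cases "\<alpha> \<in> vertices \<Lambda>")
  case True
  then have "app (boundary_rep X t (ghost \<Lambda> \<alpha>)) f (F, g) = (if F \<in> X \<and> \<alpha> \<in> F then f (F, g) else 0)"
    by (simp add: ghost_def app_vertex)
  then show ?thesis
    using True push_vertex[OF invariant_filter True] vertex_simps[OF True] by auto
next
  case False
  then show ?thesis by (simp add: ghost_def boundary_rep.simps app_pullback ghost_map_def)
qed

text \<open>The range projection of \<open>\<alpha>\<close> is multiplication by the indicator of
  the filters in \<open>X\<close> containing \<open>\<alpha>\<close>, because removing and restoring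
  \<open>\<alpha>\<close> are inverse and the two translations cancel.\<close>

lemma app_path_ghost:
  assumes \<alpha>: "\<alpha> \<in> \<M>"
  shows "app (boundary_rep X t (Path \<alpha>)) (app (boundary_rep X t (ghost \<Lambda> \<alpha>)) f) (F, g) =
    (if F \<in> X \<and> \<alpha> \<in> F then f (F, g) else 0)"
  using pull_filter(2)[OF invariant_filter] invariant_pull push_pull[OF invariant_filter]
  by (auto simp: app_path app_ghost[OF \<alpha>])

text \<open>A product of complementary indicators: it lives on the filters through \<open>v\<close>
  that avoid every member of the list. Thus (KP4) becomes a covering statement.\<close>

lemma app_product:
  assumes v: "v \<in> vertices \<Lambda>" and "ls \<noteq> []" "set ls \<subseteq> paths_to \<Lambda> v"
  shows "app (nprod (map (\<lambda>\<alpha>. boundary_rep X t (Path v) - boundary_rep X t (Path \<alpha>) *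
      boundary_rep X t (ghost \<Lambda> \<alpha>)) ls)) f (F, g) =
    (if F \<in> X \<and> v \<in> F \<and> (\<forall>\<alpha> \<in> set ls. \<alpha> \<notin> F) then f (F, g) else 0)"
  using assms(2,3)
proof (induction ls arbitrary: f rule: induct_list012)
  case (2 \<alpha>)
  then have "\<alpha> \<in> \<M>" "r \<alpha> = v" by (auto simp: paths_to_def)
  then show ?case
    using filter_vertex_iff[OF invariant_filter v] by (auto simp: app_vertex[OF v] app_path_ghost)
next
  case (3 \<alpha> \<beta> ls)
  then have "\<alpha> \<in> \<M>" "r \<alpha> = v" by (auto simp: paths_to_def)
  then show ?case
    using 3 filter_vertex_iff[OF invariant_filter v]
    by (auto simp: app_vertex[OF v] app_path_ghost)
qed simp

text \<open>At most one term of the sum in (KP3) is nonzero at a given filter.\<close>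

lemma boundary_rep_KP3:
  assumes fa: "finitely_aligned \<Lambda>" and \<alpha>: "\<alpha> \<in> \<M>" and \<mu>: "\<mu> \<in> \<M>"
  shows "(boundary_rep X t (ghost \<Lambda> \<alpha>) * boundary_rep X t (Path \<mu>) :: (_, 'r::comm_ring_1) endo) =
    (\<Sum>(\<rho>, \<tau>) \<in> Lmin \<Lambda> \<alpha> \<mu>. boundary_rep X t (Path \<rho>) * boundary_rep X t (ghost \<Lambda> \<tau>))"
proof (rule endo_eqI)
  fix f :: "_ \<Rightarrow> 'r" and y :: "'a set \<times> ('k \<Rightarrow> int)"
  obtain F g where y: "y = (F, g)" by (cases y)
  let ?S = "boundary_rep X t :: 'a gen \<Rightarrow> (_, 'r) endo"
  let ?L = "Lmin \<Lambda> \<alpha> \<mu>"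
  define h where "h = (\<lambda>(\<rho>, \<tau>). if F \<in> X \<and> \<rho> \<in> F
    then f (push \<tau> (pull \<rho> F), \<lambda>i. g i - t * int (d \<rho> i) + t * int (d \<tau> i)) else 0)"
  have fin: "finite ?L" using fa \<alpha> \<mu> by (simp add: finitely_aligned_def)
  have "app (?S (Path \<rho>)) (app (?S (ghost \<Lambda> \<tau>)) f) (F, g) = h (\<rho>, \<tau>)" if L: "(\<rho>, \<tau>) \<in> ?L" for \<rho> \<tau>
  proof -
    have \<rho>: "\<rho> \<in> \<M>" "\<tau> \<in> \<M>" "s \<alpha> = r \<rho>" "s \<mu> = r \<tau>" "\<alpha> \<cdot> \<rho> = \<mu> \<cdot> \<tau>"
      using iffD1[OF Lmin_iff[OF \<alpha> \<mu>] L] by blast+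
    then have "s \<tau> = s \<rho>" using src_cmp \<alpha> \<mu> by metis
    then show ?thesis
      using pull_filter(2)[OF invariant_filter] invariant_pull \<rho>(2)
      by (auto simp: h_def app_path app_ghost)
  qed
  then have "app (\<Sum>(\<rho>, \<tau>) \<in> ?L. ?S (Path \<rho>) * ?S (ghost \<Lambda> \<tau>)) f (F, g) = (\<Sum>z \<in> ?L. h z)"
    unfolding app_sum by (intro sum.cong) auto
  also have "\<dots> = app (?S (ghost \<Lambda> \<alpha>)) (app (?S (Path \<mu>)) f) (F, g)"
  proof (cases "F \<in> X \<and> s \<alpha> \<in> F \<and> \<mu> \<in> push \<alpha> F")
    case True
    then have F: "F \<in> filters" and G: "push \<alpha> F \<in> X" "push \<alpha> F \<in> filters"
      using \<alpha> invariant_filter invariant_push by blast+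
    have "\<alpha> \<in> push \<alpha> F" using source_push F \<alpha> True by blast
    then obtain \<kappa> where \<kappa>: "\<kappa> \<in> push \<alpha> F" "\<alpha> \<preceq> \<kappa>" "\<mu> \<preceq> \<kappa>"
      using filter_directed[OF G(2)] True by blast
    obtain \<rho> \<tau> where L: "(\<rho>, \<tau>) \<in> ?L" "\<alpha> \<cdot> \<rho> \<preceq> \<kappa>"
      using Lmin_of_common_extension[OF \<kappa>(2,3)] .
    have \<rho>: "\<rho> \<in> \<M>" "\<tau> \<in> \<M>" "s \<alpha> = r \<rho>" "s \<mu> = r \<tau>" "\<alpha> \<cdot> \<rho> = \<mu> \<cdot> \<tau>"
        "d (\<alpha> \<cdot> \<rho>) = sup (d \<alpha>) (d \<mu>)"
      using iffD1[OF Lmin_iff[OF \<alpha> \<mu>] L(1)] by blast+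
    have \<alpha>\<rho>: "\<alpha> \<cdot> \<rho> \<in> push \<alpha> F" using filter_down[OF G(2) \<kappa>(1) L(2)] .
    then have \<rho>F: "\<rho> \<in> F" using mem_push_cmp[OF F \<alpha> _ \<rho>(1)] True \<rho>(3) by metis
    \<comment> \<open>Two nonzero terms would give two elements of \<open>push \<alpha> F\<close> of
      the same degree; these coincide, and cancelling \<open>\<alpha>\<close> and
      \<open>\<mu>\<close> makes the pairs equal.\<close>
    have "h z = 0" if z: "z \<in> ?L - {(\<rho>, \<tau>)}" for z
    proof (rule ccontr)
      assume nz: "h z \<noteq> 0"
      obtain \<rho>' \<tau>' where z': "z = (\<rho>', \<tau>')" by (cases z)
      then have "(\<rho>', \<tau>') \<in> ?L" using z by blast
      from iffD1[OF Lmin_iff[OF \<alpha> \<mu>] this]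
      have \<rho>': "\<rho>' \<in> \<M>" "\<tau>' \<in> \<M>" "s \<alpha> = r \<rho>'" "s \<mu> = r \<tau>'" "\<alpha> \<cdot> \<rho>' = \<mu> \<cdot> \<tau>'"
          "d (\<alpha> \<cdot> \<rho>') = sup (d \<alpha>) (d \<mu>)" by blast+
      have "\<rho>' \<in> F" using nz by (auto simp: z' h_def split: if_splits)
      then have "\<alpha> \<cdot> \<rho>' \<in> push \<alpha> F" using mem_push_cmp[OF F \<alpha> _ \<rho>'(1)] True \<rho>'(3) by metis
      then have eq: "\<alpha> \<cdot> \<rho>' = \<alpha> \<cdot> \<rho>"
        using filter_deg_unique[OF G(2) _ \<alpha>\<rho>] \<rho>(6) \<rho>'(6) by metis
      then have "\<rho>' = \<rho>" using left_cancel[OF \<alpha> \<rho>'(1) \<rho>(1) \<rho>'(3) \<rho>(3)] by blast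
      moreover have "\<tau>' = \<tau>"
        using left_cancel[OF \<mu> \<rho>'(2) \<rho>(2) \<rho>'(4) \<rho>(4)] eq \<rho>(5) \<rho>'(5) by metis
      ultimately show False using z z' by blast
    qed
    then have "(\<Sum>z \<in> ?L. h z) = h (\<rho>, \<tau>)"
      using sum.remove[OF fin L(1), of h] by simp
    also have "\<dots> = f (push \<tau> (pull \<rho> F), \<lambda>i. g i - t * int (d \<rho> i) + t * int (d \<tau> i))"
      using True \<rho>F by (simp add: h_def)
    also have "push \<tau> (pull \<rho> F) = pull \<mu> (push \<alpha> F)"
    proof -
      have "s \<tau> = s \<rho>" using src_cmp[OF \<alpha> \<rho>(1,3)] src_cmp[OF \<mu> \<rho>(2,4)] \<rho>(5) by simp
      then have *: "pull \<rho> F \<in> filters" "s \<tau> \<in> pull \<rho> F" using pull_filter[OF F \<rho>F] by simp_all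
      have "pull \<rho> F = pull (\<mu> \<cdot> \<tau>) (push \<alpha> F)"
        using pull_pull[OF \<alpha> \<rho>(1,3)] pull_push[OF F \<alpha>] True \<rho>(5) by metis
      also have "\<dots> = pull \<tau> (pull \<mu> (push \<alpha> F))"
        using pull_pull[OF \<mu> \<rho>(2,4)] by simp
      finally have "pull \<rho> F = pull \<tau> (pull \<mu> (push \<alpha> F))" .
      moreover have "\<tau> \<in> pull \<mu> (push \<alpha> F)"
        using \<alpha>\<rho> \<rho>(2,4) unfolding \<rho>(5) pull_def by simp
      moreover have "pull \<mu> (push \<alpha> F) \<in> filters" using pull_filter G(2) True by blast
      ultimately show ?thesis using push_pull by simp
    qed
    also have "(\<lambda>i. g i - t * int (d \<rho> i) + t * int (d \<tau> i)) = (\<lambda>i. g i + t * int (d \<alpha> i) - t * int (d \<mu> i))"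
    proof
      fix i
      \<comment> \<open>Both sides are the degree of the same minimal common extension, which makes
        the translations of the second coordinate agree.\<close>
      have "d \<alpha> + d \<rho> = d \<mu> + d \<tau>" using deg_cmp[OF \<alpha> \<rho>(1,3)] deg_cmp[OF \<mu> \<rho>(2,4)] \<rho>(5) by simp
      then have "d \<alpha> i + d \<rho> i = d \<mu> i + d \<tau> i" by (metis plus_fun_apply)
      then have "int (d \<alpha> i) + int (d \<rho> i) = int (d \<mu> i) + int (d \<tau> i)" by (metis of_nat_add)
      then have \<tau>: "int (d \<tau> i) = int (d \<alpha> i) + int (d \<rho> i) - int (d \<mu> i)" by simp
      show "g i - t * int (d \<rho> i) + t * int (d \<tau> i) = g i + t * int (d \<alpha> i) - t * int (d \<mu> i)"
        unfolding \<tau> by (simp add: algebra_simps)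
    qed
    also have "f (pull \<mu> (push \<alpha> F), \<dots>) = app (?S (ghost \<Lambda> \<alpha>)) (app (?S (Path \<mu>)) f) (F, g)"
      using True G by (simp add: app_path app_ghost[OF \<alpha>])
    finally show ?thesis .
  next
    case False
    have "h z = 0" if z: "z \<in> ?L" for z
    proof (rule ccontr)
      assume nz: "h z \<noteq> 0"
      obtain \<rho> \<tau> where z': "z = (\<rho>, \<tau>)" by (cases z)
      then have F: "F \<in> X" "\<rho> \<in> F" using nz by (auto simp: h_def split: if_splits)
      from iffD1[OF Lmin_iff[OF \<alpha> \<mu>] z[unfolded z']]
      have \<rho>: "\<rho> \<in> \<M>" "\<tau> \<in> \<M>" "s \<alpha> = r \<rho>" "s \<mu> = r \<tau>" "\<alpha> \<cdot> \<rho> = \<mu> \<cdot> \<tau>" by blast+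
      note F' = invariant_filter[OF F(1)]
      have s: "s \<alpha> \<in> F" using filter_range_mem[OF F' F(2)] \<rho>(3) by simp
      then have "\<mu> \<cdot> \<tau> \<in> push \<alpha> F"
        using mem_push_cmp[OF F' \<alpha> s \<rho>(1)] \<rho>(3,5) F(2) by simp
      then have "\<mu> \<in> push \<alpha> F"
        using filter_down[OF push_filter[OF F' \<alpha> s]] initial_cmp[OF \<mu> \<rho>(2,4)] by blast
      then show False using False F s by blast
    qed
    then show ?thesis using False by (auto simp: app_path app_ghost[OF \<alpha>])
  qed
  finally show "app (?S (ghost \<Lambda> \<alpha>) * ?S (Path \<mu>)) f y =
      app (\<Sum>(\<rho>, \<tau>) \<in> ?L. ?S (Path \<rho>) * ?S (ghost \<Lambda> \<tau>)) f y"
    by (simp add: y)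
qed

lemma boundary_rep_kp_family:
  assumes fa: "finitely_aligned \<Lambda>"
  shows "kp_family \<Lambda> (boundary_rep X t :: 'a gen \<Rightarrow> (_, 'r::comm_ring_1) endo)"
  unfolding kp_family_def
proof
  let ?S = "boundary_rep X t :: 'a gen \<Rightarrow> (_, 'r::comm_ring_1) endo"
  fix x assume "x \<in> kp_relators \<Lambda> ?S"
  then show "x = 0"
  proof cases
    case (KP1_idem v)
    have "app x f (F, g) = app 0 f (F, g)" for f F g
      by (simp add: KP1_idem app_vertex)
    then show ?thesis by (rule endo_eqI_pair)
  next
    case (KP1_orth v w)
    have "v \<notin> F \<or> w \<notin> F" if "F \<in> X" for F
      using KP1_orth(2-4) filter_range[OF invariant_filter[OF that]] vertex_simps(2) by metis
    then have "app x f (F, g) = app 0 f (F, g)" for f F g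
      by (auto simp: KP1_orth(1) app_vertex[OF KP1_orth(2)] app_vertex[OF KP1_orth(3)])
    then show ?thesis by (rule endo_eqI_pair)
  next
    case (KP2_path \<alpha> \<mu>)
    have "app x f (F, g) = app 0 f (F, g)" for f F g
    proof -
      have "\<alpha> \<in> F" if "F \<in> X" "\<alpha> \<cdot> \<mu> \<in> F"
        using that invariant_filter filter_down initial_cmp KP2_path by blast
      moreover have "\<mu> \<in> pull \<alpha> F \<longleftrightarrow> \<alpha> \<cdot> \<mu> \<in> F"
        using KP2_path(3,4) by (simp add: pull_def)
      moreover have app_x: "app x f (F, g) = app (?S (Path \<alpha>)) (app (?S (Path \<mu>)) f) (F, g) -
          app (?S (Path (\<alpha> \<cdot> \<mu>))) f (F, g)"
        by (simp add: KP2_path(1))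
      ultimately show ?thesis
        using invariant_pull[of F \<alpha>] pull_pull[OF KP2_path(2-4), of F] deg_cmp[OF KP2_path(2-4)]
        unfolding app_x app_path by (auto simp: algebra_simps)
    qed
    then show ?thesis by (rule endo_eqI_pair)
  next
    case (KP2_ghost \<alpha> \<mu>)
    note \<alpha>\<mu> = KP2_ghost(2-4)
    have app_x: "app x f (F, g) = app (?S (ghost \<Lambda> \<mu>)) (app (?S (ghost \<Lambda> \<alpha>)) f) (F, g) -
        app (?S (ghost \<Lambda> (\<alpha> \<cdot> \<mu>))) f (F, g)" for f F g
      by (simp add: KP2_ghost(1))
    note app = app_ghost[OF \<alpha>\<mu>(1)] app_ghost[OF \<alpha>\<mu>(2)] app_ghost[OF cmp_mor[OF \<alpha>\<mu>]]
      src_cmp[OF \<alpha>\<mu>] deg_cmp[OF \<alpha>\<mu>]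
    have "app x f (F, g) = app 0 f (F, g)" for f F g
    proof (cases "F \<in> X \<and> s \<mu> \<in> F")
      case True
      then have F: "F \<in> filters" "push \<mu> F \<in> X" "push \<mu> F \<in> filters" "\<mu> \<in> push \<mu> F"
        using invariant_filter invariant_push KP2_ghost(3) source_push by blast+
      then have "s \<alpha> \<in> push \<mu> F" using filter_range_mem KP2_ghost(4) by metis
      moreover have "push \<alpha> (push \<mu> F) = push (\<alpha> \<cdot> \<mu>) F"
        using push_push[OF F(1) \<alpha>\<mu>] True by blast
      ultimately show ?thesis
        unfolding app_x app using True F(2) by (simp add: algebra_simps)
    next
      case False
      then show ?thesis unfolding app_x app by auto
    qed
    then show ?thesis by (rule endo_eqI_pair)
  next
    case (KP3 \<alpha> \<mu>)
    then show ?thesis using boundary_rep_KP3[OF fa] by simp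
  next
    case (KP4 v ls)
    have ls: "ls \<noteq> []" "set ls \<subseteq> paths_to \<Lambda> v"
      using KP4 FE_nonempty[OF _ k_graph_axioms] by (auto simp: FE_def)
    have "app x f (F, g) = app 0 f (F, g)" for f F g
    proof -
      \<comment> \<open>The boundary condition at the vertex \<open>v\<close>: it says that the
        indicators in (KP4) cover all filters through \<open>v\<close>.\<close>
      have "\<exists>\<alpha> \<in> set ls. \<alpha> \<in> F" if F: "F \<in> X" "v \<in> F"
      proof -
        have "F \<in> boundary_filters" using X F unfolding invariant_def by blast
        then obtain \<nu> where \<nu>: "\<nu> \<in> set ls" "v \<cdot> \<nu> \<in> F"
          using F KP4(3) vertex_simps(3)[OF KP4(2)] unfolding boundary_filters_def by force
        then have "v \<cdot> \<nu> = \<nu>" using ls cmp_rng by (auto simp: paths_to_def)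
        then show ?thesis using \<nu> by auto
      qed
      then show ?thesis
        unfolding KP4(1) app_product[OF KP4(2) ls] by auto
    qed
    then show ?thesis by (rule endo_eqI_pair)
  qed
qed

end

end


section \<open>Simplicity implies the conditions\<close>

context type_algebra
begin

lemma algebra_hom_zero:
  assumes "nonunital_algebra A" "algebra_hom A \<phi>"
  shows "\<phi> (azero A) = 0"
proof -
  interpret nonunital_algebra A by fact
  have "\<phi> (aadd A (azero A) (azero A)) = \<phi> (azero A) + \<phi> (azero A)"
    using assms(2) zero_closed unfolding algebra_hom_def by blast
  then show ?thesis using add_zero[OF zero_closed] by simp
qed

text \<open>The kernel is an ideal not containing \<open>a\<close>, hence zero. Subtraction is not
  among the operations of the carrier, so an additive inverse of \<open>y\<close> is added to both
  sides instead.\<close>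

lemma hom_of_simple_inj:
  assumes A: "nonunital_algebra A" and simple: "simple_algebra A" and hom: "algebra_hom A \<phi>"
    and a: "a \<in> carrier A" "\<phi> a \<noteq> 0"
    and xy: "x \<in> carrier A" "y \<in> carrier A" "\<phi> x = \<phi> y"
  shows "x = y"
proof -
  interpret nonunital_algebra A by fact
  note zero = algebra_hom_zero[OF A hom]
  have add: "\<phi> (aadd A x y) = \<phi> x + \<phi> y" and mult: "\<phi> (amult A x y) = \<phi> x * \<phi> y"
    if "x \<in> carrier A" "y \<in> carrier A" for x y
    using hom that unfolding algebra_hom_def by blast+
  let ?K = "{x \<in> carrier A. \<phi> x = 0}"
  have "two_sided_ideal A ?K"
    unfolding two_sided_ideal_def
  proof (intro conjI ballI)
    fix x assume x: "x \<in> ?K"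
    then obtain y where y: "y \<in> carrier A" "aadd A x y = azero A" using add_inverse by blast
    then have "\<phi> y = 0" using add[of x y] x zero by simp
    then show "\<exists>y \<in> ?K. aadd A x y = azero A" using y by blast
  qed (auto simp: zero zero_closed add mult add_closed mult_closed)
  then have K: "?K = {azero A}"
    using simple a unfolding simple_algebra_def by blast
  obtain z where z: "z \<in> carrier A" "aadd A y z = azero A" using add_inverse xy by blast
  have "\<phi> (aadd A x z) = \<phi> (aadd A y z)" using add[OF xy(1) z(1)] add[OF xy(2) z(1)] xy(3) by simp
  then have "aadd A x z \<in> ?K" using z zero xy add_closed by simp
  then have "aadd A x z = azero A" using K by blast
  then have "x = aadd A (aadd A x z) y"
    using z xy by (metis add_assoc add_comm add_zero)
  then show ?thesis using \<open>aadd A x z = azero A\<close> add_zero xy by simp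
qed

end

lemma kp_gen_closed:
  "g \<in> kp_generators \<Lambda> \<Longrightarrow> kp_gen \<Lambda> g \<in> carrier (kumjian_pask \<Lambda> :: ('r::comm_ring_1, _) nualgebra)"
  by (simp add: kumjian_pask_def quotient_algebra_def kp_gen_def free_gen_closed)

interpretation endo_algebra: type_algebra scale_endo
  by (rule type_algebra_endo)

context k_graph
begin

lemma boundary_hom:
  assumes "finitely_aligned \<Lambda>" "invariant X"
  obtains \<phi> where "endo_algebra.algebra_hom (kumjian_pask \<Lambda>) \<phi>"
    "\<And>g. g \<in> kp_generators \<Lambda> \<Longrightarrow> \<phi> (kp_gen \<Lambda> g) = (boundary_rep X t g :: (_, 'r::comm_ring_1) endo)"
  using endo_algebra.kumjian_pask_universal[OF k_graph_axioms
      boundary_rep_kp_family[OF assms(2,1), of t]]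
  by blast

context
  fixes R :: "'r::comm_ring_1 itself"
  assumes fa: "finitely_aligned \<Lambda>"
    and simple: "simple_algebra (kumjian_pask \<Lambda> :: ('r, ('a gen word \<Rightarrow>\<^sub>0 'r) set) nualgebra)"
begin

abbreviation (input) "K \<equiv> kumjian_pask \<Lambda> :: ('r, ('a gen word \<Rightarrow>\<^sub>0 'r) set) nualgebra"
abbreviation (input) "generator g \<equiv> kp_gen \<Lambda> g :: ('a gen word \<Rightarrow>\<^sub>0 'r) set"

lemma vertex_hom_nonzero:
  assumes hom: "invariant X" "F \<in> X" "v \<in> vertices \<Lambda>" "v \<in> F"
  shows "(boundary_rep X t (Path v) :: (_, 'r) endo) \<noteq> 0"
proof
  assume "(boundary_rep X t (Path v) :: (_, 'r) endo) = 0"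
  then have "app (boundary_rep X t (Path v) :: (_, 'r) endo) 1 (F, \<lambda>_. 0) = 0" by simp
  then show False using assms app_vertex[OF hom(1,3), of t "1 :: _ \<Rightarrow> 'r"] by simp
qed

text \<open>\<open>F\<close> makes the representation nonzero, since the range vertex of
  \<open>F\<close> acts as the identity at \<open>F\<close>; by simplicity the representation is
  then faithful.\<close>

lemma simple_generator_eqI:
  assumes X: "invariant X" and F: "F \<in> X"
    and gh: "g \<in> kp_generators \<Lambda>" "h \<in> kp_generators \<Lambda>"
      "(boundary_rep X t g :: (_, 'r) endo) = boundary_rep X t h"
  shows "generator g = generator h"
proof -
  obtain \<phi> where \<phi>: "endo_algebra.algebra_hom K \<phi>"
    "\<And>g. g \<in> kp_generators \<Lambda> \<Longrightarrow> \<phi> (generator g) = boundary_rep X t g"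
    using boundary_hom[OF fa X] by blast
  have F': "F \<in> filters" using F X boundary_filterD unfolding invariant_def by blast
  then obtain \<kappa> where \<kappa>: "\<kappa> \<in> F" by (auto simp: filters_def)
  have v: "r \<kappa> \<in> F" "r \<kappa> \<in> vertices \<Lambda>" using filter_range_mem filter_mor F' \<kappa> by auto
  then have "Path (r \<kappa>) \<in> kp_generators \<Lambda>" by (simp add: kp_generatorsI vertex_simps)
  then show ?thesis
    using endo_algebra.hom_of_simple_inj[OF nonunital_algebra_kumjian_pask[OF k_graph_axioms]
        simple \<phi>(1), of "generator (Path (r \<kappa>))" "generator g" "generator h"]
      vertex_hom_nonzero[OF X F v(2,1)] gh \<phi>(2) by (simp add: kp_gen_closed)
qed

lemma simple_imp_cofinal: "cofinal_graph \<Lambda>"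
  unfolding cofinal_graph_iff
proof (rule ccontr)
  assume "\<not> (\<forall>v\<in>vertices \<Lambda>. \<forall>F\<in>boundary_filters. \<exists>\<kappa>\<in>F. \<exists>\<alpha>\<in>\<M>. r \<alpha> = v \<and> s \<alpha> = s \<kappa>)"
  then obtain v F where v: "v \<in> vertices \<Lambda>" and F: "F \<in> boundary_filters"
    and no: "\<And>\<kappa> \<alpha>. \<lbrakk>\<kappa> \<in> F; \<alpha> \<in> \<M>; r \<alpha> = v\<rbrakk> \<Longrightarrow> s \<alpha> \<noteq> s \<kappa>"
    by blast
  note F' = boundary_filterD[OF F]
  \<comment> \<open>the boundary paths that are eventually equal to \<open>F\<close>, up to a shift\<close>
  define X where "X = {G \<in> boundary_filters. \<exists>\<kappa> \<in> F. \<exists>\<pi> \<in> G. pull \<pi> G = pull \<kappa> F}"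
  have X: "invariant X"
    unfolding invariant_def
  proof (intro conjI ballI impI)
    show "X \<subseteq> boundary_filters" by (auto simp: X_def)
  next
    fix G \<alpha> assume G: "G \<in> X" and \<alpha>: "\<alpha> \<in> G"
    obtain \<kappa> \<pi> where \<kappa>: "\<kappa> \<in> F" "\<pi> \<in> G" "pull \<pi> G = pull \<kappa> F" using G by (auto simp: X_def)
    have Gb: "G \<in> boundary_filters" using G by (simp add: X_def)
    note G' = boundary_filterD[OF Gb]
    \<comment> \<open>The shift by \<open>\<alpha>\<close> need not be comparable with
      \<open>\<pi>\<close>. A common extension
      \<open>\<tau> = \<pi> \<cdot> \<beta> = \<alpha> \<cdot> \<gamma>\<close> passes to a later
      tail, which agrees with the tail of \<open>F\<close> after
      \<open>\<kappa> \<cdot> \<beta>\<close>.\<close>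
    obtain \<tau> where \<tau>: "\<tau> \<in> G" "\<pi> \<preceq> \<tau>" "\<alpha> \<preceq> \<tau>" using filter_directed[OF G' \<kappa>(2) \<alpha>] .
    obtain \<beta> where \<beta>: "\<pi> \<in> \<M>" "\<beta> \<in> \<M>" "s \<pi> = r \<beta>" "\<tau> = \<pi> \<cdot> \<beta>" using \<tau>(2) by (rule initialE)
    obtain \<gamma> where \<gamma>: "\<alpha> \<in> \<M>" "\<gamma> \<in> \<M>" "s \<alpha> = r \<gamma>" "\<tau> = \<alpha> \<cdot> \<gamma>" using \<tau>(3) by (rule initialE)
    have "\<beta> \<in> pull \<kappa> F" using \<beta> \<tau>(1) \<kappa>(3) by (auto simp: pull_def)
    then have \<beta>': "s \<kappa> = r \<beta>" "\<kappa> \<cdot> \<beta> \<in> F" by (auto simp: pull_def)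
    have \<kappa>': "\<kappa> \<in> \<M>" using \<kappa>(1) F' filter_mor by blast
    have "pull \<gamma> (pull \<alpha> G) = pull \<tau> G" using pull_pull[OF \<gamma>(1-3)] \<gamma>(4) by simp
    also have "\<dots> = pull \<beta> (pull \<kappa> F)"
      unfolding \<beta>(4) using pull_pull[OF \<beta>(1-3), of G] \<kappa>(3) by metis
    also have "\<dots> = pull (\<kappa> \<cdot> \<beta>) F" using pull_pull[OF \<kappa>' \<beta>(2) \<beta>'(1)] .
    finally have "pull \<gamma> (pull \<alpha> G) = pull (\<kappa> \<cdot> \<beta>) F" .
    moreover have "\<gamma> \<in> pull \<alpha> G" using \<gamma> \<tau>(1) by (simp add: pull_def)
    ultimately show "pull \<alpha> G \<in> X"
      using pull_boundary[OF Gb \<alpha>] \<beta>'(2) unfolding X_def by blast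
  next
    fix G \<alpha> assume G: "G \<in> X" and \<alpha>: "\<alpha> \<in> \<M>" "s \<alpha> \<in> G"
    obtain \<kappa> \<pi> where \<kappa>: "\<kappa> \<in> F" "\<pi> \<in> G" "pull \<pi> G = pull \<kappa> F" using G by (auto simp: X_def)
    have Gb: "G \<in> boundary_filters" using G by (simp add: X_def)
    note G' = boundary_filterD[OF Gb]
    have \<pi>: "\<pi> \<in> \<M>" "r \<pi> = s \<alpha>"
      using \<kappa>(2) G' \<alpha> filter_mor filter_vertex_iff by auto
    have "pull (\<alpha> \<cdot> \<pi>) (push \<alpha> G) = pull \<kappa> F"
      using pull_pull[OF \<alpha>(1) \<pi>(1) \<pi>(2)[symmetric]] pull_push[OF G' \<alpha>] \<kappa>(3) by metis
    moreover have "\<alpha> \<cdot> \<pi> \<in> push \<alpha> G" using mem_push_cmp[OF G' \<alpha> \<pi>] \<kappa>(2) by simp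
    ultimately show "push \<alpha> G \<in> X"
      using push_boundary[OF fa Gb \<alpha>] \<kappa>(1) unfolding X_def by blast
  qed
  have FX: "F \<in> X" using F F' by (auto simp: X_def filters_def)
  have "v \<notin> G" if G: "G \<in> X" for G
  proof
    assume vG: "v \<in> G"
    obtain \<kappa> \<pi> where \<kappa>: "\<kappa> \<in> F" "\<pi> \<in> G" "pull \<pi> G = pull \<kappa> F" using G by (auto simp: X_def)
    have G': "G \<in> filters" using G boundary_filterD by (auto simp: X_def)
    have \<pi>: "\<pi> \<in> \<M>" "r \<pi> = v" using G' \<kappa>(2) v vG filter_mor filter_vertex_iff by auto
    \<comment> \<open>Equal tails begin at the same vertex, so \<open>\<pi>\<close> has range
      \<open>v\<close> and ends at the vertex \<open>s \<kappa>\<close> of \<open>F\<close>, which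
      was excluded.\<close>
    have "s \<pi> \<in> pull \<kappa> F" using pull_filter(2)[OF G' \<kappa>(2)] \<kappa>(3) by simp
    then have "s \<pi> = s \<kappa>" using \<pi>(1) by (simp add: pull_def)
    then show False using no[OF \<kappa>(1) \<pi>] by simp
  qed
  then have "app (boundary_rep X 0 (Path v)) f (G, g) = app 0 f (G, g)"
    for f :: "_ \<Rightarrow> 'r" and G g
    by (auto simp: app_vertex[OF X v])
  then have zero: "(boundary_rep X 0 (Path v) :: (_, 'r) endo) = 0"
    by (rule endo_eqI_pair)
  obtain \<phi> where \<phi>: "endo_algebra.algebra_hom K \<phi>"
    "\<And>g. g \<in> kp_generators \<Lambda> \<Longrightarrow> \<phi> (generator g) = boundary_rep X 0 g"
    using boundary_hom[OF fa X] by blast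
  obtain \<psi> where \<psi>: "endo_algebra.algebra_hom K \<psi>"
    "\<And>g. g \<in> kp_generators \<Lambda> \<Longrightarrow> \<psi> (generator g) = boundary_rep boundary_filters 0 g"
    using boundary_hom[OF fa invariant_boundary_filters[OF fa]] by blast
  have alg: "nonunital_algebra K" by (rule nonunital_algebra_kumjian_pask[OF k_graph_axioms])
  obtain \<kappa> where \<kappa>: "\<kappa> \<in> F" using F' by (auto simp: filters_def)
  have u: "r \<kappa> \<in> F" "r \<kappa> \<in> vertices \<Lambda>" using filter_range_mem filter_mor F' \<kappa> by auto
  have gens: "Path v \<in> kp_generators \<Lambda>" "Path (r \<kappa>) \<in> kp_generators \<Lambda>"
    using v u by (simp_all add: kp_generatorsI vertex_simps)
  have "generator (Path v) = azero K"
    using endo_algebra.hom_of_simple_inj[OF alg simple \<phi>(1), of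
        "generator (Path (r \<kappa>))" "generator (Path v)" "azero K"]
      vertex_hom_nonzero[OF X FX u(2,1)] zero \<phi>(2) gens
      endo_algebra.algebra_hom_zero[OF alg \<phi>(1)]
      nonunital_algebra.zero_closed[OF alg]
    by (simp add: kp_gen_closed)
  \<comment> \<open>The vertex vanishes in the algebra and therefore in every representation,
    including the one on all boundary paths, where some path starts at \<open>v\<close>.\<close>
  then have "(boundary_rep boundary_filters 0 (Path v) :: (_, 'r) endo) = 0"
    using \<psi>(2)[OF gens(1)] endo_algebra.algebra_hom_zero[OF alg \<psi>(1)] by simp
  moreover obtain G where "G \<in> boundary_filters" "v \<in> G"
    using boundary_filter_through[OF fa vertex_simps(1)[OF v]] .
  ultimately show False
    using vertex_hom_nonzero[OF invariant_boundary_filters[OF fa] _ v] by blast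
qed

lemma simple_imp_separating: separating
  unfolding separating_def
proof (intro ballI impI, rule ccontr)
  fix \<alpha> \<beta> assume ab: "\<alpha> \<in> \<M>" "\<beta> \<in> \<M>" "s \<alpha> = s \<beta>" "\<alpha> \<noteq> \<beta>"
    and "\<not> (\<exists>\<xi>\<in>\<M>. r \<xi> = s \<alpha> \<and> \<not> compatible (\<alpha> \<cdot> \<xi>) (\<beta> \<cdot> \<xi>))"
  then have eq: "push \<alpha> F = push \<beta> F" if "F \<in> boundary_filters" "s \<alpha> \<in> F" for F
    using incompatible_extension[OF fa that(1) ab(1) that(2) ab(2) ab(3)[symmetric]] by blast
  let ?B = boundary_filters
  note inv = invariant_boundary_filters[OF fa]
  \<comment> \<open>Rewritten in terms of \<open>pull\<close>: a boundary filter through one of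
    \<open>\<alpha>\<close>, \<open>\<beta>\<close> passes through the other and has the same
    remainder. The argument is symmetric, hence the unordered pair.\<close>
  have pull_eq: "\<beta>' \<in> F \<and> pull \<beta>' F = pull \<alpha>' F"
    if F: "F \<in> ?B" "\<alpha>' \<in> F" and "{\<alpha>', \<beta>'} = {\<alpha>, \<beta>}" for F \<alpha>' \<beta>'
  proof -
    note F' = boundary_filterD[OF F(1)]
    have s: "s \<alpha>' = s \<alpha>" "s \<beta>' = s \<alpha>" "\<beta>' \<in> \<M>" using that(3) ab by (auto simp: doubleton_eq_iff)
    have P: "pull \<alpha>' F \<in> filters" "s \<alpha>' \<in> pull \<alpha>' F" "pull \<alpha>' F \<in> ?B"
      using pull_filter[OF F' F(2)] pull_boundary[OF F] by simp_all
    have "push \<beta>' (pull \<alpha>' F) = push \<alpha>' (pull \<alpha>' F)"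
      using eq[OF P(3)] P(2) s(1) that(3) by (auto simp: doubleton_eq_iff)
    then have *: "push \<beta>' (pull \<alpha>' F) = F" using push_pull[OF F' F(2)] by simp
    have "s \<beta>' \<in> pull \<alpha>' F" using P(2) s by simp
    then show ?thesis using source_push[OF P(1) s(3)] pull_push[OF P(1) s(3)] * by metis
  qed
  have "app (boundary_rep ?B 0 (Path \<alpha>)) f (F, g) = app (boundary_rep ?B 0 (Path \<beta>)) f (F, g)"
    for f :: "_ \<Rightarrow> 'r" and F g
    using pull_eq[of F \<alpha> \<beta>] pull_eq[of F \<beta> \<alpha>] by (auto simp: app_path)
  then have "(boundary_rep ?B 0 (Path \<alpha>) :: (_, 'r) endo) = boundary_rep ?B 0 (Path \<beta>)"
    by (rule endo_eqI_pair)
  moreover obtain F where F: "F \<in> ?B" "s \<alpha> \<in> F"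
    using boundary_filter_through[OF fa src_mor[OF ab(1)]] .
  ultimately have gen: "generator (Path \<alpha>) = generator (Path \<beta>)"
    using simple_generator_eqI[OF inv F(1), of "Path \<alpha>" "Path \<beta>" 0] ab by (simp add: kp_generatorsI)
  obtain \<psi> where \<psi>: "\<And>g. g \<in> kp_generators \<Lambda> \<Longrightarrow> \<psi> (generator g) = (boundary_rep ?B 1 g :: (_, 'r) endo)"
    using boundary_hom[OF fa inv, of 1] by blast
  \<comment> \<open>Equality found with \<open>t = 0\<close> holds in the algebra itself and so
    transfers to the graded representation with \<open>t = 1\<close>.\<close>
  have "(boundary_rep ?B 1 (Path \<alpha>) :: (_, 'r) endo) = boundary_rep ?B 1 (Path \<beta>)"
    using \<psi>[of "Path \<alpha>"] \<psi>[of "Path \<beta>"] gen ab by (simp add: kp_generatorsI)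
  then have app: "app (boundary_rep ?B 1 (Path \<alpha>)) f (push \<alpha> F, g) = app (boundary_rep ?B 1 (Path \<beta>)) f (push \<alpha> F, g)"
    for f :: "_ \<Rightarrow> 'r" and g
    by simp
  note F' = boundary_filterD[OF F(1)]
  have mem: "push \<alpha> F \<in> ?B" "push \<alpha> F \<in> filters" "\<alpha> \<in> push \<alpha> F" "\<beta> \<in> push \<alpha> F"
    using push_boundary[OF fa F(1) ab(1) F(2)] boundary_filterD
      source_push[OF F' ab(1) F(2)] source_push[OF F' ab(2)] eq[OF F] F(2) ab(3) by auto
  have "d \<alpha> \<noteq> d \<beta>" using filter_deg_unique[OF mem(2-4)] ab(4) by blast
  then obtain i where i: "d \<alpha> i \<noteq> d \<beta> i" by (auto simp: fun_eq_iff)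
  show False
    \<comment> \<open>At second coordinate \<open>d \<alpha>\<close>, translation by
      \<open>d \<alpha>\<close> leads to 0 while translation by \<open>d \<beta>\<close> leaves a
      nonzero \<open>i\<close>-th entry, so the test function takes the values 1 and 0.\<close>
    using app[of "\<lambda>(G, g). if g i = 0 then 1 else 0" "\<lambda>j. int (d \<alpha> j)"] mem i
    by (simp add: app_path)
qed

lemma simple_imp_field:
  assumes v: "v \<in> vertices \<Lambda>" and c: "(c :: 'r) \<noteq> 0"
  shows "\<exists>e. c * e = 1"
proof -
  interpret A: nonunital_algebra K by (rule nonunital_algebra_kumjian_pask[OF k_graph_axioms])
  note inv = invariant_boundary_filters[OF fa]
  obtain F where F: "F \<in> boundary_filters" "v \<in> F"
    using boundary_filter_through[OF fa vertex_simps(1)[OF v]] .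
  obtain \<phi> where \<phi>: "endo_algebra.algebra_hom K \<phi>"
    "\<And>g. g \<in> kp_generators \<Lambda> \<Longrightarrow> \<phi> (generator g) = boundary_rep boundary_filters 0 g"
    using boundary_hom[OF fa inv] by blast
  have scale: "\<phi> (ascale K c x) = scale_endo c (\<phi> x)" if "x \<in> carrier K" for x
    using \<phi>(1) that unfolding endo_algebra.algebra_hom_def by blast
  have gen: "Path v \<in> kp_generators \<Lambda>" "generator (Path v) \<in> carrier K"
    using v by (simp_all add: kp_generatorsI vertex_simps kp_gen_closed)
  have val: "app (\<phi> (generator (Path v))) 1 (F, \<lambda>_. 0) = 1"
    using F \<phi>(2)[OF gen(1)] by (simp add: app_vertex[OF inv v])
  let ?I = "ascale K c ` carrier K"
  have "two_sided_ideal K ?I"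
    unfolding two_sided_ideal_def
  proof (intro conjI ballI)
    show "?I \<subseteq> carrier K" using A.scale_closed by blast
    have z: "ascale K c (azero K) = azero K"
    proof -
      obtain y where y: "y \<in> carrier K" "aadd K (ascale K c (azero K)) y = azero K"
        using A.add_inverse A.scale_closed A.zero_closed by metis
      let ?z = "ascale K c (azero K)"
      have "?z \<in> carrier K" using A.scale_closed A.zero_closed .
      moreover have "aadd K ?z ?z = ?z"
        using A.scale_add[OF A.zero_closed A.zero_closed] A.add_zero[OF A.zero_closed] by metis
      ultimately show ?thesis using y A.add_assoc A.add_zero A.add_comm by metis
    qed
    show "azero K \<in> ?I" using z A.zero_closed by (metis imageI)
    fix x assume "x \<in> ?I"
    then obtain x' where x: "x' \<in> carrier K" "x = ascale K c x'" by blast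
    show "aadd K x y \<in> ?I" if "y \<in> ?I" for y
      using that x A.scale_add A.add_closed by (auto simp flip: A.scale_add)
    obtain y' where y': "y' \<in> carrier K" "aadd K x' y' = azero K" using A.add_inverse x by blast
    then have "aadd K x (ascale K c y') = azero K" using x z A.scale_add by metis
    then show "\<exists>y \<in> ?I. aadd K x y = azero K" using y' by blast
    fix a assume "a \<in> carrier K"
    then show "amult K a x \<in> ?I" "amult K x a \<in> ?I"
      using x A.mult_closed by (simp_all add: A.scale_mult_left A.scale_mult_right)
  qed
  moreover have "?I \<noteq> {azero K}"
  proof
    assume "?I = {azero K}"
    then have "ascale K c (generator (Path v)) = azero K" using gen by blast
    then have "scale_endo c (\<phi> (generator (Path v))) = 0"
      using scale[OF gen(2)] endo_algebra.algebra_hom_zero[OF A.nonunital_algebra_axioms \<phi>(1)]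
      by simp
    then have "app (scale_endo c (\<phi> (generator (Path v)))) 1 (F, \<lambda>_. 0) = 0" by simp
    then show False using c val by simp
  qed
  ultimately have "?I = carrier K" using simple unfolding simple_algebra_def by blast
  then obtain a where "a \<in> carrier K" "generator (Path v) = ascale K c a" using gen by blast
  \<comment> \<open>The ideal of multiples of \<open>c\<close> is everything and so contains the
    vertex. Applying both sides to the constant function 1 and evaluating at \<open>F\<close> gives
    the inverse of \<open>c\<close>.\<close>
  then have "1 = c * app (\<phi> a) 1 (F, \<lambda>_. 0)" using scale val by simp
  then show ?thesis by metis
qed

end

end

section \<open>Calculations in a Kumjian--Pask algebra\<close>

text \<open>Incompatibility persists under extension. Hence \<open>\<alpha>\<close> can be separated
  from the members of \<open>M\<close> one after the other, each time along a further extension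
  common to all of them.\<close>

lemma (in k_graph) separating_finite:
  assumes sep: separating and M: "finite M" "M \<subseteq> \<M>" "\<And>\<mu>. \<mu> \<in> M \<Longrightarrow> s \<mu> = r \<xi> \<and> \<mu> \<noteq> \<alpha>"
    and \<alpha>: "\<alpha> \<in> \<M>" "s \<alpha> = r \<xi>" and \<xi>: "\<xi> \<in> \<M>"
  shows "\<exists>\<eta> \<in> \<M>. r \<eta> = s \<xi> \<and> (\<forall>\<mu> \<in> M. \<not> compatible (\<alpha> \<cdot> (\<xi> \<cdot> \<eta>)) (\<mu> \<cdot> (\<xi> \<cdot> \<eta>)))"
  using M
proof (induction M)
  case empty
  show ?case using \<xi> by (intro bexI[of _ "s \<xi>"]) simp_all
next
  case (insert \<beta> M)
  then obtain \<eta> where \<eta>: "\<eta> \<in> \<M>" "r \<eta> = s \<xi>"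
    "\<And>\<mu>. \<mu> \<in> M \<Longrightarrow> \<not> compatible (\<alpha> \<cdot> (\<xi> \<cdot> \<eta>)) (\<mu> \<cdot> (\<xi> \<cdot> \<eta>))"
    by blast
  have \<xi>\<eta>: "\<xi> \<cdot> \<eta> \<in> \<M>" "r (\<xi> \<cdot> \<eta>) = r \<xi>" "s (\<xi> \<cdot> \<eta>) = s \<eta>" using \<xi> \<eta>(1,2) by simp_all
  have cmp: "\<mu> \<cdot> (\<xi> \<cdot> \<eta>) \<in> \<M>" "s (\<mu> \<cdot> (\<xi> \<cdot> \<eta>)) = s \<eta>" if "\<mu> \<in> \<M>" "s \<mu> = r \<xi>" for \<mu>
    using that \<xi>\<eta> by simp_all
  have \<beta>: "\<beta> \<in> \<M>" "s \<beta> = r \<xi>" "\<beta> \<noteq> \<alpha>" using insert.prems by auto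
  have "\<alpha> \<cdot> (\<xi> \<cdot> \<eta>) \<noteq> \<beta> \<cdot> (\<xi> \<cdot> \<eta>)"
    using right_cancel[OF \<alpha>(1) \<beta>(1) \<xi>\<eta>(1)] \<alpha>(2) \<beta>(2,3) \<xi>\<eta>(2) by metis
  then obtain \<zeta> where \<zeta>: "\<zeta> \<in> \<M>" "r \<zeta> = s \<eta>"
    "\<not> compatible (\<alpha> \<cdot> (\<xi> \<cdot> \<eta>) \<cdot> \<zeta>) (\<beta> \<cdot> (\<xi> \<cdot> \<eta>) \<cdot> \<zeta>)"
    using sep[unfolded separating_def] cmp[OF \<alpha>] cmp[OF \<beta>(1,2)] by metis
  have assoc: "\<mu> \<cdot> (\<xi> \<cdot> (\<eta> \<cdot> \<zeta>)) = \<mu> \<cdot> (\<xi> \<cdot> \<eta>) \<cdot> \<zeta>" if "\<mu> \<in> \<M>" "s \<mu> = r \<xi>" for \<mu>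
    using cmp_assoc[OF \<xi> \<eta>(1) \<zeta>(1)] cmp_assoc[OF that(1) \<xi>\<eta>(1) \<zeta>(1)] that \<eta>(2) \<zeta>(2) \<xi>\<eta>(2,3) by metis
  have *: "\<mu> \<cdot> (\<xi> \<cdot> \<eta>) \<preceq> \<mu> \<cdot> (\<xi> \<cdot> (\<eta> \<cdot> \<zeta>))" if "\<mu> \<in> \<M>" "s \<mu> = r \<xi>" for \<mu>
    unfolding assoc[OF that] using cmp[OF that] \<zeta>(1,2) by (intro initial_cmp) simp_all
  have "\<not> compatible (\<alpha> \<cdot> (\<xi> \<cdot> (\<eta> \<cdot> \<zeta>))) (\<mu> \<cdot> (\<xi> \<cdot> (\<eta> \<cdot> \<zeta>)))" if "\<mu> \<in> M" for \<mu>
  proof -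
    have \<mu>: "\<mu> \<in> \<M>" "s \<mu> = r \<xi>" using insert.prems that by auto
    show ?thesis using \<eta>(3)[OF that] compatible_initial * \<alpha> \<mu> by blast
  qed
  moreover have "\<not> compatible (\<alpha> \<cdot> (\<xi> \<cdot> (\<eta> \<cdot> \<zeta>))) (\<beta> \<cdot> (\<xi> \<cdot> (\<eta> \<cdot> \<zeta>)))"
    using \<zeta>(3) assoc[OF \<alpha>] assoc[OF \<beta>(1,2)] by simp
  ultimately show ?case
    using \<eta>(1,2) \<zeta>(1,2) by (intro bexI[of _ "\<eta> \<cdot> \<zeta>"]) auto
qed

text \<open>Coefficients are to be indexed by paths although \<open>f\<close> need not be injective,
  so one preimage is chosen for each vector.\<close>

lemma (in module) span_image_nonzero_coeffs:
  assumes "y \<in> span (f ` A)"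
  obtains M c where "finite M" "M \<subseteq> A" "\<And>\<mu>. \<mu> \<in> M \<Longrightarrow> c \<mu> \<noteq> 0" "y = (\<Sum>\<mu> \<in> M. c \<mu> *s f \<mu>)"
proof -
  obtain t u where t: "finite t" "t \<subseteq> f ` A" "y = (\<Sum>a \<in> t. u a *s a)"
    using assms unfolding span_explicit by blast
  obtain M where M: "M \<subseteq> A" "inj_on f M" "t = f ` M"
    using t(2) by (auto simp: subset_image_inj)
  have fin: "finite M" using M t(1) finite_imageD by blast
  have "y = (\<Sum>\<mu> \<in> M. u (f \<mu>) *s f \<mu>)"
    using t(3) M by (simp add: sum.reindex)
  also have "\<dots> = (\<Sum>\<mu> \<in> {\<mu> \<in> M. u (f \<mu>) \<noteq> 0}. u (f \<mu>) *s f \<mu>)"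
    using fin by (intro sum.mono_neutral_right) auto
  finally have y: "y = (\<Sum>\<mu> \<in> {\<mu> \<in> M. u (f \<mu>) \<noteq> 0}. u (f \<mu>) *s f \<mu>)" .
  show thesis by (rule that[OF _ _ _ y]) (use fin M(1) in auto)
qed

section \<open>Relations among paths and ghosts in a Kumjian-Pask family\<close>

locale kp_algebra = k_graph \<Lambda> + type_algebra scale
  for \<Lambda> :: "('a, 'k::finite) kgraph" and scale :: "'r::comm_ring_1 \<Rightarrow> 'b::ring \<Rightarrow> 'b" +
  fixes S :: "'a gen \<Rightarrow> 'b"
  assumes fa: "finitely_aligned \<Lambda>" and kp: "kp_family \<Lambda> S"
begin

definition "p \<alpha> = S (Path \<alpha>)"
definition "q \<alpha> = S (ghost \<Lambda> \<alpha>)"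
definition "e \<alpha> = p \<alpha> * q \<alpha>"

lemma relator: "x \<in> kp_relators \<Lambda> S \<Longrightarrow> x = 0"
  using kp by (simp add: kp_family_def)

lemma vertex_idem: "v \<in> vertices \<Lambda> \<Longrightarrow> p v * p v = p v"
  using relator[OF KP1_idem[of v \<Lambda> S]] by (simp add: p_def)

lemma vertex_orth: "\<lbrakk>v \<in> vertices \<Lambda>; w \<in> vertices \<Lambda>; v \<noteq> w\<rbrakk> \<Longrightarrow> p v * p w = 0"
  using relator[OF KP1_orth[of v \<Lambda> w S]] by (simp add: p_def)

lemma path_mult: "\<lbrakk>\<alpha> \<in> \<M>; \<beta> \<in> \<M>; s \<alpha> = r \<beta>\<rbrakk> \<Longrightarrow> p \<alpha> * p \<beta> = p (\<alpha> \<cdot> \<beta>)"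
  using relator[OF KP2_path[of \<alpha> \<Lambda> \<beta> S]] by (simp add: p_def)

lemma ghost_mult: "\<lbrakk>\<alpha> \<in> \<M>; \<beta> \<in> \<M>; s \<alpha> = r \<beta>\<rbrakk> \<Longrightarrow> q \<beta> * q \<alpha> = q (\<alpha> \<cdot> \<beta>)"
  using relator[OF KP2_ghost[of \<alpha> \<Lambda> \<beta> S]] by (simp add: q_def)

lemma ghost_vertex: "v \<in> vertices \<Lambda> \<Longrightarrow> q v = p v"
  by (simp add: p_def q_def ghost_def)

lemma ghost_path:
  "\<lbrakk>\<alpha> \<in> \<M>; \<beta> \<in> \<M>\<rbrakk> \<Longrightarrow> q \<alpha> * p \<beta> = (\<Sum>(\<rho>, \<tau>) \<in> Lmin \<Lambda> \<alpha> \<beta>. p \<rho> * q \<tau>)"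
  using relator[OF KP3[of \<alpha> \<Lambda> \<beta> S]] by (simp add: p_def q_def)

lemma path_units:
  assumes "\<alpha> \<in> \<M>" shows "p \<alpha> * p (s \<alpha>) = p \<alpha>" "p (r \<alpha>) * p \<alpha> = p \<alpha>"
  using path_mult[of \<alpha> "s \<alpha>"] path_mult[of "r \<alpha>" \<alpha>] assms by simp_all

lemma ghost_units:
  assumes "\<alpha> \<in> \<M>" shows "p (s \<alpha>) * q \<alpha> = q \<alpha>" "q \<alpha> * p (r \<alpha>) = q \<alpha>"
  using ghost_mult[of \<alpha> "s \<alpha>"] ghost_mult[of "r \<alpha>" \<alpha>] assms by (simp_all add: ghost_vertex)

lemma ghost_path_incompatible: "\<lbrakk>\<alpha> \<in> \<M>; \<beta> \<in> \<M>; \<not> compatible \<alpha> \<beta>\<rbrakk> \<Longrightarrow> q \<alpha> * p \<beta> = 0"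
  by (simp add: ghost_path compatible_iff_Lmin)

lemma ghost_path_self:
  assumes \<alpha>: "\<alpha> \<in> \<M>" shows "q \<alpha> * p \<alpha> = p (s \<alpha>)"
proof -
  have "Lmin \<Lambda> \<alpha> \<alpha> = {(s \<alpha>, s \<alpha>)}"
  proof (intro equalityI subsetI)
    fix z assume "z \<in> Lmin \<Lambda> \<alpha> \<alpha>"
    then obtain \<rho> \<tau> where z: "z = (\<rho>, \<tau>)" and "(\<rho>, \<tau>) \<in> Lmin \<Lambda> \<alpha> \<alpha>" by (cases z) auto
    from iffD1[OF Lmin_iff[OF \<alpha> \<alpha>] this(2)]
    have \<rho>: "\<rho> \<in> \<M>" "\<tau> \<in> \<M>" "s \<alpha> = r \<rho>" "s \<alpha> = r \<tau>" "\<alpha> \<cdot> \<rho> = \<alpha> \<cdot> \<tau>" "d (\<alpha> \<cdot> \<rho>) = sup (d \<alpha>) (d \<alpha>)"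
      by blast+
    have "d \<rho> = 0" using deg_cmp[OF \<alpha> \<rho>(1,3)] \<rho>(6) by simp
    then have "\<rho> = s \<alpha>" using deg_zero_identity[OF \<rho>(1)] \<rho>(3) by simp
    moreover have "\<rho> = \<tau>" using left_cancel[OF \<alpha> \<rho>(1-5)] .
    ultimately show "z \<in> {(s \<alpha>, s \<alpha>)}" using z by simp
  qed (use \<alpha> in \<open>simp add: Lmin_iff\<close>)
  then show ?thesis
    using \<alpha> by (simp add: ghost_path ghost_vertex vertex_idem)
qed

lemma ghost_path_initial:
  assumes "\<alpha> \<in> \<M>" "\<beta> \<in> \<M>" "s \<alpha> = r \<beta>" shows "q \<alpha> * p (\<alpha> \<cdot> \<beta>) = p \<beta>"
proof -
  have "q \<alpha> * p (\<alpha> \<cdot> \<beta>) = (q \<alpha> * p \<alpha>) * p \<beta>" using path_mult[OF assms] by (simp add: mult.assoc)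
  also have "\<dots> = p (r \<beta>) * p \<beta>" using ghost_path_self[OF assms(1)] assms(3) by simp
  finally show ?thesis using path_units[OF assms(2)] by simp
qed

lemma e_path: "\<alpha> \<in> \<M> \<Longrightarrow> e \<alpha> * p \<alpha> = p \<alpha>"
  by (simp add: e_def mult.assoc ghost_path_self path_units)

lemma ghost_e: "\<alpha> \<in> \<M> \<Longrightarrow> q \<alpha> * e \<alpha> = q \<alpha>"
  by (simp add: e_def ghost_path_self ghost_units flip: mult.assoc)

section \<open>Range projections and cutting them away\<close>

lemma e_mult:
  assumes \<alpha>: "\<alpha> \<in> \<M>" and \<beta>: "\<beta> \<in> \<M>"
  shows "e \<alpha> * e \<beta> = (\<Sum>(\<rho>, \<tau>) \<in> Lmin \<Lambda> \<alpha> \<beta>. e (\<alpha> \<cdot> \<rho>))"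
proof -
  have *: "p \<alpha> * (p \<rho> * q \<tau>) * q \<beta> = e (\<alpha> \<cdot> \<rho>)" if "(\<rho>, \<tau>) \<in> Lmin \<Lambda> \<alpha> \<beta>" for \<rho> \<tau>
  proof -
    from iffD1[OF Lmin_iff[OF \<alpha> \<beta>] that]
    have \<rho>: "\<rho> \<in> \<M>" "\<tau> \<in> \<M>" "s \<alpha> = r \<rho>" "s \<beta> = r \<tau>" "\<alpha> \<cdot> \<rho> = \<beta> \<cdot> \<tau>" by blast+
    have "p \<alpha> * (p \<rho> * q \<tau>) * q \<beta> = (p \<alpha> * p \<rho>) * (q \<tau> * q \<beta>)" by (simp add: mult.assoc)
    also have "\<dots> = p (\<alpha> \<cdot> \<rho>) * q (\<beta> \<cdot> \<tau>)"
      using path_mult[OF \<alpha> \<rho>(1,3)] ghost_mult[OF \<beta> \<rho>(2,4)] by simp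
    finally show ?thesis using \<rho>(5) by (simp add: e_def)
  qed
  have "e \<alpha> * e \<beta> = p \<alpha> * (q \<alpha> * p \<beta>) * q \<beta>" by (simp add: e_def mult.assoc)
  also have "\<dots> = (\<Sum>(\<rho>, \<tau>) \<in> Lmin \<Lambda> \<alpha> \<beta>. p \<alpha> * (p \<rho> * q \<tau>) * q \<beta>)"
    by (simp add: ghost_path[OF \<alpha> \<beta>] sum_distrib_left sum_distrib_right case_prod_unfold)
  also have "\<dots> = (\<Sum>(\<rho>, \<tau>) \<in> Lmin \<Lambda> \<alpha> \<beta>. e (\<alpha> \<cdot> \<rho>))"
    using * by (intro sum.cong) auto
  finally show ?thesis .
qed

text \<open>Minimal common extensions are symmetric in the two paths, so both products are sums over
  the same extensions.\<close>

lemma e_comm: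
  assumes \<alpha>: "\<alpha> \<in> \<M>" and \<beta>: "\<beta> \<in> \<M>"
  shows "e \<alpha> * e \<beta> = e \<beta> * e \<alpha>"
proof -
  have swap: "(\<tau>, \<rho>) \<in> Lmin \<Lambda> \<beta> \<alpha>" if "(\<rho>, \<tau>) \<in> Lmin \<Lambda> \<alpha> \<beta>" "\<alpha> \<in> \<M>" "\<beta> \<in> \<M>" for \<alpha> \<beta> \<rho> \<tau>
    using that(1) unfolding Lmin_iff[OF that(2,3)] Lmin_iff[OF that(3,2)] by (metis sup.commute)
  have "e \<alpha> * e \<beta> = (\<Sum>(\<rho>, \<tau>) \<in> Lmin \<Lambda> \<alpha> \<beta>. e (\<beta> \<cdot> \<tau>))"
    unfolding e_mult[OF \<alpha> \<beta>] using Lmin_iff[OF \<alpha> \<beta>] by (intro sum.cong) auto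
  also have "\<dots> = (\<Sum>(\<tau>, \<rho>) \<in> Lmin \<Lambda> \<beta> \<alpha>. e (\<beta> \<cdot> \<tau>))"
    using swap \<alpha> \<beta> by (intro sum.reindex_bij_witness[of _ "\<lambda>(x, y). (y, x)" "\<lambda>(x, y). (y, x)"]) auto
  finally show ?thesis by (simp add: e_mult[OF \<beta> \<alpha>])
qed

text \<open>Right multiplication by the product of the \<open>1 - e(\<nu>)\<close> for \<open>\<nu>\<close> in a list; there is no unit.\<close>

definition cut :: "'b \<Rightarrow> 'a list \<Rightarrow> 'b"
  where "cut x G = foldl (\<lambda>x \<nu>. x - x * e \<nu>) x G"

lemma cut_simps [simp]: "cut x [] = x" "cut x (\<nu> # G) = cut (x - x * e \<nu>) G"
  by (simp_all add: cut_def)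

lemma cut_add: "cut (x + y) G = cut x G + cut y G"
proof (induction G arbitrary: x y)
  case (Cons \<nu> G)
  have "x + y - (x + y) * e \<nu> = (x - x * e \<nu>) + (y - y * e \<nu>)" by (simp add: algebra_simps)
  then show ?case by (simp only: cut_simps Cons.IH)
qed simp

lemma cut_zero [simp]: "cut 0 G = 0"
  by (induction G) simp_all

lemma cut_diff: "cut (x - y) G = cut x G - cut y G"
  using cut_add[of "x - y" y G] by simp

lemma cut_sum: "cut (\<Sum>i \<in> I. x i) G = (\<Sum>i \<in> I. cut (x i) G)"
  by (induction I rule: infinite_finite_induct) (simp_all add: cut_add)

lemma cut_mult_left: "cut (y * x) G = y * cut x G"
  by (induction G arbitrary: x) (simp_all add: mult.assoc flip: right_diff_distrib)

text \<open>The projections commute, so every factor preceding that of \<open>\<nu>\<close>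
  preserves \<open>x * e \<nu> = x\<close>; the factor of \<open>\<nu>\<close> then gives
  zero.\<close>

lemma cut_eq_zero:
  assumes "x * e \<nu> = x" "\<nu> \<in> set G" "set G \<subseteq> \<M>"
  shows "cut x G = 0"
  using assms
proof (induction G arbitrary: x)
  case (Cons \<eta> G)
  show ?case
  proof (cases "\<nu> = \<eta>")
    case False
    have M: "\<eta> \<in> \<M>" "\<nu> \<in> \<M>" using Cons.prems(2,3) by auto
    have "x * e \<eta> * e \<nu> = (x * e \<nu>) * e \<eta>" by (simp add: mult.assoc e_comm[OF M])
    then have "x * e \<eta> * e \<nu> = x * e \<eta>" by (simp add: Cons.prems(1))
    then have "(x - x * e \<eta>) * e \<nu> = x - x * e \<eta>"
      using Cons.prems(1) by (simp add: left_diff_distrib)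
    then show ?thesis using Cons False by simp
  qed (use Cons in simp)
qed simp

lemma cut_mult_right: "(\<And>\<nu>. \<nu> \<in> set G \<Longrightarrow> e \<nu> * z = 0) \<Longrightarrow> cut x G * z = x * z"
  by (induction G arbitrary: x) (simp_all add: left_diff_distrib mult.assoc)

text \<open>If cutting away \<open>\<nu>\<close> leaves something nonzero, \<open>\<nu>\<close> is
  put into \<open>G\<close>. Otherwise \<open>e \<pi>\<close> may be replaced by
  \<open>e \<pi> * e \<nu>\<close>, a sum of projections of minimal common extensions, and some
  summand survives; its path extends both \<open>\<pi>\<close> and \<open>\<nu>\<close>.\<close>

lemma resolve:
  assumes x: "x * e v \<noteq> 0" and v: "v \<in> \<M>" and L: "set L \<subseteq> \<M>"
  obtains \<pi> G where "\<pi> \<in> \<M>" "set G \<subseteq> set L" "\<And>\<nu>. \<nu> \<in> set L \<Longrightarrow> \<nu> \<preceq> \<pi> \<or> \<nu> \<in> set G"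
    "cut (x * e \<pi>) G \<noteq> 0"
  using L
proof (induction L arbitrary: thesis)
  case Nil
  then show ?case using x v by (metis cut_simps(1) empty_iff empty_set order.refl)
next
  case (Cons \<nu> L)
  obtain \<pi> G where IH: "\<pi> \<in> \<M>" "set G \<subseteq> set L" "\<And>\<nu>. \<nu> \<in> set L \<Longrightarrow> \<nu> \<preceq> \<pi> \<or> \<nu> \<in> set G"
      "cut (x * e \<pi>) G \<noteq> 0"
    using Cons.IH Cons.prems(2) by auto
  show thesis
  proof (cases "cut (x * e \<pi>) (\<nu> # G) = 0")
    case False
    show thesis
      by (rule Cons.prems(1)[of \<pi> "\<nu> # G"]) (use IH False in auto)
  next
    case True
    have \<nu>: "\<nu> \<in> \<M>" using Cons.prems(2) by simp
    have "cut (x * e \<pi>) G = cut (x * (e \<pi> * e \<nu>)) G"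
      using True by (simp add: cut_diff mult.assoc)
    also have "\<dots> = (\<Sum>(\<rho>, \<tau>) \<in> Lmin \<Lambda> \<pi> \<nu>. cut (x * e (\<pi> \<cdot> \<rho>)) G)"
      by (simp add: e_mult[OF IH(1) \<nu>] sum_distrib_left cut_sum case_prod_unfold)
    finally have "(\<Sum>(\<rho>, \<tau>) \<in> Lmin \<Lambda> \<pi> \<nu>. cut (x * e (\<pi> \<cdot> \<rho>)) G) \<noteq> 0"
      using IH(4) by simp
    then obtain z where z: "z \<in> Lmin \<Lambda> \<pi> \<nu>" "(case z of (\<rho>, \<tau>) \<Rightarrow> cut (x * e (\<pi> \<cdot> \<rho>)) G) \<noteq> 0"
      by (rule sum.not_neutral_contains_not_neutral)
    then obtain \<rho> \<tau> where "(\<rho>, \<tau>) \<in> Lmin \<Lambda> \<pi> \<nu>" and ne: "cut (x * e (\<pi> \<cdot> \<rho>)) G \<noteq> 0"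
      by (cases z) auto
    from iffD1[OF Lmin_iff[OF IH(1) \<nu>] this(1)]
    have \<rho>: "\<rho> \<in> \<M>" "\<tau> \<in> \<M>" "s \<pi> = r \<rho>" "s \<nu> = r \<tau>" "\<pi> \<cdot> \<rho> = \<nu> \<cdot> \<tau>" by blast+
    have ini: "\<pi> \<preceq> \<pi> \<cdot> \<rho>" "\<nu> \<preceq> \<pi> \<cdot> \<rho>"
      using initial_cmp[OF IH(1) \<rho>(1,3)] initial_cmp[OF \<nu> \<rho>(2,4)] \<rho>(5) by simp_all
    show thesis
    proof (rule Cons.prems(1)[of "\<pi> \<cdot> \<rho>" G])
      show "\<nu>' \<preceq> \<pi> \<cdot> \<rho> \<or> \<nu>' \<in> set G" if "\<nu>' \<in> set (\<nu> # L)" for \<nu>'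
        using that IH(3) ini initial_trans by auto
    qed (use IH ne initial_mor(2)[OF ini(1)] in auto)
  qed
qed

lemma exhaustive_product:
  assumes w: "w \<in> vertices \<Lambda>" and E: "finite E" "exhaustive \<Lambda> w E" "w \<notin> E"
  obtains ls where "set ls = E" "ls \<noteq> []" "nprod (map (\<lambda>\<alpha>. p w - p \<alpha> * q \<alpha>) ls) = 0"
proof -
  obtain ls where ls: "set ls = E" "distinct ls" using finite_distinct_list[OF E(1)] by blast
  have FE: "set ls \<in> FE \<Lambda> w" using E ls by (simp add: FE_iff)
  have "ls \<noteq> []" using FE FE_nonempty[OF w k_graph_axioms] by auto
  moreover have "nprod (map (\<lambda>\<alpha>. p w - p \<alpha> * q \<alpha>) ls) = 0"
    using relator[OF KP4[OF w FE ls(2), of S]] by (simp add: p_def q_def)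
  ultimately show thesis using that ls(1) by blast
qed

text \<open>Each factor of the product in (KP4) fixes \<open>p w * z\<close>, since its subtracted
  term ends in a ghost that kills \<open>z\<close>. But the product is zero.\<close>

lemma exhaustive_annihilator:
  assumes w: "w \<in> vertices \<Lambda>" and E: "finite E" "exhaustive \<Lambda> w E"
    and z: "\<And>\<rho>. \<rho> \<in> E \<Longrightarrow> q \<rho> * z = 0"
  shows "p w * z = 0"
proof (cases "w \<in> E")
  case True
  then show ?thesis using z[OF True] ghost_vertex[OF w] by simp
next
  case False
  obtain ls where ls: "set ls = E" and ne: "ls \<noteq> []"
    and prod: "nprod (map (\<lambda>\<alpha>. p w - p \<alpha> * q \<alpha>) ls) = 0"
    using exhaustive_product[OF w E False] .
  have sub: "set ls \<subseteq> paths_to \<Lambda> w" using E(2) ls by (auto simp: exhaustive_iff)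
  have "nprod (map (\<lambda>\<alpha>. p w - p \<alpha> * q \<alpha>) ls) * z = p w * z"
    using ne sub z[folded ls]
  proof (induction ls rule: induct_list012)
    case (3 \<alpha> \<beta> ls)
    then have \<alpha>: "\<alpha> \<in> \<M>" "r \<alpha> = w" by (auto simp: paths_to_def)
    have "nprod (map (\<lambda>\<alpha>. p w - p \<alpha> * q \<alpha>) (\<alpha> # \<beta> # ls)) * z = (p w - p \<alpha> * q \<alpha>) * (p w * z)"
      using 3 by (simp add: mult.assoc)
    also have "\<dots> = p w * z - p \<alpha> * ((q \<alpha> * p w) * z)"
      by (simp add: left_diff_distrib vertex_idem[OF w] mult.assoc flip: mult.assoc[of "p w"])
    also have "q \<alpha> * p w = q \<alpha>" using ghost_units(2)[OF \<alpha>(1)] \<alpha>(2) by simp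
    finally show ?case using 3(5)[of \<alpha>] by simp
  qed (simp_all add: left_diff_distrib mult.assoc)
  then show ?thesis using prod by simp
qed

text \<open>If every extension of \<open>\<pi>\<close> met \<open>G\<close>, then
  \<open>Ext \<pi> (set G)\<close> would be finite and exhaustive. For \<open>\<rho>\<close> in it,
  \<open>\<pi> \<cdot> \<rho>\<close> extends some \<open>\<nu>\<close> in \<open>G\<close>, so
  \<open>e \<nu>\<close> fixes \<open>q (\<pi> \<cdot> \<rho>)\<close> on the right and
  \<open>q \<rho>\<close> kills the cut of \<open>q \<pi>\<close>. By
  \<open>exhaustive_annihilator\<close> the cut itself would vanish.\<close>

lemma cut_nonzero:
  assumes \<pi>: "\<pi> \<in> \<M>" and G: "set G \<subseteq> \<M>" and ne: "cut (y * q \<pi>) G \<noteq> 0"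
  obtains \<xi> where "\<xi> \<in> \<M>" "r \<xi> = s \<pi>" "\<And>\<nu>. \<nu> \<in> set G \<Longrightarrow> \<not> compatible (\<pi> \<cdot> \<xi>) \<nu>"
proof (rule ccontr)
  note witness = that
  assume "\<not> thesis"
  then have compat: "\<exists>\<nu> \<in> set G. compatible (\<pi> \<cdot> \<xi>) \<nu>" if "\<xi> \<in> \<M>" "s \<pi> = r \<xi>" for \<xi>
    using that witness[of \<xi>] by metis
  let ?E = "Ext \<pi> (set G)"
  have E: "finite ?E" "exhaustive \<Lambda> (s \<pi>) ?E"
    using finite_Ext[OF fa _ G \<pi>] exhaustive_Ext[OF G \<pi> compat] by simp_all
  have "q \<rho> * cut (q \<pi>) G = 0" if \<rho>: "\<rho> \<in> ?E" for \<rho>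
  proof -
    obtain \<nu> \<tau> where \<nu>: "\<nu> \<in> set G" "\<rho> \<in> \<M>" "\<tau> \<in> \<M>" "s \<pi> = r \<rho>" "s \<nu> = r \<tau>" "\<pi> \<cdot> \<rho> = \<nu> \<cdot> \<tau>"
      using ExtE[OF \<rho> G \<pi>] .
    have \<nu>': "\<nu> \<in> \<M>" using \<nu>(1) G by blast
    have "q (\<pi> \<cdot> \<rho>) * e \<nu> = q \<tau> * (q \<nu> * e \<nu>)"
      using ghost_mult[OF \<nu>' \<nu>(3,5)] \<nu>(6) by (simp flip: mult.assoc)
    also have "\<dots> = q (\<pi> \<cdot> \<rho>)"
      using ghost_e[OF \<nu>'] ghost_mult[OF \<nu>' \<nu>(3,5)] \<nu>(6) by simp
    finally have "cut (q (\<pi> \<cdot> \<rho>)) G = 0" using cut_eq_zero \<nu>(1) G by blast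
    then show ?thesis
      using cut_mult_left[of "q \<rho>" "q \<pi>" G] ghost_mult[OF \<pi> \<nu>(2,4)] by simp
  qed
  then have "p (s \<pi>) * cut (q \<pi>) G = 0"
    using exhaustive_annihilator[OF _ E] \<pi> by simp
  then have "cut (q \<pi>) G = 0"
    using cut_mult_left[of "p (s \<pi>)" "q \<pi>" G] ghost_units(1)[OF \<pi>] by simp
  then show False using ne by (simp add: cut_mult_left)
qed

section \<open>The spanned subalgebra, its local units, and compression to paths\<close>

definition spanning :: "'b set"
  where "spanning = {p \<alpha> * q \<beta> |\<alpha> \<beta>. \<alpha> \<in> \<M> \<and> \<beta> \<in> \<M> \<and> s \<alpha> = s \<beta>}"

text \<open>The ambient ring may be larger than what the family generates, so this span plays the
  role of the Kumjian-Pask algebra.\<close>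

abbreviation "B \<equiv> span spanning"

lemma spanningI: "\<lbrakk>\<alpha> \<in> \<M>; \<beta> \<in> \<M>; s \<alpha> = s \<beta>\<rbrakk> \<Longrightarrow> p \<alpha> * q \<beta> \<in> B"
  by (rule span_base) (auto simp: spanning_def)

lemma path_ghost_in_B: "\<alpha> \<in> \<M> \<Longrightarrow> p \<alpha> \<in> B" "\<alpha> \<in> \<M> \<Longrightarrow> q \<alpha> \<in> B"
  using spanningI[of \<alpha> "s \<alpha>"] spanningI[of "s \<alpha>" \<alpha>]
  by (simp_all add: ghost_vertex path_units ghost_units)

lemma B_finite_support:
  assumes "a \<in> B"
  obtains L where "set L \<subseteq> \<M>" "a \<in> span {p \<alpha> * q \<beta> |\<alpha> \<beta>. \<alpha> \<in> \<M> \<and> \<beta> \<in> set L \<and> s \<alpha> = s \<beta>}"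
proof -
  let ?T = "\<lambda>L. {p \<alpha> * q \<beta> |\<alpha> \<beta>. \<alpha> \<in> \<M> \<and> \<beta> \<in> set L \<and> s \<alpha> = s \<beta>}"
  have "\<exists>L. set L \<subseteq> \<M> \<and> a \<in> span (?T L)"
    using assms
  proof (induction rule: span_induct_alt)
    case base
    show ?case by (intro exI[of _ "[]"]) (simp add: span_zero)
  next
    case (step c x y)
    then obtain L where L: "set L \<subseteq> \<M>" "y \<in> span (?T L)" by blast
    obtain \<alpha> \<beta> where x: "x = p \<alpha> * q \<beta>" "\<alpha> \<in> \<M>" "\<beta> \<in> \<M>" "s \<alpha> = s \<beta>"
      using step by (auto simp: spanning_def)
    have "x \<in> span (?T (\<beta> # L))" using x by (intro span_base) auto
    moreover have "y \<in> span (?T (\<beta> # L))" using L(2) by (rule rev_subsetD) (intro span_mono, auto)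
    ultimately show ?case
      using L(1) x(3) by (intro exI[of _ "\<beta> # L"]) (simp add: span_add span_scale)
  qed
  then show thesis using that by blast
qed

lemma B_local_unit:
  assumes "a \<in> B"
  obtains W where "finite W" "W \<subseteq> vertices \<Lambda>" "a * (\<Sum>v \<in> W. p v) = a"
proof -
  \<comment> \<open>The claim covers all larger \<open>W\<close> as well, so that the induction can
    merge the vertices of two summands.\<close>
  have "\<exists>W0. finite W0 \<and> W0 \<subseteq> vertices \<Lambda> \<and>
    (\<forall>W. finite W \<longrightarrow> W0 \<subseteq> W \<longrightarrow> W \<subseteq> vertices \<Lambda> \<longrightarrow> a * (\<Sum>v \<in> W. p v) = a)"
    using assms
  proof (induction rule: span_induct_alt)
    case base
    show ?case by (intro exI[of _ "{}"]) simp
  next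
    case (step c x y)
    then obtain W0 where W0: "finite W0" "W0 \<subseteq> vertices \<Lambda>"
      "\<And>W. \<lbrakk>finite W; W0 \<subseteq> W; W \<subseteq> vertices \<Lambda>\<rbrakk> \<Longrightarrow> y * (\<Sum>v \<in> W. p v) = y" by blast
    obtain \<alpha> \<beta> where x: "x = p \<alpha> * q \<beta>" "\<alpha> \<in> \<M>" "\<beta> \<in> \<M>" "s \<alpha> = s \<beta>"
      using step by (auto simp: spanning_def)
    have "x * (\<Sum>v \<in> W. p v) = x" if W: "finite W" "r \<beta> \<in> W" "W \<subseteq> vertices \<Lambda>" for W
    proof -
      have "q \<beta> * p v = (if v = r \<beta> then q \<beta> else 0)" if "v \<in> W" for v
        using ghost_units(2)[OF x(3)] vertex_orth[of "r \<beta>" v] W(3) that x(3)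
        by (auto simp: subset_iff) (metis mult.assoc mult_zero_right)
      then have "(\<Sum>v \<in> W. q \<beta> * p v) = q \<beta>" using W by simp
      then show ?thesis by (simp add: x(1) mult.assoc flip: sum_distrib_left)
    qed
    then show ?case
      using W0 x(3) by (intro exI[of _ "insert (r \<beta>) W0"])
        (auto simp: distrib_right scale_times_left)
  qed
  then obtain W where "finite W" "W \<subseteq> vertices \<Lambda>"
    "\<And>W'. \<lbrakk>finite W'; W \<subseteq> W'; W' \<subseteq> vertices \<Lambda>\<rbrakk> \<Longrightarrow> a * (\<Sum>v \<in> W'. p v) = a" by blast
  then show thesis using that by blast
qed

text \<open>
  Splitting off the projections \<open>e(\<nu>)\<close> for the finitely many ghosts in \<open>a\<close> makes all of them cancel;
  by (KP4) this is possible without annihilating \<open>a\<close>.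
\<close>

lemma nonzero_compression:
  assumes a: "a \<in> B" "a \<noteq> 0"
  obtains \<pi> \<xi> M c where "\<pi> \<in> \<M>" "\<xi> \<in> \<M>" "s \<pi> = r \<xi>" "finite M" "M \<noteq> {}"
    "M \<subseteq> {\<mu> \<in> \<M>. s \<mu> = s \<pi>}" "\<And>\<mu>. \<mu> \<in> M \<Longrightarrow> c \<mu> \<noteq> 0"
    "a * p (\<pi> \<cdot> \<xi>) = (\<Sum>\<mu> \<in> M. scale (c \<mu>) (p \<mu>)) * p \<xi>"
proof -
  obtain L where L: "set L \<subseteq> \<M>" "a \<in> span {p \<alpha> * q \<beta> |\<alpha> \<beta>. \<alpha> \<in> \<M> \<and> \<beta> \<in> set L \<and> s \<alpha> = s \<beta>}"
    using B_finite_support[OF a(1)] .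
  obtain W where W: "finite W" "W \<subseteq> vertices \<Lambda>" "a * (\<Sum>v \<in> W. p v) = a"
    using B_local_unit[OF a(1)] .
  then have "(\<Sum>v \<in> W. a * p v) \<noteq> 0" using a(2) by (simp add: sum_distrib_left)
  then obtain v where "v \<in> W" "a * p v \<noteq> 0" by (meson sum.not_neutral_contains_not_neutral)
  then have v: "v \<in> \<M>" "a * e v \<noteq> 0"
    using W(2) vertex_simps(1) by (auto simp: e_def ghost_vertex vertex_idem subset_iff)
  obtain \<pi> G where \<pi>: "\<pi> \<in> \<M>" "set G \<subseteq> set L" "\<And>\<nu>. \<nu> \<in> set L \<Longrightarrow> \<nu> \<preceq> \<pi> \<or> \<nu> \<in> set G"
    "cut (a * e \<pi>) G \<noteq> 0"
    using resolve[OF v(2,1) L(1)] by blast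
  have G: "set G \<subseteq> \<M>" using \<pi>(2) L(1) by blast
  let ?A = "{\<mu> \<in> \<M>. s \<mu> = s \<pi>}"
  \<comment> \<open>By the choice of \<open>\<pi>\<close> and \<open>G\<close>, every ghost
    \<open>\<beta>\<close> in \<open>a\<close> either is an initial segment of \<open>\<pi>\<close>,
    so that \<open>q \<beta> * p \<pi>\<close> is a path, or belongs to \<open>G\<close> and its
    term is cut away.\<close>
  have "\<exists>y \<in> span (p ` ?A). cut (a * e \<pi>) G = cut (y * q \<pi>) G"
    using L(2)
  proof (induction rule: span_induct_alt)
    case base
    show ?case by (intro bexI[of _ 0]) (simp_all add: span_zero)
  next
    case (step c x y)
    then obtain z where z: "z \<in> span (p ` ?A)" "cut (y * e \<pi>) G = cut (z * q \<pi>) G" by blast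
    obtain \<alpha> \<beta> where x: "x = p \<alpha> * q \<beta>" "\<alpha> \<in> \<M>" "\<beta> \<in> set L" "s \<alpha> = s \<beta>" using step by blast
    have "\<exists>u \<in> span (p ` ?A). cut (x * e \<pi>) G = cut (u * q \<pi>) G"
    proof (cases "\<beta> \<preceq> \<pi>")
      case True
      then obtain \<kappa> where \<kappa>: "\<beta> \<in> \<M>" "\<kappa> \<in> \<M>" "s \<beta> = r \<kappa>" "\<pi> = \<beta> \<cdot> \<kappa>" by (rule initialE)
      have s\<alpha>: "s \<alpha> = r \<kappa>" using x(4) \<kappa>(3) by simp
      have "x * e \<pi> = p \<alpha> * (q \<beta> * p \<pi>) * q \<pi>" by (simp add: x(1) e_def mult.assoc)
      also have "q \<beta> * p \<pi> = p \<kappa>" unfolding \<kappa>(4) by (rule ghost_path_initial[OF \<kappa>(1-3)])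
      also have "p \<alpha> * p \<kappa> = p (\<alpha> \<cdot> \<kappa>)" by (rule path_mult[OF x(2) \<kappa>(2) s\<alpha>])
      finally have "x * e \<pi> = p (\<alpha> \<cdot> \<kappa>) * q \<pi>" .
      moreover have "\<alpha> \<cdot> \<kappa> \<in> ?A"
        using cmp_mor[OF x(2) \<kappa>(2) s\<alpha>] src_cmp[OF x(2) \<kappa>(2) s\<alpha>] src_cmp[OF \<kappa>(1-3)] \<kappa>(4) by simp
      ultimately show ?thesis by (intro bexI[of _ "p (\<alpha> \<cdot> \<kappa>)"]) (auto intro: span_base)
    next
      case False
      then have \<beta>: "\<beta> \<in> set G" "\<beta> \<in> \<M>" using \<pi>(3) x(3) L(1) by blast+
      have "x * e \<pi> * e \<beta> = p \<alpha> * (q \<beta> * e \<beta>) * e \<pi>"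
        by (simp add: x(1) mult.assoc e_comm[OF \<pi>(1) \<beta>(2)])
      also have "\<dots> = x * e \<pi>" by (simp add: ghost_e[OF \<beta>(2)] x(1))
      finally have "cut (x * e \<pi>) G = 0" using cut_eq_zero \<beta>(1) G by blast
      then show ?thesis by (intro bexI[of _ 0]) (simp_all add: span_zero)
    qed
    then obtain u where u: "u \<in> span (p ` ?A)" "cut (x * e \<pi>) G = cut (u * q \<pi>) G" by blast
    have scale: "cut (scale c b) G = scale c (cut b G)" for b
      by (induction G arbitrary: b) (simp_all add: scale_times_left flip: scale_right_diff_distrib)
    have "cut ((scale c x + y) * e \<pi>) G = cut ((scale c u + z) * q \<pi>) G"
      using u(2) z(2) by (simp add: distrib_right cut_add scale scale_times_left)
    then show ?case using u(1) z(1) span_add span_scale by blast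
  qed
  then obtain y where y: "y \<in> span (p ` ?A)" "cut (a * e \<pi>) G = cut (y * q \<pi>) G" by blast
  obtain \<xi> where \<xi>: "\<xi> \<in> \<M>" "r \<xi> = s \<pi>" "\<And>\<nu>. \<nu> \<in> set G \<Longrightarrow> \<not> compatible (\<pi> \<cdot> \<xi>) \<nu>"
    using cut_nonzero[OF \<pi>(1) G] \<pi>(4) y(2) by metis
  note \<pi>\<xi> = \<pi>(1) \<xi>(1) \<xi>(2)[symmetric]
  have "e \<nu> * p (\<pi> \<cdot> \<xi>) = 0" if "\<nu> \<in> set G" for \<nu>
    using ghost_path_incompatible[of \<nu> "\<pi> \<cdot> \<xi>"] \<xi>(3)[OF that] compatible_sym G that cmp_mor[OF \<pi>\<xi>]
    by (auto simp: e_def mult.assoc)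
  then have cut: "cut x G * p (\<pi> \<cdot> \<xi>) = x * p (\<pi> \<cdot> \<xi>)" for x by (rule cut_mult_right)
  have "e \<pi> * p (\<pi> \<cdot> \<xi>) = p (\<pi> \<cdot> \<xi>)"
    using e_path[OF \<pi>(1)] path_mult[OF \<pi>\<xi>] by (metis mult.assoc)
  then have "a * p (\<pi> \<cdot> \<xi>) = cut (a * e \<pi>) G * p (\<pi> \<cdot> \<xi>)" by (simp add: cut mult.assoc)
  also have "\<dots> = y * p \<xi>"
    using ghost_path_initial[OF \<pi>\<xi>] by (simp add: y(2) cut mult.assoc)
  finally have ap: "a * p (\<pi> \<cdot> \<xi>) = y * p \<xi>" .
  obtain M c where M: "finite M" "M \<subseteq> ?A" "\<And>\<mu>. \<mu> \<in> M \<Longrightarrow> c \<mu> \<noteq> 0" "y = (\<Sum>\<mu> \<in> M. scale (c \<mu>) (p \<mu>))"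
    using span_image_nonzero_coeffs[OF y(1)] by blast
  have "y \<noteq> 0" using \<pi>(4) y(2) by auto
  then have "M \<noteq> {}" using M(4) by auto
  show thesis
  proof (rule that[OF \<pi>\<xi> M(1) \<open>M \<noteq> {}\<close> M(2)])
    show "a * p (\<pi> \<cdot> \<xi>) = (\<Sum>\<mu> \<in> M. scale (c \<mu>) (p \<mu>)) * p \<xi>"
      using ap by (simp only: M(4))
  qed (rule M(3))
qed


section \<open>Ideals of the spanned subalgebra\<close>

context
  fixes J :: "'b set"
  assumes J_zero: "0 \<in> J" and J_sub: "J \<subseteq> B"
    and J_diff: "\<And>x y. \<lbrakk>x \<in> J; y \<in> J\<rbrakk> \<Longrightarrow> x - y \<in> J"
    and J_mult: "\<And>a x. \<lbrakk>a \<in> B; x \<in> J\<rbrakk> \<Longrightarrow> a * x \<in> J" "\<And>a x. \<lbrakk>a \<in> B; x \<in> J\<rbrakk> \<Longrightarrow> x * a \<in> J"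
begin

lemma J_add: "\<lbrakk>x \<in> J; y \<in> J\<rbrakk> \<Longrightarrow> x + y \<in> J"
  using J_diff[of x "0 - y"] J_diff[OF J_zero, of y] by simp

lemma ideal_contains_vertex:
  assumes field: "\<And>c :: 'r. c \<noteq> 0 \<Longrightarrow> \<exists>d. c * d = 1" and sep: separating
    and a: "a \<in> J" "a \<noteq> 0"
  obtains w where "w \<in> vertices \<Lambda>" "p w \<in> J"
proof -
  have aB: "a \<in> B" using a(1) J_sub by blast
  obtain \<pi> \<xi> M c where *: "\<pi> \<in> \<M>" "\<xi> \<in> \<M>" "s \<pi> = r \<xi>" "finite M" "M \<noteq> {}"
    "M \<subseteq> {\<mu> \<in> \<M>. s \<mu> = s \<pi>}" "\<And>\<mu>. \<mu> \<in> M \<Longrightarrow> c \<mu> \<noteq> 0"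
    "a * p (\<pi> \<cdot> \<xi>) = (\<Sum>\<mu> \<in> M. scale (c \<mu>) (p \<mu>)) * p \<xi>"
    using nonzero_compression[OF aB a(2)] by blast
  obtain \<alpha> where \<alpha>: "\<alpha> \<in> M" using *(5) by blast
  have M: "\<mu> \<in> \<M>" "s \<mu> = r \<xi>" if "\<mu> \<in> M" for \<mu> using that *(3,6) by auto
  have "\<exists>\<eta> \<in> \<M>. r \<eta> = s \<xi> \<and>
      (\<forall>\<mu> \<in> M - {\<alpha>}. \<not> compatible (\<alpha> \<cdot> (\<xi> \<cdot> \<eta>)) (\<mu> \<cdot> (\<xi> \<cdot> \<eta>)))"
    by (rule separating_finite[OF sep _ _ _ M(1)[OF \<alpha>] M(2)[OF \<alpha>] *(2)]) (use M *(4) in auto)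
  then obtain \<eta> where \<eta>: "\<eta> \<in> \<M>" "r \<eta> = s \<xi>"
    "\<And>\<mu>. \<mu> \<in> M - {\<alpha>} \<Longrightarrow> \<not> compatible (\<alpha> \<cdot> (\<xi> \<cdot> \<eta>)) (\<mu> \<cdot> (\<xi> \<cdot> \<eta>))"
    by blast
  have \<xi>\<eta>: "\<xi> \<cdot> \<eta> \<in> \<M>" "r (\<xi> \<cdot> \<eta>) = r \<xi>" "s (\<xi> \<cdot> \<eta>) = s \<eta>" "p \<xi> * p \<eta> = p (\<xi> \<cdot> \<eta>)"
    using *(2) \<eta>(1,2) path_mult[of \<xi> \<eta>] by simp_all
  have ext: "\<mu> \<cdot> (\<xi> \<cdot> \<eta>) \<in> \<M>" "p \<mu> * p (\<xi> \<cdot> \<eta>) = p (\<mu> \<cdot> (\<xi> \<cdot> \<eta>))" "s (\<mu> \<cdot> (\<xi> \<cdot> \<eta>)) = s \<eta>"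
    if "\<mu> \<in> M" for \<mu>
    using M[OF that] \<xi>\<eta>(1-3) path_mult[of \<mu> "\<xi> \<cdot> \<eta>"] by simp_all
  let ?q = "q (\<alpha> \<cdot> (\<xi> \<cdot> \<eta>))"
  have "?q * (a * p (\<pi> \<cdot> \<xi>) * p \<eta>) = (\<Sum>\<mu> \<in> M. scale (c \<mu>) (?q * p (\<mu> \<cdot> (\<xi> \<cdot> \<eta>))))"
    using \<xi>\<eta>(4) ext(2)
    by (simp add: *(8) mult.assoc sum_distrib_left sum_distrib_right scale_times_left scale_times_right)
  \<comment> \<open>The ghost of the extended \<open>\<alpha>\<close> annihilates every other term,
    whose path is incompatible with it, and leaves only its own source vertex.\<close>
  also have "\<dots> = (\<Sum>\<mu> \<in> M. if \<mu> = \<alpha> then scale (c \<alpha>) (p (s \<eta>)) else 0)"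
    using ghost_path_self[OF ext(1)[OF \<alpha>]] ext(1,3) \<alpha> ghost_path_incompatible \<eta>(3)
    by (intro sum.cong) auto
  also have "\<dots> = scale (c \<alpha>) (p (s \<eta>))" using \<alpha> *(4) by simp
  finally have eq: "?q * (a * p (\<pi> \<cdot> \<xi>) * p \<eta>) = scale (c \<alpha>) (p (s \<eta>))" .
  have J: "scale (c \<alpha>) (p (s \<eta>)) \<in> J"
    unfolding eq[symmetric]
    by (intro J_mult path_ghost_in_B a(1) ext(1)[OF \<alpha>] cmp_mor[OF *(1-3)] \<eta>(1))
  obtain b where b: "c \<alpha> * b = 1" using field[OF *(7)[OF \<alpha>]] by blast
  have w: "s \<eta> \<in> vertices \<Lambda>" using \<eta>(1) by simp
  \<comment> \<open>\<open>J\<close> is not assumed closed under scalars; the inverse coefficient is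
    applied as a multiple of the idempotent \<open>p (s \<eta>)\<close>, which lies in
    \<open>B\<close>.\<close>
  have "scale b (p (s \<eta>)) * scale (c \<alpha>) (p (s \<eta>)) = scale (c \<alpha> * b) (p (s \<eta>))"
    by (simp only: scale_times_left scale_times_right vertex_idem[OF w] scale_scale mult.commute[of b])
  then have "scale b (p (s \<eta>)) * scale (c \<alpha>) (p (s \<eta>)) = p (s \<eta>)" by (simp add: b)
  moreover have "scale b (p (s \<eta>)) \<in> B" using path_ghost_in_B(1) \<eta>(1) span_scale by simp
  ultimately have "p (s \<eta>) \<in> J" using J J_mult(1) by metis
  then show thesis using that w by blast
qed

lemma ideal_hereditary:
  assumes "\<alpha> \<in> \<M>" "p (r \<alpha>) \<in> J" shows "p (s \<alpha>) \<in> J"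
proof -
  have "q \<alpha> * (p (r \<alpha>) * p \<alpha>) \<in> J" using assms J_mult path_ghost_in_B by blast
  then show ?thesis using ghost_path_self path_units assms by simp
qed

text \<open>Modulo \<open>J\<close> every factor of the product in (KP4) equals \<open>p w\<close>,
  so the product, which is zero, is congruent to \<open>p w\<close>.\<close>

lemma ideal_saturated:
  assumes w: "w \<in> vertices \<Lambda>" and E: "finite E" "exhaustive \<Lambda> w E"
    and J: "\<And>\<rho>. \<rho> \<in> E \<Longrightarrow> p (s \<rho>) \<in> J"
  shows "p w \<in> J"
proof (cases "w \<in> E")
  case True
  then show ?thesis using J vertex_simps(3)[OF w] by metis
next
  case False
  obtain ls where ls: "set ls = E" and ne: "ls \<noteq> []"
    and prod: "nprod (map (\<lambda>\<alpha>. p w - p \<alpha> * q \<alpha>) ls) = 0"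
    using exhaustive_product[OF w E False] .
  have sub: "set ls \<subseteq> \<M>" using E(2) ls by (auto simp: exhaustive_iff paths_to_def)
  have e: "p \<alpha> * q \<alpha> \<in> J" if "\<alpha> \<in> set ls" for \<alpha>
  proof -
    have \<alpha>: "\<alpha> \<in> \<M>" "p (s \<alpha>) \<in> J" using that sub J ls by auto
    then have "p \<alpha> * p (s \<alpha>) * q \<alpha> \<in> J" using J_mult path_ghost_in_B by blast
    then show ?thesis using path_units \<alpha> by simp
  qed
  have w': "p w \<in> B" using path_ghost_in_B(1) vertex_simps(1)[OF w] .
  have "p w - nprod (map (\<lambda>\<alpha>. p w - p \<alpha> * q \<alpha>) ls) \<in> J"
    using ne e
  proof (induction ls rule: induct_list012)
    case (3 \<alpha> \<beta> ls)
    let ?n = "nprod (map (\<lambda>\<alpha>. p w - p \<alpha> * q \<alpha>) (\<beta> # ls))"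
    have IH: "p w - ?n \<in> J" using 3 by simp
    have "p \<alpha> * q \<alpha> \<in> J" using 3 by simp
    then have "p w - p \<alpha> * q \<alpha> \<in> B" using w' J_sub span_diff by blast
    then have "(p w - p \<alpha> * q \<alpha>) * (p w - ?n) \<in> J" "p \<alpha> * q \<alpha> * p w \<in> J"
      using IH \<open>p \<alpha> * q \<alpha> \<in> J\<close> w' J_mult by blast+
    then have "(p w - p \<alpha> * q \<alpha>) * (p w - ?n) + p \<alpha> * q \<alpha> * p w \<in> J" by (rule J_add)
    moreover have "(p w - p \<alpha> * q \<alpha>) * (p w - ?n) + p \<alpha> * q \<alpha> * p w
        = p w - (p w - p \<alpha> * q \<alpha>) * ?n"
      by (simp add: algebra_simps vertex_idem[OF w])
    ultimately show ?case by simp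
  qed (simp_all add: J_zero)
  then show ?thesis using prod by simp
qed

text \<open>Take for \<open>P\<close> the paths whose source is not in \<open>J\<close>. Saturation
  is precisely the extension hypothesis of \<open>generic_boundary_filter\<close>. Heredity, applied
  along a path from \<open>w\<close> to the generic path and then along that path, contradicts the
  cofinality of \<open>P\<close> in it.\<close>

lemma ideal_contains_all_vertices:
  assumes cof: "cofinal_graph \<Lambda>" and w: "w \<in> vertices \<Lambda>" "p w \<in> J" and v: "v \<in> vertices \<Lambda>"
  shows "p v \<in> J"
proof (rule ccontr)
  assume nv: "p v \<notin> J"
  let ?P = "{\<alpha> \<in> \<M>. p (s \<alpha>) \<notin> J}"
  have sub: "?P \<subseteq> \<M>" by blast
  have vP: "v \<in> ?P" using v nv vertex_simps by simp
  have ext: "\<exists>\<nu> \<in> E. \<kappa> \<cdot> \<nu> \<in> ?P" if \<kappa>: "\<kappa> \<in> ?P" and E: "finite E" "exhaustive \<Lambda> (s \<kappa>) E" for \<kappa> E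
  proof -
    have "s \<kappa> \<in> vertices \<Lambda>" using \<kappa> by simp
    then obtain \<nu> where \<nu>: "\<nu> \<in> E" "p (s \<nu>) \<notin> J" using ideal_saturated E \<kappa> by blast
    moreover have "\<nu> \<in> \<M>" "s \<kappa> = r \<nu>" using \<nu> E(2) by (auto simp: exhaustive_iff paths_to_def)
    ultimately show ?thesis using \<kappa> by (intro bexI[of _ \<nu>]) auto
  qed
  obtain F where F: "F \<in> boundary_filters" "v \<in> F" "\<And>\<kappa>. \<kappa> \<in> F \<Longrightarrow> \<exists>\<mu> \<in> ?P \<inter> F. \<kappa> \<preceq> \<mu>"
  proof (rule generic_boundary_filter[OF fa sub vP countable_empty _ ext])
    show "\<exists>\<mu> \<in> ?P \<inter> D. \<kappa> \<preceq> \<mu>" if "D \<in> {}" for D \<kappa> using that by simp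
  qed (assumption | rule that)+
  obtain \<kappa> \<alpha> where \<kappa>: "\<kappa> \<in> F" "\<alpha> \<in> \<M>" "r \<alpha> = w" "s \<alpha> = s \<kappa>"
    using cof w(1) F(1) unfolding cofinal_graph_iff by blast
  have "p (s \<kappa>) \<in> J" using ideal_hereditary[OF \<kappa>(2)] \<kappa>(3,4) w(2) by simp
  moreover obtain \<mu> where \<mu>: "\<mu> \<in> ?P" "\<kappa> \<preceq> \<mu>" using F(3)[OF \<kappa>(1)] by blast
  from \<mu>(2) obtain \<gamma> where \<gamma>: "\<kappa> \<in> \<M>" "\<gamma> \<in> \<M>" "s \<kappa> = r \<gamma>" "\<mu> = \<kappa> \<cdot> \<gamma>" by (rule initialE)
  ultimately have "p (s \<gamma>) \<in> J" using ideal_hereditary[OF \<gamma>(2)] by simp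
  then show False using \<mu>(1) \<gamma> by simp
qed

lemma ideal_eq_top:
  assumes "\<And>c :: 'r. c \<noteq> 0 \<Longrightarrow> \<exists>d. c * d = 1" separating "cofinal_graph \<Lambda>" "J \<noteq> {0}"
  shows "B \<subseteq> J"
proof
  fix b assume b: "b \<in> B"
  obtain a where "a \<in> J" "a \<noteq> 0" using assms(4) J_zero by blast
  then obtain w where w: "w \<in> vertices \<Lambda>" "p w \<in> J"
    using ideal_contains_vertex[OF assms(1,2)] by blast
  obtain W where W: "finite W" "W \<subseteq> vertices \<Lambda>" "b * (\<Sum>v \<in> W. p v) = b"
    using B_local_unit[OF b] .
  have "(\<Sum>v \<in> W. p v) \<in> J"
    using W(1,2)
  proof (induction W)
    case (insert v W)
    then show ?case using ideal_contains_all_vertices[OF assms(3) w] J_add by simp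
  qed (simp add: J_zero)
  \<comment> \<open>A local unit in \<open>J\<close> absorbs \<open>b\<close> into
    \<open>J\<close>.\<close>
  then show "b \<in> J" using J_mult(1)[OF b] W(3) by metis
qed

end

lemma B_mult:
  assumes "a \<in> B" "b \<in> B" shows "a * b \<in> B"
proof -
  have base: "p \<alpha> * q \<beta> * (p \<gamma> * q \<delta>) \<in> B"
    if ab: "\<alpha> \<in> \<M>" "\<beta> \<in> \<M>" "s \<alpha> = s \<beta>" and cd: "\<gamma> \<in> \<M>" "\<delta> \<in> \<M>" "s \<gamma> = s \<delta>" for \<alpha> \<beta> \<gamma> \<delta>
  proof -
    have "p \<alpha> * (p \<rho> * q \<tau>) * q \<delta> \<in> B" if "(\<rho>, \<tau>) \<in> Lmin \<Lambda> \<beta> \<gamma>" for \<rho> \<tau>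
    proof -
      from iffD1[OF Lmin_iff[OF ab(2) cd(1)] that]
      have \<rho>: "\<rho> \<in> \<M>" "\<tau> \<in> \<M>" "s \<beta> = r \<rho>" "s \<gamma> = r \<tau>" "\<beta> \<cdot> \<rho> = \<gamma> \<cdot> \<tau>" by blast+
      have s: "s \<alpha> = r \<rho>" "s \<delta> = r \<tau>" using ab(3) cd(3) \<rho>(3,4) by simp_all
      have "s \<rho> = s \<tau>" using src_cmp[OF ab(2) \<rho>(1,3)] src_cmp[OF cd(1) \<rho>(2,4)] \<rho>(5) by simp
      then have "p (\<alpha> \<cdot> \<rho>) * q (\<delta> \<cdot> \<tau>) \<in> B"
        using spanningI[OF cmp_mor[OF ab(1) \<rho>(1) s(1)] cmp_mor[OF cd(2) \<rho>(2) s(2)]]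
          src_cmp[OF ab(1) \<rho>(1) s(1)] src_cmp[OF cd(2) \<rho>(2) s(2)] by simp
      then show ?thesis
        using path_mult[OF ab(1) \<rho>(1) s(1)] ghost_mult[OF cd(2) \<rho>(2) s(2)] by (simp add: mult.assoc)
          (simp flip: mult.assoc)
    qed
    then have "(\<Sum>(\<rho>, \<tau>) \<in> Lmin \<Lambda> \<beta> \<gamma>. p \<alpha> * (p \<rho> * q \<tau>) * q \<delta>) \<in> B"
      by (intro span_sum) auto
    also have "(\<Sum>(\<rho>, \<tau>) \<in> Lmin \<Lambda> \<beta> \<gamma>. p \<alpha> * (p \<rho> * q \<tau>) * q \<delta>) = p \<alpha> * (q \<beta> * p \<gamma>) * q \<delta>"
      by (simp add: ghost_path[OF ab(2) cd(1)] sum_distrib_left sum_distrib_right case_prod_unfold)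
    finally show ?thesis by (simp add: mult.assoc)
  qed
  have left: "x * b \<in> B" if x: "x \<in> spanning" for x
    using assms(2)
  proof (induction rule: span_induct_alt)
    case (step c y z)
    have "x * y \<in> B" using x step(1) base unfolding spanning_def by blast
    then show ?case using step(2) by (simp add: distrib_left scale_times_right span_add span_scale)
  qed (simp add: span_zero)
  show ?thesis
    using assms(1)
  proof (induction rule: span_induct_alt)
    case (step c y z)
    then show ?case using left by (simp add: distrib_right scale_times_left span_add span_scale)
  qed (simp add: span_zero)
qed

end

section \<open>Quotient rings as subrings of a type\<close>

text \<open>
  The product of the quotients of a ring by all its ideals.  Being independent of any particular
  ideal it is a type, and it contains each of these quotients, so that one can calculate in
  a quotient by equational reasoning.
\<close>

definition ring_ideal :: "'a::ring set \<Rightarrow> bool"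
  where "ring_ideal I \<longleftrightarrow> 0 \<in> I \<and> (\<forall>x \<in> I. \<forall>y \<in> I. x - y \<in> I) \<and> (\<forall>a. \<forall>x \<in> I. a * x \<in> I \<and> x * a \<in> I)"

lemma ring_idealD:
  assumes "ring_ideal I"
  shows "0 \<in> I" "x \<in> I \<Longrightarrow> y \<in> I \<Longrightarrow> x - y \<in> I" "x \<in> I \<Longrightarrow> y \<in> I \<Longrightarrow> x + y \<in> I" "x \<in> I \<Longrightarrow> - x \<in> I"
    "x \<in> I \<Longrightarrow> a * x \<in> I" "x \<in> I \<Longrightarrow> x * a \<in> I"
proof -
  show 0: "0 \<in> I" and diff: "x \<in> I \<Longrightarrow> y \<in> I \<Longrightarrow> x - y \<in> I" for x y
    using assms by (auto simp: ring_ideal_def)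
  show minus: "x \<in> I \<Longrightarrow> - x \<in> I" for x using diff[OF 0, of x] by simp
  show "x \<in> I \<Longrightarrow> y \<in> I \<Longrightarrow> x + y \<in> I" using diff[of x "- y"] minus[of y] by simp
  show "x \<in> I \<Longrightarrow> a * x \<in> I" "x \<in> I \<Longrightarrow> x * a \<in> I" using assms by (auto simp: ring_ideal_def)
qed

\<comment> \<open>Families are indexed by all subsets but compared at ideals only; the components at
  other subsets are identified and carry no information.\<close>
quotient_type (overloaded) 'a quotients = "'a::ring set \<Rightarrow> 'a" /
  "\<lambda>f g. \<forall>I. ring_ideal I \<longrightarrow> f I - g I \<in> I"
proof (rule equivpI)
  show "reflp (\<lambda>f g. \<forall>I. ring_ideal I \<longrightarrow> f I - g I \<in> I)"
    by (rule reflpI) (simp add: ring_idealD)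
  show "symp (\<lambda>f g. \<forall>I. ring_ideal I \<longrightarrow> f I - g I \<in> I)"
    by (rule sympI) (metis ring_idealD(4) minus_diff_eq)
  show "transp (\<lambda>(f :: 'a set \<Rightarrow> 'a) g. \<forall>I. ring_ideal I \<longrightarrow> f I - g I \<in> I)"
  proof (rule transpI)
    fix f g h :: "'a set \<Rightarrow> 'a"
    assume *: "\<forall>I. ring_ideal I \<longrightarrow> f I - g I \<in> I" "\<forall>I. ring_ideal I \<longrightarrow> g I - h I \<in> I"
    show "\<forall>I. ring_ideal I \<longrightarrow> f I - h I \<in> I"
    proof (intro allI impI)
      fix I :: "'a set" assume "ring_ideal I"
      then have "(f I - g I) + (g I - h I) \<in> I" using * ring_idealD(3) by blast
      then show "f I - h I \<in> I" by simp
    qed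
  qed
qed

instantiation quotients :: (ring) ring
begin

lift_definition zero_quotients :: "'a quotients" is "\<lambda>I. 0" .

lift_definition plus_quotients :: "'a quotients \<Rightarrow> 'a quotients \<Rightarrow> 'a quotients" is "\<lambda>f g I. f I + g I"
proof -
  fix f f' g g' :: "'a set \<Rightarrow> 'a" and I :: "'a set"
  assume "\<And>I. ring_ideal I \<Longrightarrow> f I - f' I \<in> I" "\<And>I. ring_ideal I \<Longrightarrow> g I - g' I \<in> I" "ring_ideal I"
  then have "(f I - f' I) + (g I - g' I) \<in> I" using ring_idealD(3) by blast
  then show "f I + g I - (f' I + g' I) \<in> I" by (simp add: algebra_simps)
qed

lift_definition minus_quotients :: "'a quotients \<Rightarrow> 'a quotients \<Rightarrow> 'a quotients" is "\<lambda>f g I. f I - g I"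
proof -
  fix f f' g g' :: "'a set \<Rightarrow> 'a" and I :: "'a set"
  assume "\<And>I. ring_ideal I \<Longrightarrow> f I - f' I \<in> I" "\<And>I. ring_ideal I \<Longrightarrow> g I - g' I \<in> I" "ring_ideal I"
  then have "(f I - f' I) - (g I - g' I) \<in> I" using ring_idealD(2) by blast
  then show "f I - g I - (f' I - g' I) \<in> I" by (simp add: algebra_simps)
qed

lift_definition uminus_quotients :: "'a quotients \<Rightarrow> 'a quotients" is "\<lambda>f I. - f I"
proof -
  fix f f' :: "'a set \<Rightarrow> 'a" and I :: "'a set"
  assume "\<And>I. ring_ideal I \<Longrightarrow> f I - f' I \<in> I" "ring_ideal I"
  then have "- (f I - f' I) \<in> I" using ring_idealD(4) by blast
  then show "- f I - - f' I \<in> I" by simp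
qed

lift_definition times_quotients :: "'a quotients \<Rightarrow> 'a quotients \<Rightarrow> 'a quotients" is "\<lambda>f g I. f I * g I"
proof -
  fix f f' g g' :: "'a set \<Rightarrow> 'a" and I :: "'a set"
  assume "\<And>I. ring_ideal I \<Longrightarrow> f I - f' I \<in> I" "\<And>I. ring_ideal I \<Longrightarrow> g I - g' I \<in> I" "ring_ideal I"
  then have "(f I - f' I) * g I + f' I * (g I - g' I) \<in> I"
    using ring_idealD(3,5,6) by blast
  then show "f I * g I - f' I * g' I \<in> I" by (simp add: algebra_simps)
qed

instance
  by standard (transfer; simp add: ring_idealD algebra_simps)+

end

text \<open>The quotient by \<open>I\<close> sits in the factor at \<open>I\<close>, with 0 at all
  other ideals: an embedding of rings that need not preserve a unit.\<close>

lift_definition residue :: "'a::ring set \<Rightarrow> 'a \<Rightarrow> 'a quotients" is "\<lambda>I x J. if J = I then x else 0" .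

lemma residue_ops:
  "residue I (x + y) = residue I x + residue I y" "residue I (x - y) = residue I x - residue I y"
  "residue I (x * y) = residue I x * residue I y" "residue I 0 = 0"
  by (transfer; simp add: ring_idealD)+

lemma residue_eq_0_iff: "ring_ideal I \<Longrightarrow> residue I x = 0 \<longleftrightarrow> x \<in> I"
  by transfer (auto simp: ring_idealD)

lemma residue_eq_iff: "ring_ideal I \<Longrightarrow> residue I x = residue I y \<longleftrightarrow> x - y \<in> I"
  using residue_eq_0_iff[of I "x - y"] by (simp add: residue_ops)

lemma residue_sum: "residue I (\<Sum>i \<in> A. f i) = (\<Sum>i \<in> A. residue I (f i))"
  by (induction A rule: infinite_finite_induct) (simp_all add: residue_ops)

lemma residue_nprod: "xs \<noteq> [] \<Longrightarrow> residue I (nprod xs) = nprod (map (residue I) xs)"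
  by (induction xs rule: induct_list012) (simp_all add: residue_ops)

lift_definition lmult :: "'a::ring \<Rightarrow> 'a quotients \<Rightarrow> 'a quotients" is "\<lambda>a f I. a * f I"
  by (simp add: ring_idealD(5) flip: right_diff_distrib)

lemma lmult_simps:
  "lmult a (x + y) = lmult a x + lmult a y" "lmult (a + b) x = lmult a x + lmult b x"
  "lmult a x * y = lmult a (x * y)" "lmult a (lmult b x) = lmult (a * b) x"
  "lmult a (residue I c) = residue I (a * c)"
proof -
  show "lmult a (x + y) = lmult a x + lmult a y"
    by transfer (simp add: ring_idealD(1) distrib_left)
  show "lmult (a + b) x = lmult a x + lmult b x"
    by transfer (simp add: ring_idealD(1) distrib_right)
  show "lmult a x * y = lmult a (x * y)"
    by transfer (simp add: ring_idealD(1) mult.assoc)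
  show "lmult a (lmult b x) = lmult (a * b) x"
    by (induction x rule: quotients.abs_induct) (simp add: lmult.abs_eq mult.assoc)
  show "lmult a (residue I c) = residue I (a * c)"
    by transfer (simp add: ring_idealD(1))
qed

lemma lmult_one: "lmult 1 x = (x :: 'a::ring_1 quotients)"
  by transfer (simp add: ring_idealD(1))

lemma lmult_central: "(\<And>b. b * a = a * b) \<Longrightarrow> x * lmult a y = lmult a (x * y)"
  by transfer (metis (no_types, lifting) diff_self mult.assoc ring_idealD(1))

text \<open>Scalars are the multiples \<open>single 0 c\<close> of the empty word in the free
  algebra with unit. They are central, so multiplication by them is compatible with the
  product.\<close>

definition scale_quotients ::
    "'r::comm_ring_1 \<Rightarrow> ('g word \<Rightarrow>\<^sub>0 'r) quotients \<Rightarrow> ('g word \<Rightarrow>\<^sub>0 'r) quotients"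
  where "scale_quotients c = lmult (Poly_Mapping.single 0 c)"

lemma type_algebra_quotients: "type_algebra (scale_quotients :: 'r::comm_ring_1 \<Rightarrow> _)"
  by unfold_locales
    (simp_all add: scale_quotients_def lmult_simps lmult_one single_add mult_single
      lmult_central[OF single_zero_central])

lemma residue_scale: "residue I (Poly_Mapping.single 0 c * x) = scale_quotients c (residue I x)"
  by (simp add: scale_quotients_def lmult_simps)


section \<open>The Kumjian--Pask algebra as a quotient\<close>

lemma poly_mapping_sum_induct:
  fixes a :: "'w \<Rightarrow>\<^sub>0 'r::comm_ring_1"
  assumes "P 0" "\<And>x y. P x \<Longrightarrow> P y \<Longrightarrow> P (x + y)"
    "\<And>w c. w \<in> Poly_Mapping.keys a \<Longrightarrow> P (Poly_Mapping.single w c)"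
  shows "P a"
proof -
  have "P (\<Sum>w \<in> W. Poly_Mapping.single w (Poly_Mapping.lookup a w))"
    if "W \<subseteq> Poly_Mapping.keys a" for W
    using that by (induction W rule: infinite_finite_induct) (auto intro: assms)
  then show ?thesis by (subst poly_mapping_monomials) simp
qed

text \<open>
  \<open>N'\<close> is obtained from \<open>N\<close> by adding the noncommutative polynomials all of whose words contain
  a letter outside \<open>X\<close>.
\<close>

lemma extend_ideal_of_free_algebra:
  fixes N :: "('g word \<Rightarrow>\<^sub>0 'r::comm_ring_1) set"
  assumes N: "algebra_ideal (free_algebra X) N"
  obtains N' where "ring_ideal N'" "N' \<inter> carrier (free_algebra X) = N"
proof -
  let ?F = "free_algebra X :: ('r, 'g word \<Rightarrow>\<^sub>0 'r) nualgebra"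
  note NI = ideal_free_closed[OF N]
  define Z :: "('g word \<Rightarrow>\<^sub>0 'r) set"
    where "Z = {p. \<forall>w \<in> Poly_Mapping.keys p. \<not> set (letters w) \<subseteq> X}"
  have Z0: "0 \<in> Z" by (simp add: Z_def)
  have Z_diff: "x - y \<in> Z" if "x \<in> Z" "y \<in> Z" for x y
    using that keys_diff[of x y] unfolding Z_def by blast
  have Z_mult: "a * x \<in> Z \<and> x * a \<in> Z" if "x \<in> Z" for a x
    using that keys_mult[of a x] keys_mult[of x a] unfolding Z_def
    by (auto simp: letters_add subset_iff) (smt (verit, ccfv_threshold) Un_iff letters_add mem_Collect_eq set_append subsetD)+
  define N' where "N' = {n + z |n z. n \<in> N \<and> z \<in> Z}"
  have NN': "N \<subseteq> N'" "Z \<subseteq> N'" using Z0 NI(2) unfolding N'_def by force+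
  have add: "x + y \<in> N'" if "x \<in> N'" "y \<in> N'" for x y
  proof -
    obtain n z m w where "x = n + z" "y = m + w" "n \<in> N" "m \<in> N" "z \<in> Z" "w \<in> Z"
      using \<open>x \<in> N'\<close> \<open>y \<in> N'\<close> unfolding N'_def by blast
    moreover from this have "n + m \<in> N" "z + w \<in> Z"
      using NI(3) Z_diff[OF _ Z_diff[OF Z0], of z w] by simp_all
    ultimately show ?thesis
      unfolding N'_def by (intro CollectI exI[of _ "n + m"] exI[of _ "z + w"]) (simp add: algebra_simps)
  qed
  have mult: "a * n \<in> N' \<and> n * a \<in> N'" if n: "n \<in> N" for a n
  proof (rule poly_mapping_sum_induct[of "\<lambda>a. a * n \<in> N' \<and> n * a \<in> N'"])
    fix w :: "'g word" and c :: 'r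
    \<comment> \<open>The empty word acts as a scalar, under which \<open>N\<close> is closed as an
      algebra ideal; words in \<open>X\<close> act within the free algebra; all other words send
      \<open>N\<close> into \<open>Z\<close>.\<close>
    consider "w = 0" | "w \<noteq> 0" "set (letters w) \<subseteq> X" | "\<not> set (letters w) \<subseteq> X" by blast
    then show "Poly_Mapping.single w c * n \<in> N' \<and> n * Poly_Mapping.single w c \<in> N'"
    proof cases
      case 1
      then show ?thesis
        using NI(7)[OF n, of c] NN' single_zero_central[of n c] by (auto simp: scale_conv_mult)
    next
      case 2
      then have "Poly_Mapping.single w c \<in> carrier ?F" by (simp add: free_algebra_def)
      then show ?thesis using NI(5,6) n NN' by blast
    next
      case 3
      then have "Poly_Mapping.single w c \<in> Z" by (simp add: Z_def)
      then show ?thesis using Z_mult NN' by blast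
    qed
  qed (use NN' NI(2) add in \<open>auto simp: distrib_left distrib_right\<close>)
  have "ring_ideal N'"
    unfolding ring_ideal_def
  proof (intro conjI ballI allI)
    show "0 \<in> N'" using NN' NI(2) by blast
    fix x assume "x \<in> N'"
    then obtain n z where x: "x = n + z" "n \<in> N" "z \<in> Z" unfolding N'_def by blast
    show "a * x \<in> N'" "x * a \<in> N'" for a
      using add mult[OF x(2), of a] Z_mult[OF x(3), of a] NN' by (auto simp: x(1) distrib_left distrib_right)
    fix y assume "y \<in> N'"
    then obtain m w where y: "y = m + w" "m \<in> N" "w \<in> Z" unfolding N'_def by blast
    have "- m \<in> N'" "- w \<in> N'" using NN' NI(4)[OF y(2)] Z_diff[OF Z0 y(3)] by auto
    then show "x - y \<in> N'" using add[OF \<open>x \<in> N'\<close> add[of "- m" "- w"]] by (simp add: y(1) algebra_simps)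
  qed
  moreover have "N' \<inter> carrier ?F = N"
  proof (intro equalityI subsetI)
    fix x assume "x \<in> N' \<inter> carrier ?F"
    then obtain n z where x: "x = n + z" "n \<in> N" "z \<in> Z" "x \<in> carrier ?F" unfolding N'_def by blast
    \<comment> \<open>Every word of \<open>z\<close> has a letter outside \<open>X\<close>, while as
      a difference of elements of the carrier \<open>z\<close> only has words in \<open>X\<close>.
      Hence \<open>z = 0\<close>.\<close>
    have "z = x - n" using x(1) by simp
    then have "z \<in> carrier ?F" using x(2,4) NI(1) free_algebra_closed(4)[of x X n] by auto
    then have "Poly_Mapping.keys z = {}" using x(3) by (auto simp: Z_def free_algebra_def)
    then show "x \<in> N" using x by simp
  qed (use NI(1) NN' in blast)
  ultimately show thesis using that by blast
qed

lemma residue_kp_family: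
  fixes \<Lambda> :: "('a, 'k::finite) kgraph" and N' :: "('a gen word \<Rightarrow>\<^sub>0 'r::comm_ring_1) set"
  assumes \<Lambda>: "k_graph \<Lambda>" and N': "ring_ideal N'" "kp_ideal \<Lambda> \<subseteq> N'"
  shows "kp_family \<Lambda> (\<lambda>g. residue N' (free_gen g))"
  unfolding kp_family_def
proof
  let ?S = "\<lambda>g. residue N' (free_gen g)"
  have gen: "kp_relators \<Lambda> free_gen \<subseteq> (kp_ideal \<Lambda> :: ('a gen word \<Rightarrow>\<^sub>0 'r) set)"
    using algebra_ideal_generated(2)[OF nonunital_algebra_free kp_relators_closed[OF \<Lambda>]]
    by (simp add: kp_ideal_def)
  have zero: "residue N' y = 0" if "y \<in> kp_relators \<Lambda> free_gen" for y
    using that gen N' by (subst residue_eq_0_iff) auto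
  fix x assume "x \<in> kp_relators \<Lambda> ?S"
  then show "x = 0"
  proof cases
    case (KP1_idem v)
    then show ?thesis using zero[OF kp_relators.KP1_idem[of v]] by (simp add: residue_ops)
  next
    case (KP1_orth v w)
    then show ?thesis using zero[OF kp_relators.KP1_orth[of v _ w]] by (simp add: residue_ops)
  next
    case (KP2_path \<alpha> \<mu>)
    then show ?thesis using zero[OF kp_relators.KP2_path[of \<alpha> _ \<mu>]] by (simp add: residue_ops)
  next
    case (KP2_ghost \<alpha> \<mu>)
    then show ?thesis using zero[OF kp_relators.KP2_ghost[of \<alpha> _ \<mu>]] by (simp add: residue_ops)
  next
    case (KP3 \<alpha> \<mu>)
    then show ?thesis
      using zero[OF kp_relators.KP3[of \<alpha> _ \<mu>]]
      by (simp add: residue_ops residue_sum case_prod_unfold)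
  next
    case (KP4 v ls)
    have "ls \<noteq> []" using KP4 FE_nonempty[OF _ \<Lambda>] by auto
    then show ?thesis
      using zero[OF kp_relators.KP4[OF KP4(2-4)]] KP4(1)
      by (simp add: residue_ops residue_nprod comp_def)
  qed
qed

theorem theorem9p4:
  fixes \<Lambda> :: "('a, 'k::finite) kgraph"
  assumes "k_graph \<Lambda>"
    and "finitely_aligned \<Lambda>"
    and "vertices \<Lambda> \<noteq> {}"
  shows "simple_algebra (kumjian_pask \<Lambda> :: ('r::comm_ring_1, ('a gen word \<Rightarrow>\<^sub>0 'r) set) nualgebra)
    \<longleftrightarrow> (\<forall>c::'r. c \<noteq> 0 \<longrightarrow> (\<exists>d. c * d = 1)) \<and> aperiodic_graph \<Lambda> \<and> cofinal_graph \<Lambda>"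
proof
  interpret k_graph \<Lambda> by fact
  assume simple: "simple_algebra (kumjian_pask \<Lambda> :: ('r, ('a gen word \<Rightarrow>\<^sub>0 'r) set) nualgebra)"
  \<comment> \<open>The vertex forces the field property: for an empty graph the algebra is zero and
    satisfies \<open>simple_algebra\<close> over every ring.\<close>
  obtain v where v: "v \<in> vertices \<Lambda>" using assms(3) by blast
  show "(\<forall>c::'r. c \<noteq> 0 \<longrightarrow> (\<exists>d. c * d = 1)) \<and> aperiodic_graph \<Lambda> \<and> cofinal_graph \<Lambda>"
    using simple_imp_field[OF assms(2) simple v] simple_imp_separating[OF assms(2) simple]
      simple_imp_cofinal[OF assms(2) simple] aperiodic_graph_iff[OF assms(2)] by blast
next
  interpret k_graph \<Lambda> by fact
  assume cond: "(\<forall>c::'r. c \<noteq> 0 \<longrightarrow> (\<exists>d. c * d = 1)) \<and> aperiodic_graph \<Lambda> \<and> cofinal_graph \<Lambda>"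
  let ?F = "kp_free \<Lambda> :: ('r, 'a gen word \<Rightarrow>\<^sub>0 'r) nualgebra"
  let ?N = "kp_ideal \<Lambda> :: ('a gen word \<Rightarrow>\<^sub>0 'r) set"
  let ?K = "kumjian_pask \<Lambda> :: ('r, ('a gen word \<Rightarrow>\<^sub>0 'r) set) nualgebra"
  let ?c = "acoset ?F ?N"
  have N: "algebra_ideal ?F ?N"
    using algebra_ideal_generated(1)[OF nonunital_algebra_free kp_relators_closed[OF assms(1)]]
    by (simp add: kp_ideal_def)
  note NI = ideal_free_closed[OF N]
  note ops = quotient_free_ops[OF N, folded kumjian_pask_def]
  have carrier: "carrier ?K = ?c ` carrier ?F" and zero: "azero ?K = ?c 0"
    by (simp_all add: kumjian_pask_def quotient_algebra_def)
  \<comment> \<open>Residues need an ideal of the whole ring of polynomials. Since \<open>N'\<close>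
    meets the carrier exactly in the Kumjian-Pask ideal, \<open>residue N'\<close> identifies the
    same elements of the carrier as passing to cosets does.\<close>
  obtain N' where N': "ring_ideal N'" "N' \<inter> carrier ?F = ?N"
    using extend_ideal_of_free_algebra[OF N] .
  have res_eq: "residue N' x = residue N' y \<longleftrightarrow> ?c x = ?c y" if "x \<in> carrier ?F" "y \<in> carrier ?F" for x y
    using N'(2) free_algebra_closed(4)[OF that]
    by (auto simp: residue_eq_iff[OF N'(1)] acoset_free_eq_iff[OF N])
  let ?S = "\<lambda>g. residue N' (free_gen g)"
  interpret kp_algebra \<Lambda> scale_quotients ?S
  proof (intro kp_algebra.intro kp_algebra_axioms.intro assms type_algebra_quotients residue_kp_family N')
    show "?N \<subseteq> N'" using N'(2) by blast
  qed
  have gens: "?S g \<in> B" if "g \<in> kp_generators \<Lambda>" for g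
  proof -
    have "\<exists>\<alpha> \<in> mor \<Lambda>. g = Path \<alpha> \<or> g = ghost \<Lambda> \<alpha>"
      using that by (force simp: kp_generators_def ghost_def)
    then obtain \<alpha> where "\<alpha> \<in> mor \<Lambda>" "g = Path \<alpha> \<or> g = ghost \<Lambda> \<alpha>" by blast
    then show ?thesis using path_ghost_in_B[of \<alpha>] by (auto simp: p_def q_def)
  qed
  \<comment> \<open>Together with \<open>B'\<close> below, this identifies \<open>B\<close> with the
    image of the carrier, that is, with a copy of the Kumjian-Pask algebra.\<close>
  have B: "residue N' x \<in> B" if x: "x \<in> carrier ?F" for x
  proof (rule poly_mapping_sum_induct[of "\<lambda>x. residue N' x \<in> B"])
    fix w :: "'a gen word" and k :: 'r
    assume "w \<in> Poly_Mapping.keys x"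
    then have w: "letters w \<noteq> []" "set (letters w) \<subseteq> kp_generators \<Lambda>"
      using x by (cases w; force simp: free_algebra_def zero_word_def)+
    have "residue N' (Poly_Mapping.single w 1) \<in> B"
      using w
    proof (induction "letters w" arbitrary: w rule: induct_list012)
      case (2 g)
      then have w: "w = Word [g]" by (cases w) simp
      then show ?case using gens[of g] 2(3) by (simp add: free_gen_def)
    next
      case (3 g h gs)
      then have w: "w = Word (g # h # gs)" by (cases w) simp
      then have "Poly_Mapping.single w (1::'r) = free_gen g * Poly_Mapping.single (Word (h # gs)) 1"
        by (simp add: free_gen_def mult_single plus_word_def)
      moreover have "residue N' (Poly_Mapping.single (Word (h # gs)) 1) \<in> B"
        using 3(2)[of "Word (h # gs)"] 3(5) w by simp
      ultimately show ?case
        using B_mult gens[of g] 3(5) w by (simp add: residue_ops)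
    qed simp
    then have "scale_quotients k (residue N' (Poly_Mapping.single w 1)) \<in> B" by (rule span_scale)
    then show "residue N' (Poly_Mapping.single w k) \<in> B"
      by (simp add: mult_single flip: residue_scale)
  qed (simp_all add: residue_ops span_zero span_add)
  have B': "\<exists>x \<in> carrier ?F. residue N' x = b" if "b \<in> B" for b
    using that
  proof (induction rule: span_induct_alt)
    case base
    show ?case using free_algebra_closed(1) by (intro bexI[of _ 0]) (simp_all add: residue_ops)
  next
    case (step k u y)
    then obtain x where x: "x \<in> carrier ?F" "residue N' x = y" by blast
    obtain \<alpha> \<beta> where ab: "\<alpha> \<in> mor \<Lambda>" "\<beta> \<in> mor \<Lambda>" "u = p \<alpha> * q \<beta>"
      using step by (auto simp: spanning_def)
    let ?z = "Poly_Mapping.single 0 k * (free_gen (Path \<alpha>) * free_gen (ghost \<Lambda> \<beta>)) + x"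
    have "?z \<in> carrier ?F"
      using ab x by (intro free_algebra_closed free_gen_closed kp_generatorsI)
    moreover have "residue N' ?z = scale_quotients k u + y"
      by (subst residue_ops(1), subst residue_scale, subst residue_ops(3))
        (simp only: ab(3) p_def q_def x(2))
    ultimately show ?case by blast
  qed
  show "simple_algebra ?K"
    unfolding simple_algebra_def
  proof (intro allI impI)
    fix I assume I: "two_sided_ideal ?K I"
    then have I_sub: "I \<subseteq> ?c ` carrier ?F" and I_zero: "?c 0 \<in> I"
      and I_add: "\<And>x y. \<lbrakk>x \<in> I; y \<in> I\<rbrakk> \<Longrightarrow> aadd ?K x y \<in> I"
      and I_minus: "\<And>x. x \<in> I \<Longrightarrow> \<exists>y \<in> I. aadd ?K x y = ?c 0"
      and I_mult: "\<And>x a. \<lbrakk>x \<in> I; a \<in> ?c ` carrier ?F\<rbrakk> \<Longrightarrow> amult ?K a x \<in> I \<and> amult ?K x a \<in> I"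
      unfolding two_sided_ideal_def carrier zero by blast+
    \<comment> \<open>The copy of \<open>I\<close> inside \<open>B\<close>; the facts about
      \<open>J\<close> that follow are those required by \<open>ideal_eq_top\<close>.\<close>
    define J where "J = {residue N' x |x. x \<in> carrier ?F \<and> ?c x \<in> I}"
    have J_diff: "x - y \<in> J" if "x \<in> J" "y \<in> J" for x y
    proof -
      obtain x' y' where x': "x = residue N' x'" "x' \<in> carrier ?F" "?c x' \<in> I"
        and y': "y = residue N' y'" "y' \<in> carrier ?F" "?c y' \<in> I"
        using \<open>x \<in> J\<close> \<open>y \<in> J\<close> unfolding J_def by blast
      obtain z where z: "z \<in> carrier ?F" "?c z \<in> I" "aadd ?K (?c y') (?c z) = ?c 0"
        using I_minus[OF y'(3)] I_sub by blast
      then have "y' + z \<in> ?N" using ops(1)[OF y'(2) z(1)] acoset_free_eq_iff[OF N, of "y' + z" 0] by simp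
      \<comment> \<open>The coset of \<open>z\<close> is an additive inverse of that of
        \<open>y'\<close>, so adding \<open>z\<close> represents the subtraction that is not an
        operation of the quotient.\<close>
      then have "(x' + z) - (x' - y') \<in> ?N" by (simp add: algebra_simps)
      then have "?c (x' - y') = ?c (x' + z)" using acoset_free_eqI[OF N] by metis
      also have "\<dots> \<in> I" using I_add[OF x'(3) z(2)] ops(1)[OF x'(2) z(1)] by simp
      finally have "?c (x' - y') \<in> I" .
      moreover have "x - y = residue N' (x' - y')" by (simp add: x'(1) y'(1) residue_ops)
      ultimately show ?thesis
        unfolding J_def using free_algebra_closed(4)[OF x'(2) y'(2)] by blast
    qed
    have J_mult: "a * x \<in> J \<and> x * a \<in> J" if a: "a \<in> B" and x: "x \<in> J" for a x
    proof -
      obtain x' where x': "x = residue N' x'" "x' \<in> carrier ?F" "?c x' \<in> I"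
        using x unfolding J_def by blast
      obtain a' where a': "a' \<in> carrier ?F" "residue N' a' = a" using B' a by blast
      have "?c (a' * x') \<in> I" "?c (x' * a') \<in> I"
        using I_mult[OF x'(3), of "?c a'"] a'(1) ops(2)[OF a'(1) x'(2)] ops(2)[OF x'(2) a'(1)] by simp_all
      moreover have "a * x = residue N' (a' * x')" "x * a = residue N' (x' * a')"
        using a'(2) x'(1) by (simp_all add: residue_ops)
      ultimately show ?thesis
        unfolding J_def using free_algebra_closed(5)[OF a'(1) x'(2)] free_algebra_closed(5)[OF x'(2) a'(1)]
        by blast
    qed
    have J_sub: "J \<subseteq> B" using B by (auto simp: J_def)
    have J_zero: "0 \<in> J" unfolding J_def using I_zero free_algebra_closed(1) residue_ops(4) by force
    show "I = {azero ?K} \<or> I = carrier ?K"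
    proof (cases "I = {azero ?K}")
      case False
      then obtain x where x: "x \<in> carrier ?F" "?c x \<in> I" "?c x \<noteq> ?c 0"
        using I_sub I_zero unfolding zero by blast
      have "residue N' x \<in> J" using x unfolding J_def by blast
      moreover have "residue N' x \<noteq> 0"
        using res_eq[OF x(1) free_algebra_closed(1)] x(3) by (simp add: residue_ops)
      ultimately have "J \<noteq> {0}" by blast
      then have BJ: "B \<subseteq> J"
        using ideal_eq_top[OF J_zero J_sub J_diff] J_mult cond aperiodic_graph_iff[OF assms(2)] by blast
      have "?c y \<in> I" if y: "y \<in> carrier ?F" for y
      proof -
        have "residue N' y \<in> J" using B[OF y] BJ by blast
        then obtain y' where "residue N' y = residue N' y'" "y' \<in> carrier ?F" "?c y' \<in> I"
          unfolding J_def by blast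
        then show ?thesis using res_eq[OF y] by metis
      qed
      then show ?thesis using I_sub unfolding carrier by blast
    qed simp
  qed
qed

end
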